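(* Let $S_l=\{(x_i,y_i,m_i)\}_{i=1}^{n_l}$ and $S_u=\{(x_{i+n_l},y_{i+n_l})\}_{i=1}^{n_u}$ be two i.i.d. sample sets drawn from the distribution $\mu_{XYM}$ that are, respectively, labeled and not labeled by the human. Assume that the optimal classifier $\bar h=\arg\min_{h}\mathbb{E}_{X,Y\sim\mu_{XY}}[\mathbb{I}_{h(X)\neq Y}]$ (minimum over all functions $h$) is a member of $\mathcal{H}$. Let $(\hat h,\hat r)$ be the staged solution and let $(\tilde h,\tilde r)$ be the joint solution obtained by learning only on $S_l$. Then there is a universal constant $C$ such that, with probability at least $1-\delta$, for staged learning $$L_{\mathrm{def}}^{0-1}(\hat h,\hat r)\le L_{\mathrm{def}}^{0-1}(h^*,r^* )+\mathfrak{R}_{n_u}(\mathcal{H})+2\mathfrak{R}_{n_l}(\mathcal{R})+2\min\big\{\Pr(M\neq Y),\ \mathfrak{R}_{n_l\Pr(M\neq Y)/2}(\mathcal{R})\big\}+C\sqrt{\frac{\log (1/\delta)}{\min(n_l,n_u)}}+\Pr(M\neq Y)\,e^{-n_l\frac{\Pr(M\neq Y)^2}{2}},$$ while for joint learning $$L_{\mathrm{def}}^{0-1}(\tilde h,\tilde r)\le L_{\mathrm{def}}^{0-1}(h^*,r^* )+\mathfrak{R}_{n_l}(\mathcal{H})+2\mathfrak{R}_{n_l}(\mathcal{R})+2\mathfrak{R}_{n_l\Pr(M\neq Y)/2}(\mathcal{R})+C\sqrt{\frac{\log (1/\delta)}{n_l}}+\Pr(M\neq Y)\,e^{-n_l\frac{\Pr(M\neq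 Y)}{2}}.$$
   Context: Setting: features $X\in\mathcal{X}$, binary label $Y\in\{0,1\}$, expert (human) prediction $M$, with joint law $\mu_{XYM}$. Classifiers $h:\mathcal{X}\to\{0,1\}$ lie in a class $\mathcal{H}$, rejectors $r:\mathcal{X}\to\{0,1\}$ lie in a class $\mathcal{R}$ ($r(x)=1$ means defer to the expert). The deferral loss is $L_{\mathrm{def}}^{0-1}(h,r)=\mathbb{E}[\mathbb{I}_{h(X)\neq Y}\mathbb{I}_{r(X)=0}+\mathbb{I}_{M\neq Y}\mathbb{I}_{r(X)=1}]$, and $(h^*,r^* )=\arg\min_{(h,r)\in\mathcal{H}\times\mathcal{R}}L_{\mathrm{def}}^{0-1}(h,r)$. Joint solution (using only $S_l$): $(\tilde h,\tilde r)=\arg\min_{(h,r)\in\mathcal{H}\times\mathcal{R}}\sum_{i\in S_l}\mathbb{I}_{h(x_i)\neq y_i}\mathbb{I}_{r(x_i)=0}+\mathbb{I}_{y_i\neq m_i}\mathbb{I}_{r(x_i)=1}$. Staged solution: $\hat h=\arg\min_{h\in\mathcal{H}}\sum_{i\in S_u}\mathbb{I}_{h(x_i)\neq y_i}$, then $\hat r=\arg\min_{r\in\mathcal{R}}\sum_{i\in S_l}\mathbb{I}_{\hat h(x_i)\neq y_i}\mathbb{I}_{r(x_i)=0}+\mathbb{I}_{y_i\neq m_i}\mathbb{I}_{r(x_i)=1}$. $\mathfrak{R}_n(\mathcal{F})=\mathbb{E}_{x_1,\dots,x_n}\mathbb{E}_{\sigma}\big[\frac1n\sup_{f\in\mathcal{F}}\sum_{i=1}^n\sigma_i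 f(x_i)\big]$ is the Rademacher complexity, where $x_1,\dots,x_n$ are i.i.d. copies of $X$ and $\sigma_i$ are i.i.d. uniform on $\{-1,1\}$. For non-integer $m>0$, $\mathfrak{R}_m$ is read as $\mathfrak{R}_{\lceil m\rceil}$.
   Formalization: In R_n(H) classifiers are coded as -1/1 (twice the literal {0,1} value), since with {0,1} both bounds fail (Y=M=0, H all functions, R={0}). C is uniform over each fixed feature set; full universality follows by a disjoint union of counterexamples. *)

theory Defs
  imports "HOL-Probability.Probability"
begin

text \<open>
  Binary values (labels, expert predictions, outputs of classifiers and rejectors) are
  booleans, with \<open>True\<close> for 1; \<open>r x\<close> means that \<open>r\<close> defers on \<open>x\<close>.  An example is a triple
  \<open>(x, y, m)\<close> of features, label and expert prediction.  The measure \<open>MX\<close> only carries the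
  sigma-algebra of the feature space; the law of the features is \<open>law_X MX \<mu>\<close>.
\<close>

definition law_X :: "'a measure \<Rightarrow> ('a \<times> bool \<times> bool) measure \<Rightarrow> 'a measure" where
  "law_X MX \<mu> = distr \<mu> MX fst"

definition law_XY :: "'a measure \<Rightarrow> ('a \<times> bool \<times> bool) measure \<Rightarrow> ('a \<times> bool) measure" where
  "law_XY MX \<mu> = distr \<mu> (MX \<Otimes>\<^sub>M count_space UNIV) (\<lambda>(x, y, m). (x, y))"

definition expert_error :: "('a \<times> bool \<times> bool) measure \<Rightarrow> real" where
  "expert_error \<mu> = measure \<mu> {z \<in> space \<mu>. case z of (x, y, m) \<Rightarrow> m \<noteq> y}"

definition loss01 :: "('a \<Rightarrow> bool) \<Rightarrow> 'a \<times> bool \<Rightarrow> real" where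
  "loss01 h = (\<lambda>(x, y). of_bool (h x \<noteq> y))"

definition defer_loss :: "('a \<Rightarrow> bool) \<Rightarrow> ('a \<Rightarrow> bool) \<Rightarrow> 'a \<times> bool \<times> bool \<Rightarrow> real" where
  "defer_loss h r = (\<lambda>(x, y, m).
     of_bool (h x \<noteq> y) * of_bool (\<not> r x) + of_bool (m \<noteq> y) * of_bool (r x))"

definition L_def :: "('a \<times> bool \<times> bool) measure \<Rightarrow> ('a \<Rightarrow> bool) \<Rightarrow> ('a \<Rightarrow> bool) \<Rightarrow> real" where
  "L_def \<mu> h r = (\<integral>z. defer_loss h r z \<partial>\<mu>)"

definition optimal_pair ::
  "('a \<times> bool \<times> bool) measure \<Rightarrow> ('a \<Rightarrow> bool) set \<Rightarrow> ('a \<Rightarrow> bool) set \<Rightarrow>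
   ('a \<Rightarrow> bool) \<times> ('a \<Rightarrow> bool) \<Rightarrow> bool" where
  "optimal_pair \<mu> H R hr \<longleftrightarrow>
     is_arg_min (\<lambda>(h, r). L_def \<mu> h r) (\<lambda>hr. hr \<in> H \<times> R) hr"

definition optimal_classifier ::
  "'a measure \<Rightarrow> ('a \<times> bool \<times> bool) measure \<Rightarrow> ('a \<Rightarrow> bool) \<Rightarrow> bool" where
  "optimal_classifier MX \<mu> h \<longleftrightarrow>
     is_arg_min (\<lambda>g. \<integral>z. loss01 g z \<partial>law_XY MX \<mu>) (\<lambda>g. g \<in> MX \<rightarrow>\<^sub>M count_space UNIV) h"

definition joint_solution ::
  "('a \<Rightarrow> bool) set \<Rightarrow> ('a \<Rightarrow> bool) set \<Rightarrow> nat \<Rightarrow> (nat \<Rightarrow> 'a \<times> bool \<times> bool) \<Rightarrow>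
   ('a \<Rightarrow> bool) \<times> ('a \<Rightarrow> bool) \<Rightarrow> bool" where
  "joint_solution H R nl Sl hr \<longleftrightarrow>
     is_arg_min (\<lambda>(h, r). \<Sum>i<nl. defer_loss h r (Sl i)) (\<lambda>hr. hr \<in> H \<times> R) hr"

definition staged_classifier ::
  "('a \<Rightarrow> bool) set \<Rightarrow> nat \<Rightarrow> (nat \<Rightarrow> 'a \<times> bool) \<Rightarrow> ('a \<Rightarrow> bool) \<Rightarrow> bool" where
  "staged_classifier H nu Su h \<longleftrightarrow>
     is_arg_min (\<lambda>h. \<Sum>i<nu. loss01 h (Su i)) (\<lambda>h. h \<in> H) h"

definition staged_rejector ::
  "('a \<Rightarrow> bool) set \<Rightarrow> nat \<Rightarrow> (nat \<Rightarrow> 'a \<times> bool \<times> bool) \<Rightarrow> ('a \<Rightarrow> bool) \<Rightarrow>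
   ('a \<Rightarrow> bool) \<Rightarrow> bool" where
  "staged_rejector R nl Sl h r \<longleftrightarrow>
     is_arg_min (\<lambda>r. \<Sum>i<nl. defer_loss h r (Sl i)) (\<lambda>r. r \<in> R) r"

text \<open>
  For \<open>n = 0\<close> the value is 0, because \<open>x / 0 = 0\<close>.
\<close>

definition rademacher :: "'a measure \<Rightarrow> nat \<Rightarrow> ('a \<Rightarrow> real) set \<Rightarrow> real" where
  "rademacher D n F =
     (\<integral>x. measure_pmf.expectation (Pi_pmf {..<n} 0 (\<lambda>_. pmf_of_set {-1, 1}))
            (\<lambda>\<sigma>. 1 / real n * (SUP f\<in>F. \<Sum>i<n. \<sigma> i * f (x i)))
        \<partial>(\<Pi>\<^sub>M i\<in>{..<n}. D))"

text \<open>
  The Bochner integral of a non-measurable function is 0, so the suprema in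
  \<open>rademacher\<close> have to be measurable for its value to be meaningful.
\<close>

definition measurable_suprema :: "'a measure \<Rightarrow> ('a \<Rightarrow> real) set \<Rightarrow> bool" where
  "measurable_suprema D F \<longleftrightarrow>
     (\<forall>n::nat. \<forall>\<sigma> \<in> {..<n} \<rightarrow> {-1, 1}.
        (\<lambda>x. SUP f\<in>F. \<Sum>i<n. \<sigma> i * f (x i)) \<in> borel_measurable (\<Pi>\<^sub>M i\<in>{..<n}. D))"

text \<open>
  Rejectors enter the complexity with values 0 and 1.  Classifiers enter it with their labels
  coded as -1 and 1, the coding for which the generalization bound of binary classification has
  coefficient 1 in front of the complexity.  With labels 0 and 1 the coefficient 1 would be
  too small: if the features are uniform on \<open>N\<close> points, all labels are 0 and every function is
  a classifier, then the complexity is at most 1/2, while the empirical risk minimizer that is 1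
  off the sample has error at least \<open>1 - n / N\<close>.
\<close>

definition classifier_functions :: "('a \<Rightarrow> bool) set \<Rightarrow> ('a \<Rightarrow> real) set" where
  "classifier_functions H = (\<lambda>h x. if h x then 1 else -1) ` H"

definition rejector_functions :: "('a \<Rightarrow> bool) set \<Rightarrow> ('a \<Rightarrow> real) set" where
  "rejector_functions R = (\<lambda>r x. of_bool (r x)) ` R"

definition deferral_setting ::
  "'a measure \<Rightarrow> ('a \<times> bool \<times> bool) measure \<Rightarrow> ('a \<Rightarrow> bool) set \<Rightarrow> ('a \<Rightarrow> bool) set \<Rightarrow> bool" where
  "deferral_setting MX \<mu> H R \<longleftrightarrow>
     prob_space \<mu> \<and>
     sets \<mu> = sets (MX \<Otimes>\<^sub>M (count_space UNIV \<Otimes>\<^sub>M count_space UNIV)) \<and>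
     H \<subseteq> MX \<rightarrow>\<^sub>M count_space UNIV \<and>
     R \<subseteq> MX \<rightarrow>\<^sub>M count_space UNIV \<and>
     measurable_suprema MX (classifier_functions H) \<and>
     measurable_suprema MX (rejector_functions R)"

definition law_Sl :: "nat \<Rightarrow> ('a \<times> bool \<times> bool) measure \<Rightarrow> (nat \<Rightarrow> 'a \<times> bool \<times> bool) measure" where
  "law_Sl nl \<mu> = (\<Pi>\<^sub>M i\<in>{..<nl}. \<mu>)"

definition law_Su :: "nat \<Rightarrow> 'a measure \<Rightarrow> ('a \<times> bool \<times> bool) measure \<Rightarrow> (nat \<Rightarrow> 'a \<times> bool) measure" where
  "law_Su nu MX \<mu> = (\<Pi>\<^sub>M i\<in>{..<nu}. law_XY MX \<mu>)"

text \<open>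
  Learning rules choose one minimizer for every sample, measurably in the sample and the
  features together.  The staged classifier is a function of \<open>Su\<close> alone, so ties between
  minimizers cannot be broken with knowledge of \<open>Sl\<close>.
\<close>

definition measurable_rule :: "'s measure \<Rightarrow> 'a measure \<Rightarrow> ('s \<Rightarrow> 'a \<Rightarrow> bool) \<Rightarrow> bool" where
  "measurable_rule S MX g \<longleftrightarrow> (\<lambda>(s, x). g s x) \<in> S \<Otimes>\<^sub>M MX \<rightarrow>\<^sub>M count_space UNIV"

definition staged_rule ::
  "'a measure \<Rightarrow> ('a \<times> bool \<times> bool) measure \<Rightarrow> ('a \<Rightarrow> bool) set \<Rightarrow> ('a \<Rightarrow> bool) set \<Rightarrow>
   nat \<Rightarrow> nat \<Rightarrow> ((nat \<Rightarrow> 'a \<times> bool) \<Rightarrow> 'a \<Rightarrow> bool) \<Rightarrow>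
   ((nat \<Rightarrow> 'a \<times> bool \<times> bool) \<times> (nat \<Rightarrow> 'a \<times> bool) \<Rightarrow> 'a \<Rightarrow> bool) \<Rightarrow> bool" where
  "staged_rule MX \<mu> H R nl nu hh rh \<longleftrightarrow>
     measurable_rule (law_Su nu MX \<mu>) MX hh \<and>
     measurable_rule (law_Sl nl \<mu> \<Otimes>\<^sub>M law_Su nu MX \<mu>) MX rh \<and>
     (\<forall>Su \<in> space (law_Su nu MX \<mu>). staged_classifier H nu Su (hh Su)) \<and>
     (\<forall>Sl \<in> space (law_Sl nl \<mu>). \<forall>Su \<in> space (law_Su nu MX \<mu>).
        staged_rejector R nl Sl (hh Su) (rh (Sl, Su)))"

definition joint_rule ::
  "'a measure \<Rightarrow> ('a \<times> bool \<times> bool) measure \<Rightarrow> ('a \<Rightarrow> bool) set \<Rightarrow> ('a \<Rightarrow> bool) set \<Rightarrow>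
   nat \<Rightarrow> ((nat \<Rightarrow> 'a \<times> bool \<times> bool) \<Rightarrow> 'a \<Rightarrow> bool) \<Rightarrow>
   ((nat \<Rightarrow> 'a \<times> bool \<times> bool) \<Rightarrow> 'a \<Rightarrow> bool) \<Rightarrow> bool" where
  "joint_rule MX \<mu> H R nl ht rt \<longleftrightarrow>
     measurable_rule (law_Sl nl \<mu>) MX ht \<and>
     measurable_rule (law_Sl nl \<mu>) MX rt \<and>
     (\<forall>Sl \<in> space (law_Sl nl \<mu>). joint_solution H R nl Sl (ht Sl, rt Sl))"

end

theory Submission
  imports Defs
begin

text \<open>
  Both excess risks are bounded by sums of deviations \<open>(P - P_n) f\<close> of a data-dependent \<open>f\<close>, and each
  deviation \<open>X\<close> gets a bound \<open>E exp (l (X - m)) \<le> exp (v l\<^sup>2)\<close> for all \<open>l \<ge> 0\<close>, where \<open>m\<close> is a Rademacher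
  complexity.  Such bounds add up without independence, and a single Chernoff step at the end gives
  the confidence term \<open>sqrt (ln (1 / \<delta>) / n)\<close> for every \<open>\<delta> < 1\<close>; a union bound over the deviations
  would cost an additive constant that is not of this form as \<open>\<delta>\<close> tends to 1.  For one deviation the
  bound comes from symmetrization with a ghost sample, the contraction inequality conditionally on the
  data, and McDiarmid's inequality for the signs and then for the features.

  For staged learning, optimality of the Bayes classifier turns the loss of the classifier on the
  region where the optimal rejector does not defer into its plain excess risk, and given \<open>Su\<close> the
  rejector minimizes an empirical loss that is linear in it, with coefficients in \<open>[-1, 1]\<close>; this
  already yields the coefficient 2 of the rejector complexity.  For joint learning,
  \<open>1[h \<noteq> y] 1[r = 0]\<close> is the positive part of \<open>1[h \<noteq> y] - r\<close>, which separates \<open>H\<close> from \<open>R\<close>, and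
  the remaining term \<open>1[m \<noteq> y] r\<close> costs a second \<open>2 RadR nl\<close>.  The complexity is antitone
  in the sample size, so this is at most the term with \<open>nl * p / 2\<close> unless \<open>p = 0\<close>, when the
  deviation of \<open>1[m \<noteq> y] r\<close> is not positive.
\<close>

section \<open>Signs and contraction\<close>

text \<open>Measurability is granted only for the signed suprema of
  \<open>classifier_functions H\<close> and \<open>rejector_functions R\<close>. Suprema of the
  losses also involve labels and expert predictions and may fail to be measurable, so the usual
  route, which concentrates the supremum of all deviations and then symmetrizes its mean, is closed.
  Instead the exponential moment of the learned function itself is symmetrized, and the supremum
  over losses appears only at a fixed sample. Contraction is therefore required for exponential
  moments, not for means: it has to lead to suprema over the two classes before the sample is
  integrated out.

  The coefficient 1 of the classifier complexity is the factor 2 of symmetrization times the 1/2 in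
  \<open>1[h \<noteq> y] = 1/2 - y h / 2\<close>, with labels and classifiers coded as -1 and 1.
  Rejectors enter with weights of modulus at most 1 and keep the factor 2.\<close>

definition signs :: "nat \<Rightarrow> (nat \<Rightarrow> real) set" where
  "signs n = PiE_dflt {..<n} 0 (\<lambda>_. {-1, 1})"

definition sign_mean :: "nat \<Rightarrow> ((nat \<Rightarrow> real) \<Rightarrow> real) \<Rightarrow> real" where
  "sign_mean n \<Phi> = (\<Sum>\<sigma>\<in>signs n. \<Phi> \<sigma>) / 2 ^ n"

lemma finite_signs [simp]: "finite (signs n)"
  unfolding signs_def by (rule finite_PiE_dflt) auto

lemma card_signs: "card (signs n) = 2 ^ n"
  unfolding signs_def by (subst card_PiE_dflt) (auto simp: numeral_2_eq_2)

lemma signsD: "\<sigma> \<in> signs n \<Longrightarrow> i < n \<Longrightarrow> \<sigma> i = -1 \<or> \<sigma> i = 1"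
  by (auto simp: signs_def PiE_dflt_def)

lemma signs_outside: "\<sigma> \<in> signs n \<Longrightarrow> \<not> i < n \<Longrightarrow> \<sigma> i = 0"
  by (auto simp: signs_def PiE_dflt_def)

lemma signsI: "(\<And>i. i < n \<Longrightarrow> \<sigma> i = -1 \<or> \<sigma> i = 1) \<Longrightarrow> (\<And>i. \<not> i < n \<Longrightarrow> \<sigma> i = 0) \<Longrightarrow> \<sigma> \<in> signs n"
  by (auto simp: signs_def PiE_dflt_def)

lemma signs_abs: "\<sigma> \<in> signs n \<Longrightarrow> i < n \<Longrightarrow> \<bar>\<sigma> i\<bar> = 1"
  using signsD[of \<sigma> n i] by auto

lemma signs_Pi: "\<sigma> \<in> signs n \<Longrightarrow> \<sigma> \<in> {..<n} \<rightarrow> {-1, 1}"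
  using signsD by blast

text \<open>The default 0 in \<open>signs\<close> is also the default of \<open>Pi_pmf\<close>, so
  the law of the signs is uniform on this finite set. Averages over signs are then finite sums,
  which commute freely with integrals over the sample.\<close>

lemma expectation_signs:
  "measure_pmf.expectation (Pi_pmf {..<n} 0 (\<lambda>_. pmf_of_set {-1, 1})) \<Phi> = sign_mean n \<Phi>"
proof -
  have "Pi_pmf {..<n} 0 (\<lambda>_. pmf_of_set {-1, 1::real}) = pmf_of_set (signs n)"
    unfolding signs_def by (rule Pi_pmf_of_set) auto
  moreover have "signs n \<noteq> {}"
    using card_signs[of n] by (metis card.empty power_not_zero zero_neq_numeral)
  ultimately show ?thesis
    by (simp add: integral_pmf_of_set sign_mean_def card_signs)
qed

lemma sign_mean_mono: "(\<And>\<sigma>. \<sigma> \<in> signs n \<Longrightarrow> \<Phi> \<sigma> \<le> \<Psi> \<sigma>) \<Longrightarrow> sign_mean n \<Phi> \<le> sign_mean n \<Psi>"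
  unfolding sign_mean_def by (intro divide_right_mono sum_mono) auto

lemma sign_mean_cong: "(\<And>\<sigma>. \<sigma> \<in> signs n \<Longrightarrow> \<Phi> \<sigma> = \<Psi> \<sigma>) \<Longrightarrow> sign_mean n \<Phi> = sign_mean n \<Psi>"
  unfolding sign_mean_def by (intro arg_cong2[where f="(/)"] sum.cong) auto

lemma sign_mean_const: "sign_mean n (\<lambda>_. c) = c"
  unfolding sign_mean_def by (simp add: card_signs)

lemma sign_mean_add: "sign_mean n (\<lambda>\<sigma>. \<Phi> \<sigma> + \<Psi> \<sigma>) = sign_mean n \<Phi> + sign_mean n \<Psi>"
  unfolding sign_mean_def by (simp add: sum.distrib add_divide_distrib)

lemma sign_mean_cmult: "sign_mean n (\<lambda>\<sigma>. c * \<Phi> \<sigma>) = c * sign_mean n \<Phi>"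
  unfolding sign_mean_def by (simp add: sum_distrib_left)

lemma sign_mean_diff: "sign_mean n (\<lambda>\<sigma>. \<Phi> \<sigma> - \<Psi> \<sigma>) = sign_mean n \<Phi> - sign_mean n \<Psi>"
  unfolding sign_mean_def by (simp add: sum_subtractf diff_divide_distrib)

lemma abs_sign_mean_le:
  assumes "\<And>\<sigma>. \<sigma> \<in> signs n \<Longrightarrow> \<bar>\<Phi> \<sigma>\<bar> \<le> B"
  shows "\<bar>sign_mean n \<Phi>\<bar> \<le> B"
  using sign_mean_mono[of n \<Phi> "\<lambda>_. B"] sign_mean_mono[of n "\<lambda>_. - B" \<Phi>] assms
  by (force simp: sign_mean_const abs_le_iff)

text \<open>Multiplication by a fixed sign vector is an involution of \<open>signs n\<close>. Later
  \<open>c\<close> is -1 at a single coordinate, constantly -1, or made of the labels.\<close>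

lemma sign_mean_flip:
  assumes c: "\<And>i. i < n \<Longrightarrow> c i = -1 \<or> c i = (1::real)"
  shows "sign_mean n (\<lambda>\<sigma>. \<Phi> (\<lambda>i. c i * \<sigma> i)) = sign_mean n \<Phi>"
proof -
  let ?f = "\<lambda>\<sigma> i. c i * \<sigma> i :: real"
  have cc: "c i * c i = 1" if "i < n" for i
    using c[OF that] by auto
  have mem: "?f \<sigma> \<in> signs n" if "\<sigma> \<in> signs n" for \<sigma>
    using c signsD[OF that] signs_outside[OF that] by (intro signsI) fastforce+
  have inv: "?f (?f \<sigma>) = \<sigma>" if "\<sigma> \<in> signs n" for \<sigma>
  proof
    fix i show "?f (?f \<sigma>) i = \<sigma> i"
      using cc[of i] signs_outside[OF that, of i]
      by (cases "i < n") (simp_all flip: mult.assoc)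
  qed
  have "(\<Sum>\<sigma>\<in>signs n. \<Phi> (?f \<sigma>)) = (\<Sum>\<sigma>\<in>signs n. \<Phi> \<sigma>)"
    by (rule sum.reindex_bij_witness[where i="?f" and j="?f"]) (auto intro: mem inv simp: inv)
  then show ?thesis by (simp add: sign_mean_def)
qed

text \<open>Pairing each \<open>\<sigma>\<close> with its flip at \<open>j\<close> isolates this
  coordinate and leaves the others untouched, so that contraction can treat one coordinate at a
  time.\<close>

lemma sign_mean_average_coordinate:
  assumes "j < n"
  shows "sign_mean n \<Phi> = sign_mean n (\<lambda>\<sigma>. (\<Phi> (\<sigma>(j := 1)) + \<Phi> (\<sigma>(j := -1))) / 2)"
proof -
  let ?c = "\<lambda>i. if i = j then -1 else (1::real)"
  have "2 * sign_mean n \<Phi> = sign_mean n \<Phi> + sign_mean n (\<lambda>\<sigma>. \<Phi> (\<lambda>i. ?c i * \<sigma> i))"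
    by (subst sign_mean_flip) auto
  also have "\<dots> = sign_mean n (\<lambda>\<sigma>. \<Phi> \<sigma> + \<Phi> (\<lambda>i. ?c i * \<sigma> i))"
    by (rule sign_mean_add[symmetric])
  also have "\<dots> = sign_mean n (\<lambda>\<sigma>. \<Phi> (\<sigma>(j := 1)) + \<Phi> (\<sigma>(j := -1)))"
  proof (rule sign_mean_cong)
    fix \<sigma> assume "\<sigma> \<in> signs n"
    then consider "\<sigma> j = 1" | "\<sigma> j = -1" using signsD assms by blast
    then show "\<Phi> \<sigma> + \<Phi> (\<lambda>i. ?c i * \<sigma> i) = \<Phi> (\<sigma>(j := 1)) + \<Phi> (\<sigma>(j := -1))"
    proof cases
      case 1
      then have "\<sigma>(j := 1) = \<sigma>" "\<sigma>(j := -1) = (\<lambda>i. ?c i * \<sigma> i)" by auto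
      then show ?thesis by simp
    next
      case 2
      then have "\<sigma>(j := -1) = \<sigma>" "\<sigma>(j := 1) = (\<lambda>i. ?c i * \<sigma> i)" by auto
      then show ?thesis by simp
    qed
  qed
  finally show ?thesis
    using sign_mean_cmult[of n "1/2" "\<lambda>\<sigma>. \<Phi> (\<sigma>(j := 1)) + \<Phi> (\<sigma>(j := -1))"] by simp
qed

text \<open>The inequality of arithmetic and geometric means for \<open>exp a\<close> and
  \<open>exp b\<close>. It stands in for independence wherever an exponent is split into two parts;
  the price is that each part is doubled.\<close>

lemma exp_half_sum_le: "exp ((a + b) / 2) \<le> (exp a + exp b) / (2::real)"
proof -
  have "0 \<le> (exp (a / 2) - exp (b / 2))\<^sup>2" by simp
  also have "\<dots> = exp a + exp b - 2 * exp ((a + b) / 2)"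
    by (simp add: power2_eq_square algebra_simps add_divide_distrib flip: exp_add)
  finally show ?thesis by simp
qed

text \<open>The pair \<open>(p, q)\<close> is weakly majorized by \<open>(a, b)\<close>, and
  \<open>exp\<close> is increasing and convex.\<close>

lemma exp_weak_majorization:
  fixes a b p q :: real
  assumes "p + q \<le> a + b" "p \<le> max a b" "q \<le> max a b"
  shows "exp p + exp q \<le> exp a + exp b"
proof -
  have *: "exp p + exp q \<le> exp a + exp b"
    if "p + q \<le> a + b" "p \<le> a" "q \<le> a" "b \<le> a" for a b p q :: real
  proof (cases "q \<le> b")
    case True
    then show ?thesis using that by (intro add_mono) auto
  next
    case False
    \<comment> \<open>Here \<open>p\<close> may be raised to \<open>a + b - q\<close>; the new pair
      has the sum \<open>a + b\<close> and lies between \<open>b\<close> and \<open>a\<close>.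
      Expanding this product of nonnegative factors is convexity of \<open>exp\<close> for such a
      pair.\<close>
    have "0 \<le> (exp q - exp b) * (exp (a - q) - 1)"
      using False that by (intro mult_nonneg_nonneg) auto
    also have "\<dots> = exp a + exp b - exp q - exp (a + b - q)"
      by (simp add: algebra_simps flip: exp_add)
    finally have "exp (a + b - q) + exp q \<le> exp a + exp b" by simp
    moreover have "exp p \<le> exp (a + b - q)" using that by simp
    ultimately show ?thesis by linarith
  qed
  show ?thesis
  proof (cases "b \<le> a")
    case True
    with assms show ?thesis by (intro *) auto
  next
    case False
    with assms have "exp p + exp q \<le> exp b + exp a" by (intro *) auto
    then show ?thesis by simp
  qed
qed

text \<open>The function \<open>u\<close> collects all coordinates but the contracted one. The
  suprema on the left are weakly majorized by those on the right:
  \<open>\<bar>\<phi> x\<bar> \<le> \<bar>x\<bar>\<close> bounds each of them by the larger one, and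
  the Lipschitz condition bounds their sum.\<close>

lemma contraction_step:
  fixes u t :: "'k \<Rightarrow> real"
  assumes K: "K \<noteq> {}" and \<kappa>: "\<kappa> \<ge> 0"
    and bdd: "bdd_above ((\<lambda>k. u k + t k) ` K)" "bdd_above ((\<lambda>k. u k - t k) ` K)"
    and lip: "\<And>x y. \<bar>\<phi> x - \<phi> y\<bar> \<le> \<bar>x - y\<bar>" and zero: "\<phi> 0 = (0::real)"
  shows "exp (\<kappa> * (SUP k\<in>K. u k + \<phi> (t k))) + exp (\<kappa> * (SUP k\<in>K. u k - \<phi> (t k)))
    \<le> exp (\<kappa> * (SUP k\<in>K. u k + t k)) + exp (\<kappa> * (SUP k\<in>K. u k - t k))"
proof -
  define A B P Q where "A = (SUP k\<in>K. u k + t k)" and "B = (SUP k\<in>K. u k - t k)"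
    and "P = (SUP k\<in>K. u k + \<phi> (t k))" and "Q = (SUP k\<in>K. u k - \<phi> (t k))"
  have leA: "u k + t k \<le> A" and leB: "u k - t k \<le> B" if "k \<in> K" for k
    using bdd that by (auto simp: A_def B_def intro: cSUP_upper)
  have abs_phi: "\<bar>\<phi> x\<bar> \<le> \<bar>x\<bar>" for x using lip[of x 0] zero by simp
  have "P \<le> max A B"
    unfolding P_def
  proof (rule cSUP_least[OF K])
    fix k assume "k \<in> K"
    then show "u k + \<phi> (t k) \<le> max A B"
      using leA[of k] leB[of k] abs_phi[of "t k"] by linarith
  qed
  moreover have "Q \<le> max A B"
    unfolding Q_def
  proof (rule cSUP_least[OF K])
    fix k assume "k \<in> K"
    then show "u k - \<phi> (t k) \<le> max A B"
      using leA[of k] leB[of k] abs_phi[of "t k"] by linarith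
  qed
  moreover have "P + Q \<le> A + B"
  proof -
    \<comment> \<open>If \<open>t l \<le> t k\<close>, then \<open>k\<close> is charged to
      \<open>A\<close> and \<open>l\<close> to \<open>B\<close>, otherwise the other way round;
      either way \<open>\<bar>t k - t l\<bar>\<close> is absorbed. Since \<open>k\<close> and
      \<open>l\<close> vary independently, the two suprema can be taken one after the other.\<close>
    have "(u k + \<phi> (t k)) + (u l - \<phi> (t l)) \<le> A + B" if "k \<in> K" "l \<in> K" for k l
      using leA[of k] leB[of k] leA[of l] leB[of l] lip[of "t k" "t l"] that by linarith
    then have "P \<le> A + B - (u l - \<phi> (t l))" if "l \<in> K" for l
      unfolding P_def using that by (intro cSUP_least[OF K]) (simp add: le_diff_eq)
    then have "u l - \<phi> (t l) \<le> A + B - P" if "l \<in> K" for l using that by fastforce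
    then have "Q \<le> A + B - P" unfolding Q_def by (intro cSUP_least[OF K])
    then show ?thesis by simp
  qed
  ultimately have "exp (\<kappa> * P) + exp (\<kappa> * Q) \<le> exp (\<kappa> * A) + exp (\<kappa> * B)"
    using \<kappa> by (intro exp_weak_majorization)
      (auto simp: mult_left_mono le_max_iff_disj simp flip: distrib_left)
  then show ?thesis by (simp add: A_def B_def P_def Q_def)
qed

lemma bdd_above_abs:
  assumes "\<And>k. k \<in> K \<Longrightarrow> \<bar>f k\<bar> \<le> (B::real)"
  shows "bdd_above (f ` K)"
  by (rule bdd_aboveI2[of _ _ B]) (use assms in force)

lemma bdd_above_coefficient_sum:
  fixes t :: "'k \<Rightarrow> nat \<Rightarrow> real"
  assumes "\<And>k i. k \<in> K \<Longrightarrow> i < n \<Longrightarrow> \<bar>t k i\<bar> \<le> B"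
  shows "bdd_above ((\<lambda>k. \<Sum>i<n. c i * t k i) ` K)"
proof (rule bdd_above_abs)
  fix k assume "k \<in> K"
  have "\<bar>\<Sum>i<n. c i * t k i\<bar> \<le> (\<Sum>i<n. \<bar>c i\<bar> * \<bar>t k i\<bar>)"
    by (rule order_trans[OF sum_abs]) (simp add: abs_mult)
  also have "\<dots> \<le> (\<Sum>i<n. \<bar>c i\<bar> * B)"
    using assms \<open>k \<in> K\<close> by (intro sum_mono mult_left_mono) auto
  finally show "\<bar>\<Sum>i<n. c i * t k i\<bar> \<le> (\<Sum>i<n. \<bar>c i\<bar> * B)" .
qed

text \<open>
  The comparison inequality of Ledoux and Talagrand; the coordinates are contracted one at a time.
\<close>

lemma contraction_exp:
  fixes t :: "'k \<Rightarrow> nat \<Rightarrow> real"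
  assumes K: "K \<noteq> {}" and \<kappa>: "\<kappa> \<ge> 0"
    and bdd: "\<And>k i. k \<in> K \<Longrightarrow> i < n \<Longrightarrow> \<bar>t k i\<bar> \<le> B"
    and lip: "\<And>i x y. i < n \<Longrightarrow> \<bar>\<phi> i x - \<phi> i y\<bar> \<le> \<bar>x - y\<bar>"
    and zero: "\<And>i. i < n \<Longrightarrow> \<phi> i 0 = (0::real)"
  shows "sign_mean n (\<lambda>\<sigma>. exp (\<kappa> * (SUP k\<in>K. \<Sum>i<n. \<sigma> i * \<phi> i (t k i))))
    \<le> sign_mean n (\<lambda>\<sigma>. exp (\<kappa> * (SUP k\<in>K. \<Sum>i<n. \<sigma> i * t k i)))"
proof -
  \<comment> \<open>In \<open>G j\<close> the coordinates below \<open>j\<close> are already free of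
    \<open>\<phi>\<close>: \<open>G 0\<close> and \<open>G n\<close> are the two sides of the claim,
    and consecutive values differ in one coordinate only.\<close>
  define v where "v = (\<lambda>j k i. if i < j then t k i else \<phi> i (t k i))"
  define G where "G = (\<lambda>j. sign_mean n (\<lambda>\<sigma>. exp (\<kappa> * (SUP k\<in>K. \<Sum>i<n. \<sigma> i * v j k i))))"
  have abs_phi: "\<bar>\<phi> i x\<bar> \<le> \<bar>x\<bar>" if "i < n" for i x using lip[OF that, of x 0] zero[OF that] by simp
  have vB: "\<bar>v j k i\<bar> \<le> B" if "k \<in> K" "i < n" for j k i
    using bdd[OF that] abs_phi[OF that(2), of "t k i"] by (auto simp: v_def)
  have step: "G j \<le> G (Suc j)" if j: "j < n" for j
  proof -
    define E where "E = (\<lambda>l \<sigma>. exp (\<kappa> * (SUP k\<in>K. \<Sum>i<n. \<sigma> i * v l k i)))"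
    have "E j (\<sigma>(j := 1)) + E j (\<sigma>(j := -1))
        \<le> E (Suc j) (\<sigma>(j := 1)) + E (Suc j) (\<sigma>(j := -1))" for \<sigma>
    proof -
      define u where "u = (\<lambda>k. \<Sum>i\<in>{..<n}-{j}. \<sigma> i * v j k i)"
      have sum: "(\<Sum>i<n. (\<sigma>(j := s)) i * v l k i) = u k + s * v l k j"
        if "l = j \<or> l = Suc j" for s l k
      proof -
        have "(\<Sum>i<n. (\<sigma>(j := s)) i * v l k i)
            = (\<sigma>(j := s)) j * v l k j + (\<Sum>i\<in>{..<n}-{j}. (\<sigma>(j := s)) i * v l k i)"
          using j by (intro sum.remove) auto
        also have "(\<Sum>i\<in>{..<n}-{j}. (\<sigma>(j := s)) i * v l k i) = u k"
          unfolding u_def using that by (intro sum.cong) (auto simp: v_def)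
        finally show ?thesis by simp
      qed
      have "bdd_above ((\<lambda>k. \<Sum>i<n. (\<sigma>(j := s)) i * v (Suc j) k i) ` K)" for s
        using vB by (rule bdd_above_coefficient_sum)
      from this[of 1] this[of "-1"]
      have bddu: "bdd_above ((\<lambda>k. u k + t k j) ` K)" "bdd_above ((\<lambda>k. u k - t k j) ` K)"
        by (simp_all only: sum simp_thms) (simp_all add: v_def)
      show ?thesis
        using contraction_step[OF K \<kappa> bddu, of "\<phi> j"] lip[OF j] zero[OF j]
        by (simp only: E_def sum simp_thms) (simp add: v_def)
    qed
    then have "sign_mean n (\<lambda>\<sigma>. (E j (\<sigma>(j := 1)) + E j (\<sigma>(j := -1))) / 2)
      \<le> sign_mean n (\<lambda>\<sigma>. (E (Suc j) (\<sigma>(j := 1)) + E (Suc j) (\<sigma>(j := -1))) / 2)"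
      by (intro sign_mean_mono divide_right_mono) auto
    then show ?thesis
      using sign_mean_average_coordinate[OF j, of "E j"]
        sign_mean_average_coordinate[OF j, of "E (Suc j)"]
      by (simp add: G_def E_def)
  qed
  have "G 0 \<le> G m" if "m \<le> n" for m
    using that by (induction m) (auto intro: order_trans[OF _ step])
  from this[of n] have "G 0 \<le> G n" by simp
  moreover have "(\<Sum>i<n. \<sigma> i * v n k i) = (\<Sum>i<n. \<sigma> i * t k i)" for \<sigma> k
    by (intro sum.cong) (auto simp: v_def)
  moreover have "(\<Sum>i<n. \<sigma> i * v 0 k i) = (\<Sum>i<n. \<sigma> i * \<phi> i (t k i))" for \<sigma> k
    by (simp add: v_def)
  ultimately show ?thesis by (simp only: G_def)
qed

section \<open>Bounded differences\<close>

lemma sign_mean_0: "sign_mean 0 \<Phi> = \<Phi> (\<lambda>_. 0)"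
proof -
  have "signs 0 = {\<lambda>_. 0}" by (auto simp: signs_def PiE_dflt_def)
  then show ?thesis by (simp add: sign_mean_def)
qed

lemma sign_mean_Suc:
  "sign_mean (Suc n) \<Phi> = sign_mean n (\<lambda>\<sigma>. (\<Phi> (\<sigma>(n := 1)) + \<Phi> (\<sigma>(n := -1))) / 2)"
proof -
  have img: "signs (Suc n) = (\<lambda>(\<sigma>, s). \<sigma>(n := s)) ` (signs n \<times> {1, -1})"
  proof (intro equalityI subsetI)
    fix \<sigma> assume s: "\<sigma> \<in> signs (Suc n)"
    then have "\<sigma>(n := 0) \<in> signs n" "\<sigma> n \<in> {1, -1}"
      using signsD[OF s] signs_outside[OF s] by (auto intro!: signsI simp: less_Suc_eq) blast
    then show "\<sigma> \<in> (\<lambda>(\<sigma>, s). \<sigma>(n := s)) ` (signs n \<times> {1, -1})"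
      by (intro image_eqI[of _ _ "(\<sigma>(n := 0), \<sigma> n)"]) auto
  next
    fix \<tau> assume "\<tau> \<in> (\<lambda>(\<sigma>, s). \<sigma>(n := s)) ` (signs n \<times> {1, -1})"
    then obtain \<sigma> s where "\<sigma> \<in> signs n" "s \<in> {1, -1}" and \<tau>: "\<tau> = \<sigma>(n := s)" by auto
    then show "\<tau> \<in> signs (Suc n)"
      using signsD[of \<sigma> n] signs_outside[of \<sigma> n] by (auto intro!: signsI simp: less_Suc_eq) blast+
  qed
  have inj: "inj_on (\<lambda>(\<sigma>, s). \<sigma>(n := s)) (signs n \<times> {1, -1})"
  proof (rule inj_onI, clarify)
    fix \<sigma> \<tau> :: "nat \<Rightarrow> real" and s t
    assume st: "\<sigma> \<in> signs n" "\<tau> \<in> signs n" and eq: "\<sigma>(n := s) = \<tau>(n := t)"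
    have "\<sigma> n = 0" "\<tau> n = 0" using st signs_outside by auto
    then show "\<sigma> = \<tau> \<and> s = t"
      using eq by (metis fun_upd_same fun_upd_triv fun_upd_upd)
  qed
  have "(\<Sum>\<sigma>\<in>signs (Suc n). \<Phi> \<sigma>) = (\<Sum>(\<sigma>, s)\<in>signs n \<times> {1, -1}. \<Phi> (\<sigma>(n := s)))"
    unfolding img by (subst sum.reindex[OF inj]) (simp add: case_prod_unfold)
  also have "\<dots> = (\<Sum>\<sigma>\<in>signs n. \<Phi> (\<sigma>(n := 1)) + \<Phi> (\<sigma>(n := -1)))"
    by (subst sum.cartesian_product[symmetric]) simp
  finally show ?thesis by (simp add: sign_mean_def sum_divide_distrib[symmetric])
qed

text \<open>Hoeffding's lemma for a fair coin with values \<open>a\<close> and \<open>b\<close>: the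
  general two-point inequality at weight 1/2, shifted by \<open>a\<close>.\<close>

lemma exp_average_le:
  fixes a b c :: real
  assumes "\<bar>a - b\<bar> \<le> c"
  shows "(exp a + exp b) / 2 \<le> exp ((a + b) / 2 + c\<^sup>2 / 8)"
proof -
  have *: "(exp a + exp b) / 2 \<le> exp ((a + b) / 2 + c\<^sup>2 / 8)" if "a \<le> b" "b - a \<le> c" for a b :: real
  proof -
    define h where "h = b - a"
    have "- h * (1/2) + ln (1 + (1/2) * (exp h - 1)) \<le> h\<^sup>2 / 8"
      using that by (intro Hoeffdings_lemma_aux) (auto simp: h_def)
    then have "ln ((1 + exp h) / 2) \<le> h / 2 + h\<^sup>2 / 8" by (simp add: field_simps)
    then have "exp (ln ((1 + exp h) / 2)) \<le> exp (h / 2 + h\<^sup>2 / 8)" by simp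
    moreover have "exp (ln ((1 + exp h) / 2)) = (1 + exp h) / 2"
      by (rule exp_ln) (simp add: add_pos_pos)
    ultimately have "(1 + exp h) / 2 \<le> exp (h / 2 + h\<^sup>2 / 8)" by simp
    then have "exp a * ((1 + exp h) / 2) \<le> exp a * exp (h / 2 + h\<^sup>2 / 8)" by simp
    then have "(exp a + exp b) / 2 \<le> exp ((a + b) / 2 + h\<^sup>2 / 8)"
      by (simp add: h_def field_simps flip: exp_add)
    also have "\<dots> \<le> exp ((a + b) / 2 + c\<^sup>2 / 8)"
      using that by (auto simp: h_def intro: power_mono)
    finally show ?thesis .
  qed
  show ?thesis
    using *[of a b] *[of b a] assms by (cases "a \<le> b") (auto simp: add.commute)
qed

text \<open>Averaging over the last sign leaves a function \<open>\<Psi>\<close> with the same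
  bounded differences, and the fair-coin inequality pays \<open>c\<^sup>2 / 8\<close> for that
  sign.\<close>

lemma sign_mean_mcdiarmid:
  assumes "\<And>\<sigma> j. j < n \<Longrightarrow> \<bar>\<Phi> (\<sigma>(j := 1)) - \<Phi> (\<sigma>(j := -1))\<bar> \<le> c"
  shows "sign_mean n (\<lambda>\<sigma>. exp (\<Phi> \<sigma>)) \<le> exp (sign_mean n \<Phi> + real n * c\<^sup>2 / 8)"
  using assms
proof (induction n arbitrary: \<Phi>)
  case 0
  then show ?case by (simp add: sign_mean_0)
next
  case (Suc n)
  define \<Psi> where "\<Psi> = (\<lambda>\<sigma>. (\<Phi> (\<sigma>(n := 1)) + \<Phi> (\<sigma>(n := -1))) / 2)"
  have d\<Psi>: "\<bar>\<Psi> (\<sigma>(j := 1)) - \<Psi> (\<sigma>(j := -1))\<bar> \<le> c" if "j < n" for \<sigma> j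
  proof -
    have comm: "(\<sigma>(j := s))(n := t) = (\<sigma>(n := t))(j := s)" for s t
      using that by (auto simp: fun_upd_twist)
    have "\<bar>\<Phi> ((\<sigma>(n := t))(j := 1)) - \<Phi> ((\<sigma>(n := t))(j := -1))\<bar> \<le> c" for t
      by (rule Suc.prems) (use that in simp)
    from this[of 1] this[of "-1"] show ?thesis unfolding \<Psi>_def comm by (simp add: abs_if field_simps split: if_splits)
  qed
  have "sign_mean (Suc n) (\<lambda>\<sigma>. exp (\<Phi> \<sigma>))
      = sign_mean n (\<lambda>\<sigma>. (exp (\<Phi> (\<sigma>(n := 1))) + exp (\<Phi> (\<sigma>(n := -1)))) / 2)"
    by (rule sign_mean_Suc)
  also have "\<dots> \<le> sign_mean n (\<lambda>\<sigma>. exp (c\<^sup>2 / 8) * exp (\<Psi> \<sigma>))"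
  proof (rule sign_mean_mono)
    fix \<sigma>
    have "(exp (\<Phi> (\<sigma>(n := 1))) + exp (\<Phi> (\<sigma>(n := -1)))) / 2 \<le> exp (\<Psi> \<sigma> + c\<^sup>2 / 8)"
      unfolding \<Psi>_def by (intro exp_average_le Suc.prems) simp
    then show "(exp (\<Phi> (\<sigma>(n := 1))) + exp (\<Phi> (\<sigma>(n := -1)))) / 2 \<le> exp (c\<^sup>2 / 8) * exp (\<Psi> \<sigma>)"
      by (simp add: exp_add mult.commute)
  qed
  also have "\<dots> = exp (c\<^sup>2 / 8) * sign_mean n (\<lambda>\<sigma>. exp (\<Psi> \<sigma>))" by (rule sign_mean_cmult)
  also have "\<dots> \<le> exp (c\<^sup>2 / 8) * exp (sign_mean n \<Psi> + real n * c\<^sup>2 / 8)"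
    by (intro mult_left_mono Suc.IH d\<Psi>) auto
  also have "\<dots> = exp (sign_mean (Suc n) \<Phi> + real (Suc n) * c\<^sup>2 / 8)"
    by (simp add: sign_mean_Suc \<Psi>_def field_simps flip: exp_add)
  finally show ?case .
qed

section \<open>McDiarmid's inequality on product spaces\<close>

lemma (in prob_space) integrable_bounded:
  fixes f :: "'a \<Rightarrow> real"
  assumes "f \<in> borel_measurable M" "\<And>x. x \<in> space M \<Longrightarrow> \<bar>f x\<bar> \<le> B"
  shows "integrable M f"
  using assms by (intro integrable_const_bound[where B=B]) auto

lemma (in prob_space) abs_expectation_le:
  fixes f :: "'a \<Rightarrow> real"
  assumes "f \<in> borel_measurable M" "\<And>x. x \<in> space M \<Longrightarrow> \<bar>f x\<bar> \<le> B"
  shows "\<bar>expectation f\<bar> \<le> B"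
proof -
  have "integrable M f" using assms by (rule integrable_bounded)
  then have "expectation f \<le> B" "- B \<le> expectation f"
    using assms(2) by (force intro!: integral_le_const integral_ge_const AE_I2)+
  then show ?thesis by linarith
qed

lemma (in prob_space) expectation_exp_le:
  fixes g :: "'a \<Rightarrow> real"
  assumes g[measurable]: "g \<in> borel_measurable M"
    and osc: "\<And>x y. x \<in> space M \<Longrightarrow> y \<in> space M \<Longrightarrow> \<bar>g x - g y\<bar> \<le> c"
  shows "expectation (\<lambda>x. exp (g x)) \<le> exp (expectation g + c\<^sup>2 / 8)"
proof -
  \<comment> \<open>The oscillation bound places all values in the interval of length
    \<open>c\<close> that starts at their infimum, which is the form Hoeffding's lemma asks
    for.\<close>
  define a where "a = (INF x\<in>space M. g x)"
  obtain x0 where x0: "x0 \<in> space M" using not_empty by blast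
  have bdd: "bdd_below (g ` space M)"
    by (rule bdd_belowI2[of _ "g x0 - c"]) (use osc[OF x0] in force)
  have "a \<le> g x" if "x \<in> space M" for x
    unfolding a_def using bdd that by (rule cINF_lower)
  moreover have "g x - c \<le> a" if "x \<in> space M" for x
    unfolding a_def using osc that not_empty by (intro cINF_greatest) (auto simp: abs_le_iff algebra_simps)
  ultimately interpret interval_bounded_random_variable M g a "a + c"
    by unfold_locales (auto intro!: AE_I2 simp: algebra_simps)
  have "(\<integral>\<^sup>+x. ennreal (exp (1 * (g x - expectation g))) \<partial>M) \<le> ennreal (exp (1\<^sup>2 * (a + c - a)\<^sup>2 / 8))"
    by (rule Hoeffdings_lemma_nn_integral) simp
  then have "expectation (\<lambda>x. exp (g x - expectation g)) \<le> exp (c\<^sup>2 / 8)"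
    by (intro integral_real_bounded) auto
  moreover have "expectation (\<lambda>x. exp (g x)) = exp (expectation g) * expectation (\<lambda>x. exp (g x - expectation g))"
    by (simp add: exp_diff)
  ultimately show ?thesis by (simp add: exp_add)
qed

text \<open>Induction over the index set: integrating out one coordinate preserves the bounded
  differences of the rest, and Hoeffding's lemma in the removed coordinate costs
  \<open>c\<^sup>2 / 8\<close>. The bound \<open>B\<close> serves integrability and does not enter
  the estimate.\<close>

lemma (in prob_space) mcdiarmid_mgf:
  fixes f :: "('i \<Rightarrow> 'a) \<Rightarrow> real" and B c :: real
  assumes "finite I" "f \<in> borel_measurable (PiM I (\<lambda>_. M))"
    and "\<And>x. x \<in> space (PiM I (\<lambda>_. M)) \<Longrightarrow> \<bar>f x\<bar> \<le> B"
    and "\<And>x i y. x \<in> space (PiM I (\<lambda>_. M)) \<Longrightarrow> i \<in> I \<Longrightarrow> y \<in> space M \<Longrightarrow> \<bar>f x - f (x(i := y))\<bar> \<le> c"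
  shows "(\<integral>x. exp (f x) \<partial>PiM I (\<lambda>_. M)) \<le> exp ((\<integral>x. f x \<partial>PiM I (\<lambda>_. M)) + card I * c\<^sup>2 / 8)"
  using assms
proof (induction I arbitrary: f rule: finite_induct)
  case empty
  interpret E: prob_space "PiM {} (\<lambda>_::'i. M)" by (rule prob_space_PiM) (rule prob_space_axioms)
  \<comment> \<open>The empty product consists of the single point
    \<open>\<lambda>_. undefined\<close>.\<close>
  have "(\<integral>x. h (f x) \<partial>PiM {} (\<lambda>_. M)) = h (f (\<lambda>_. undefined))" for h :: "real \<Rightarrow> real"
  proof -
    have "(\<integral>x. h (f x) \<partial>PiM {} (\<lambda>_. M)) = (\<integral>x. h (f (\<lambda>_. undefined)) \<partial>PiM {} (\<lambda>_::'i. M))"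
      by (rule Bochner_Integration.integral_cong) (auto simp: space_PiM)
    then show ?thesis by (simp add: E.prob_space)
  qed
  from this[of exp] this[of "\<lambda>x. x"] show ?case by simp
next
  case (insert i I)
  note f[measurable] = insert.prems(1)
  interpret J: prob_space "PiM I (\<lambda>_. M)" by (rule prob_space_PiM) (rule prob_space_axioms)
  interpret JI: prob_space "PiM (insert i I) (\<lambda>_. M)" by (rule prob_space_PiM) (rule prob_space_axioms)
  have psf: "product_sigma_finite (\<lambda>_::'i. M)"
    by (simp add: product_sigma_finite_def sigma_finite_measure_axioms)
  have upd: "x(i := y) \<in> space (PiM (insert i I) (\<lambda>_. M))"
    if "x \<in> space (PiM I (\<lambda>_. M))" "y \<in> space M" for x y
    using that by (auto simp: space_PiM PiE_def extensional_def)
  have [measurable]: "(\<lambda>(x, y). f (x(i := y))) \<in> borel_measurable (PiM I (\<lambda>_. M) \<Otimes>\<^sub>M M)"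
    using f by measurable
  define g where "g x = (\<integral>y. f (x(i := y)) \<partial>M)" for x
  have g[measurable]: "g \<in> borel_measurable (PiM I (\<lambda>_. M))"
    unfolding g_def by measurable
  have sec: "(\<lambda>y. f (x(i := y))) \<in> borel_measurable M" if "x \<in> space (PiM I (\<lambda>_. M))" for x
    using that by measurable
  have gB: "\<bar>g x\<bar> \<le> B" if x: "x \<in> space (PiM I (\<lambda>_. M))" for x
    unfolding g_def using insert.prems(2) upd[OF x] sec[OF x] by (intro abs_expectation_le) auto
  have gc: "\<bar>g x - g (x(j := z))\<bar> \<le> c"
    if x: "x \<in> space (PiM I (\<lambda>_. M))" and j: "j \<in> I" and z: "z \<in> space M" for x j z
  proof -
    have xz: "x(j := z) \<in> space (PiM I (\<lambda>_. M))"
      using that by (auto simp: space_PiM PiE_def extensional_def)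
    have int: "integrable M (\<lambda>y. f (x(i := y)))" if "x \<in> space (PiM I (\<lambda>_. M))" for x
      using insert.prems(2) upd[OF that] sec[OF that] by (intro integrable_bounded) auto
    have "g x - g (x(j := z)) = (\<integral>y. f (x(i := y)) - f ((x(j := z))(i := y)) \<partial>M)"
      unfolding g_def using int x xz by simp
    also have "\<bar>\<dots>\<bar> \<le> c"
    proof (rule abs_expectation_le)
      fix y assume y: "y \<in> space M"
      have "(x(j := z))(i := y) = (x(i := y))(j := z)"
        using j insert.hyps by (auto simp: fun_upd_twist)
      then show "\<bar>f (x(i := y)) - f ((x(j := z))(i := y))\<bar> \<le> c"
        using insert.prems(3)[OF upd[OF x y] _ z, of j] j by (simp only: insert_iff simp_thms)
    qed (use sec x xz in auto)
    finally show ?thesis .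
  qed
  have expB: "\<bar>exp (f x)\<bar> \<le> exp B" if "x \<in> space (PiM (insert i I) (\<lambda>_. M))" for x
    using insert.prems(2)[OF that] by (simp add: abs_le_iff)
  have "(\<integral>x. exp (f x) \<partial>PiM (insert i I) (\<lambda>_. M))
      = (\<integral>x. (\<integral>y. exp (f (x(i := y))) \<partial>M) \<partial>PiM I (\<lambda>_. M))"
    using insert.hyps expB by (intro product_sigma_finite.product_integral_insert[OF psf] JI.integrable_bounded[where B="exp B"]) auto
  also have "\<dots> \<le> (\<integral>x. exp (c\<^sup>2 / 8) * exp (g x) \<partial>PiM I (\<lambda>_. M))"
  proof (rule integral_mono)
    show "integrable (PiM I (\<lambda>_. M)) (\<lambda>x. \<integral>y. exp (f (x(i := y))) \<partial>M)"
    proof (rule J.integrable_bounded)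
      show "\<bar>\<integral>y. exp (f (x(i := y))) \<partial>M\<bar> \<le> exp B" if x: "x \<in> space (PiM I (\<lambda>_. M))" for x
        using sec[OF x] expB upd[OF x] by (intro abs_expectation_le) auto
    qed measurable
    show "integrable (PiM I (\<lambda>_. M)) (\<lambda>x. exp (c\<^sup>2 / 8) * exp (g x))"
      using gB by (intro integrable_mult_right J.integrable_bounded[where B="exp B"])
        (auto simp: abs_le_iff)
    fix x assume x: "x \<in> space (PiM I (\<lambda>_. M))"
    have "(\<integral>y. exp (f (x(i := y))) \<partial>M) \<le> exp ((\<integral>y. f (x(i := y)) \<partial>M) + c\<^sup>2 / 8)"
    proof (rule expectation_exp_le[OF sec[OF x]])
      fix y z assume "y \<in> space M" "z \<in> space M"
      then show "\<bar>f (x(i := y)) - f (x(i := z))\<bar> \<le> c"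
        using insert.prems(3)[OF upd[OF x] insertI1, of y z] by (simp only: fun_upd_upd)
    qed
    then show "(\<integral>y. exp (f (x(i := y))) \<partial>M) \<le> exp (c\<^sup>2 / 8) * exp (g x)"
      by (simp add: g_def exp_add mult.commute)
  qed
  also have "\<dots> = exp (c\<^sup>2 / 8) * (\<integral>x. exp (g x) \<partial>PiM I (\<lambda>_. M))" by simp
  also have "\<dots> \<le> exp (c\<^sup>2 / 8) * exp ((\<integral>x. g x \<partial>PiM I (\<lambda>_. M)) + card I * c\<^sup>2 / 8)"
    using insert.IH[OF g gB gc] by simp
  also have "(\<integral>x. g x \<partial>PiM I (\<lambda>_. M)) = (\<integral>x. f x \<partial>PiM (insert i I) (\<lambda>_. M))"
    unfolding g_def using insert.hyps insert.prems(2)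
    by (intro product_sigma_finite.product_integral_insert[OF psf, symmetric] JI.integrable_bounded) auto
  finally show ?case
    using insert.hyps by (simp add: field_simps flip: exp_add)
qed

section \<open>Rademacher complexity\<close>

text \<open>The signs at \<open>k\<close> distinct positions are again independent and uniform: a
  marginal of the product law, renumbered.\<close>

lemma sign_mean_reindex:
  assumes inj: "inj_on f {..<k}" and f: "f ` {..<k} \<subseteq> {..<n}"
  shows "sign_mean n (\<lambda>\<sigma>. G (\<lambda>i. if i < k then \<sigma> (f i) else 0)) = sign_mean k G"
proof -
  let ?p = "pmf_of_set {-1, 1::real}"
  \<comment> \<open>Renumbering a \<open>Pi_pmf\<close> requires that indices outside
    \<open>{..<k}\<close> leave the image of \<open>f\<close>, so that they receive the default
    value; \<open>n + i\<close> does, as the image lies below \<open>n\<close>.\<close>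
  define h where "h = (\<lambda>i. if i < k then f i else n + i)"
  have bij: "bij_betw h {..<k} (f ` {..<k})"
    using inj by (auto simp: bij_betw_def h_def inj_on_def)
  have "Pi_pmf {..<k} 0 (\<lambda>_. ?p) = map_pmf (\<lambda>\<sigma>. \<sigma> \<circ> h) (Pi_pmf (f ` {..<k}) 0 (\<lambda>_. ?p))"
    using f by (intro Pi_pmf_bij_betw[OF _ bij]) (fastforce simp: h_def image_subset_iff)+
  also have "\<dots> = map_pmf (\<lambda>\<sigma>. \<sigma> \<circ> h)
      (map_pmf (\<lambda>\<sigma> x. if x \<in> f ` {..<k} then \<sigma> x else 0) (Pi_pmf {..<n} 0 (\<lambda>_. ?p)))"
    using f by (subst Pi_pmf_subset[of "{..<n}"]) auto
  also have "\<dots> = map_pmf (\<lambda>\<sigma> i. if i < k then \<sigma> (f i) else 0) (Pi_pmf {..<n} 0 (\<lambda>_. ?p))"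
    unfolding map_pmf_comp using f
    by (intro map_pmf_cong refl) (fastforce simp: fun_eq_iff h_def image_subset_iff)
  finally show ?thesis
    by (simp flip: expectation_signs)
qed

text \<open>The supremum is 1-Lipschitz for the uniform distance. This carries bounded differences
  from single functions over to a whole class.\<close>

lemma abs_SUP_diff_le:
  fixes g h :: "'k \<Rightarrow> real"
  assumes K: "K \<noteq> {}" and bdd: "bdd_above (g ` K)" "bdd_above (h ` K)"
    and d: "\<And>k. k \<in> K \<Longrightarrow> \<bar>g k - h k\<bar> \<le> c"
  shows "\<bar>(SUP k\<in>K. g k) - (SUP k\<in>K. h k)\<bar> \<le> c"
proof -
  have "(SUP k\<in>K. g k) \<le> (SUP k\<in>K. h k) + c"
  proof (rule cSUP_least[OF K])
    fix k assume "k \<in> K"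
    then show "g k \<le> (SUP k\<in>K. h k) + c"
      using d[of k] cSUP_upper[OF _ bdd(2), of k] by linarith
  qed
  moreover have "(SUP k\<in>K. h k) \<le> (SUP k\<in>K. g k) + c"
  proof (rule cSUP_least[OF K])
    fix k assume "k \<in> K"
    then show "h k \<le> (SUP k\<in>K. g k) + c"
      using d[of k] cSUP_upper[OF _ bdd(1), of k] by linarith
  qed
  ultimately show ?thesis by linarith
qed

section \<open>Signed suprema over a bounded class\<close>

definition signed_sup :: "('a \<Rightarrow> real) set \<Rightarrow> nat \<Rightarrow> (nat \<Rightarrow> real) \<Rightarrow> (nat \<Rightarrow> 'a) \<Rightarrow> real" where
  "signed_sup F n \<sigma> x = (SUP f\<in>F. \<Sum>i<n. \<sigma> i * f (x i))"

lemma signed_sup_cong: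
  "(\<And>i. i < n \<Longrightarrow> \<sigma> i = \<tau> i) \<Longrightarrow> (\<And>i. i < n \<Longrightarrow> x i = y i) \<Longrightarrow> signed_sup F n \<sigma> x = signed_sup F n \<tau> y"
  unfolding signed_sup_def by (intro arg_cong[where f=Sup] image_cong sum.cong) auto

lemma rademacher_eq_sign_mean:
  "rademacher D n F = 1 / real n * (\<integral>x. sign_mean n (\<lambda>\<sigma>. signed_sup F n \<sigma> x) \<partial>(\<Pi>\<^sub>M i\<in>{..<n}. D))"
  unfolding rademacher_def expectation_signs sign_mean_cmult signed_sup_def by simp

locale bounded_class = prob_space D for D :: "'a measure" +
  fixes F :: "('a \<Rightarrow> real) set"
  assumes F_nonempty: "F \<noteq> {}"
    and F_bounded: "\<And>f x. f \<in> F \<Longrightarrow> \<bar>f x\<bar> \<le> 1"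
    and F_suprema: "measurable_suprema D F"
begin

lemma bdd_signed_sum: fixes x :: "nat \<Rightarrow> 'a" shows "bdd_above ((\<lambda>f. \<Sum>i<n. \<sigma> i * f (x i)) ` F)"
  using F_bounded by (intro bdd_above_coefficient_sum[where t="\<lambda>(f :: 'a \<Rightarrow> real) i. f (x i)" and B=1])

lemma measurable_signed_sup [measurable]:
  assumes "\<sigma> \<in> signs n"
  shows "signed_sup F n \<sigma> \<in> borel_measurable (\<Pi>\<^sub>M i\<in>{..<n}. D)"
  using F_suprema signs_Pi[OF assms] unfolding measurable_suprema_def signed_sup_def by blast

lemma abs_signed_sup_le:
  assumes "\<sigma> \<in> signs n"
  shows "\<bar>signed_sup F n \<sigma> x\<bar> \<le> n"
proof -
  have "\<bar>(SUP f\<in>F. \<Sum>i<n. \<sigma> i * f (x i)) - (SUP f\<in>F. 0)\<bar> \<le> real n"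
  proof (rule abs_SUP_diff_le[OF F_nonempty bdd_signed_sum])
    fix f assume f: "f \<in> F"
    have "\<bar>\<Sum>i<n. \<sigma> i * f (x i)\<bar> \<le> (\<Sum>i<n. \<bar>\<sigma> i * f (x i)\<bar>)" by (rule sum_abs)
    also have "\<dots> \<le> (\<Sum>i<n. 1)"
      using signs_abs[OF assms] F_bounded[OF f] by (intro sum_mono) (simp add: abs_mult)
    finally show "\<bar>(\<Sum>i<n. \<sigma> i * f (x i)) - 0\<bar> \<le> real n" by simp
  qed (auto intro: bdd_above_abs)
  then show ?thesis using F_nonempty by (simp add: signed_sup_def)
qed

lemma signed_sup_update_point:
  assumes "\<sigma> \<in> signs n" "i < n"
  shows "\<bar>signed_sup F n \<sigma> x - signed_sup F n \<sigma> (x(i := y))\<bar> \<le> 2"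
  unfolding signed_sup_def
proof (rule abs_SUP_diff_le[OF F_nonempty bdd_signed_sum bdd_signed_sum])
  fix f assume f: "f \<in> F"
  have "(\<Sum>j<n. \<sigma> j * f (x j)) - (\<Sum>j<n. \<sigma> j * f ((x(i := y)) j))
      = (\<Sum>j<n. if j = i then \<sigma> i * (f (x i) - f y) else 0)"
    unfolding sum_subtractf[symmetric] by (intro sum.cong) (auto simp: algebra_simps)
  also have "\<dots> = \<sigma> i * (f (x i) - f y)" using assms by simp
  also have "\<bar>\<dots>\<bar> \<le> 2"
    using signs_abs[OF assms] F_bounded[OF f, of "x i"] F_bounded[OF f, of y] by (simp add: abs_mult)
  finally show "\<bar>(\<Sum>j<n. \<sigma> j * f (x j)) - (\<Sum>j<n. \<sigma> j * f ((x(i := y)) j))\<bar> \<le> 2" .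
qed

lemma signed_sup_flip_sign:
  assumes "j < n"
  shows "\<bar>signed_sup F n (\<sigma>(j := 1)) x - signed_sup F n (\<sigma>(j := -1)) x\<bar> \<le> 2"
  unfolding signed_sup_def
proof (rule abs_SUP_diff_le[OF F_nonempty bdd_signed_sum bdd_signed_sum])
  fix f assume f: "f \<in> F"
  have "(\<Sum>i<n. (\<sigma>(j := 1)) i * f (x i)) - (\<Sum>i<n. (\<sigma>(j := -1)) i * f (x i))
      = (\<Sum>i<n. if i = j then 2 * f (x j) else 0)"
    unfolding sum_subtractf[symmetric] by (intro sum.cong) (auto simp: algebra_simps)
  also have "\<dots> = 2 * f (x j)" using assms by simp
  also have "\<bar>\<dots>\<bar> \<le> 2" using F_bounded[OF f, of "x j"] by (simp add: abs_mult)
  finally show "\<bar>(\<Sum>i<n. (\<sigma>(j := 1)) i * f (x i)) - (\<Sum>i<n. (\<sigma>(j := -1)) i * f (x i))\<bar> \<le> 2" .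
qed

lemma measurable_sign_mean_sup:
  assumes "g \<in> borel_measurable borel"
  shows "(\<lambda>x. sign_mean n (\<lambda>\<sigma>. g (signed_sup F n \<sigma> x))) \<in> borel_measurable (\<Pi>\<^sub>M i\<in>{..<n}. D)"
  unfolding sign_mean_def using measurable_compose[OF measurable_signed_sup assms]
  by (intro borel_measurable_divide borel_measurable_sum borel_measurable_const)

lemma prob_space_sample: "prob_space (\<Pi>\<^sub>M i\<in>I. D)"
  by (rule prob_space_PiM) (rule prob_space_axioms)

lemma integrable_sign_mean_sup:
  "integrable (\<Pi>\<^sub>M i\<in>{..<n}. D) (\<lambda>x. sign_mean n (\<lambda>\<sigma>. signed_sup F n \<sigma> x))"
  by (rule prob_space.integrable_bounded[OF prob_space_sample measurable_sign_mean_sup])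
    (auto intro: abs_sign_mean_le abs_signed_sup_le)

text \<open>For one fixed \<open>f\<close> the sums at \<open>\<sigma>\<close> and at its negative
  cancel, so the two suprema have a nonnegative sum; both have the same average over signs.\<close>

lemma sign_mean_sup_nonneg: "0 \<le> sign_mean n (\<lambda>\<sigma>. signed_sup F n \<sigma> x)"
proof -
  let ?S = "\<lambda>\<sigma>. signed_sup F n \<sigma> x"
  obtain f where f: "f \<in> F" using F_nonempty by blast
  have "(\<Sum>i<n. \<sigma> i * f (x i)) \<le> ?S \<sigma>" for \<sigma>
    unfolding signed_sup_def by (rule cSUP_upper[OF f bdd_signed_sum])
  from this this[of "\<lambda>i. -1 * _ i"] have "0 \<le> ?S \<sigma> + ?S (\<lambda>i. -1 * \<sigma> i)" for \<sigma>
    by (smt (verit, best) mult_minus_left mult_1 sum.cong sum_negf)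
  then have "0 \<le> sign_mean n (\<lambda>\<sigma>. ?S \<sigma> + ?S (\<lambda>i. -1 * \<sigma> i))"
    using sign_mean_mono[of n "\<lambda>_. 0"] by (simp add: sign_mean_const)
  also have "\<dots> = 2 * sign_mean n ?S"
    unfolding sign_mean_add by (subst sign_mean_flip) auto
  finally show ?thesis by simp
qed

lemma rademacher_nonneg: "0 \<le> rademacher D n F"
  unfolding rademacher_eq_sign_mean by (simp add: sign_mean_sup_nonneg)

text \<open>McDiarmid's inequality is applied twice: to the signs at fixed features, then to the
  average over signs as a function of the features. In both cases one coordinate moves the exponent
  by at most \<open>2 * l / n\<close>, which costs \<open>l\<^sup>2 / (2 * n)\<close> each
  time.\<close>

lemma rademacher_mgf:
  assumes l: "l \<ge> 0" and n: "n \<ge> 1"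
  shows "(\<integral>x. sign_mean n (\<lambda>\<sigma>. exp (l / n * signed_sup F n \<sigma> x)) \<partial>(\<Pi>\<^sub>M i\<in>{..<n}. D))
    \<le> exp (l * rademacher D n F + l\<^sup>2 / n)"
proof -
  interpret S: prob_space "\<Pi>\<^sub>M i\<in>{..<n}. D" by (rule prob_space_sample)
  define G where "G x = l / n * sign_mean n (\<lambda>\<sigma>. signed_sup F n \<sigma> x)" for x
  have G[measurable]: "G \<in> borel_measurable (\<Pi>\<^sub>M i\<in>{..<n}. D)"
    unfolding G_def by (intro borel_measurable_times borel_measurable_const measurable_sign_mean_sup) simp
  have GB: "\<bar>G x\<bar> \<le> l" for x
  proof -
    have "\<bar>sign_mean n (\<lambda>\<sigma>. signed_sup F n \<sigma> x)\<bar> \<le> n"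
      by (intro abs_sign_mean_le abs_signed_sup_le)
    then have "l / n * \<bar>sign_mean n (\<lambda>\<sigma>. signed_sup F n \<sigma> x)\<bar> \<le> l / n * n"
      using l by (intro mult_left_mono) auto
    then have "\<bar>G x\<bar> \<le> l / n * n"
      unfolding G_def using l by (simp add: abs_mult)
    then show ?thesis using n by simp
  qed
  have "(\<integral>x. sign_mean n (\<lambda>\<sigma>. exp (l / n * signed_sup F n \<sigma> x)) \<partial>(\<Pi>\<^sub>M i\<in>{..<n}. D))
      \<le> (\<integral>x. exp (l\<^sup>2 / (2 * n)) * exp (G x) \<partial>(\<Pi>\<^sub>M i\<in>{..<n}. D))"
  proof (rule integral_mono)
    show "integrable (\<Pi>\<^sub>M i\<in>{..<n}. D) (\<lambda>x. sign_mean n (\<lambda>\<sigma>. exp (l / n * signed_sup F n \<sigma> x)))"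
    proof (rule S.integrable_bounded)
      show "(\<lambda>x. sign_mean n (\<lambda>\<sigma>. exp (l / n * signed_sup F n \<sigma> x))) \<in> borel_measurable (\<Pi>\<^sub>M i\<in>{..<n}. D)"
        by (rule measurable_sign_mean_sup) simp
      have "l / n * signed_sup F n \<sigma> x \<le> l / n * n" if "\<sigma> \<in> signs n" for \<sigma> x
        using abs_signed_sup_le[OF that, of x] l by (intro mult_left_mono) auto
      then show "\<bar>sign_mean n (\<lambda>\<sigma>. exp (l / n * signed_sup F n \<sigma> x))\<bar> \<le> exp (l / n * n)" for x
        by (intro abs_sign_mean_le) simp
    qed
    show "integrable (\<Pi>\<^sub>M i\<in>{..<n}. D) (\<lambda>x. exp (l\<^sup>2 / (2 * n)) * exp (G x))"
      using GB by (intro integrable_mult_right S.integrable_bounded[where B="exp l"]) (auto simp: abs_le_iff)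
    fix x
    have "sign_mean n (\<lambda>\<sigma>. exp (l / n * signed_sup F n \<sigma> x))
        \<le> exp (sign_mean n (\<lambda>\<sigma>. l / n * signed_sup F n \<sigma> x) + real n * (l / n * 2)\<^sup>2 / 8)"
    proof (rule sign_mean_mcdiarmid)
      fix \<sigma> :: "nat \<Rightarrow> real" and j assume "j < n"
      then have "l / n * \<bar>signed_sup F n (\<sigma>(j := 1)) x - signed_sup F n (\<sigma>(j := - 1)) x\<bar> \<le> l / n * 2"
        using l by (intro mult_left_mono signed_sup_flip_sign) auto
      then show "\<bar>l / n * signed_sup F n (\<sigma>(j := 1)) x - l / n * signed_sup F n (\<sigma>(j := - 1)) x\<bar> \<le> l / n * 2"
        unfolding right_diff_distrib[symmetric] abs_mult using l by simp
    qed
    also have "\<dots> = exp (l\<^sup>2 / (2 * n)) * exp (G x)"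
      unfolding sign_mean_cmult G_def[symmetric]
      using n by (simp add: power2_eq_square field_simps flip: exp_add)
    finally show "sign_mean n (\<lambda>\<sigma>. exp (l / n * signed_sup F n \<sigma> x)) \<le> exp (l\<^sup>2 / (2 * n)) * exp (G x)" .
  qed
  also have "\<dots> = exp (l\<^sup>2 / (2 * n)) * (\<integral>x. exp (G x) \<partial>(\<Pi>\<^sub>M i\<in>{..<n}. D))" by simp
  also have "\<dots> \<le> exp (l\<^sup>2 / (2 * n)) * exp ((\<integral>x. G x \<partial>(\<Pi>\<^sub>M i\<in>{..<n}. D)) + card {..<n} * (l / n * 2)\<^sup>2 / 8)"
  proof (intro mult_left_mono mcdiarmid_mgf[OF _ G])
    fix x i y assume "i \<in> {..<n}"
    then have "\<bar>sign_mean n (\<lambda>\<sigma>. signed_sup F n \<sigma> x - signed_sup F n \<sigma> (x(i := y)))\<bar> \<le> 2"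
      by (intro abs_sign_mean_le signed_sup_update_point) auto
    then have "l / n * \<bar>sign_mean n (\<lambda>\<sigma>. signed_sup F n \<sigma> x - signed_sup F n \<sigma> (x(i := y)))\<bar> \<le> l / n * 2"
      using l by (intro mult_left_mono) auto
    then show "\<bar>G x - G (x(i := y))\<bar> \<le> l / n * 2"
      unfolding G_def right_diff_distrib[symmetric] sign_mean_diff[symmetric] abs_mult using l by simp
  qed (use GB in auto)
  also have "(\<integral>x. G x \<partial>(\<Pi>\<^sub>M i\<in>{..<n}. D)) = l * rademacher D n F"
    unfolding G_def rademacher_eq_sign_mean by simp
  also have "exp (l\<^sup>2 / (2 * n)) * exp (l * rademacher D n F + card {..<n} * (l / n * 2)\<^sup>2 / 8)
      = exp (l * rademacher D n F + l\<^sup>2 / n)"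
    using n by (simp add: power2_eq_square field_simps flip: exp_add)
  finally show ?thesis .
qed

end

section \<open>Marginals and images of product laws\<close>

lemma (in prob_space) integral_PiM_reindex:
  fixes h :: "('i \<Rightarrow> 'a) \<Rightarrow> real"
  assumes "inj_on f I" "f ` I \<subseteq> K" "h \<in> borel_measurable (PiM I (\<lambda>_. M))"
  shows "(\<integral>x. h (\<lambda>i\<in>I. x (f i)) \<partial>PiM K (\<lambda>_. M)) = (\<integral>x. h x \<partial>PiM I (\<lambda>_. M))"
proof -
  have "PiM I (\<lambda>_. M) = distr (PiM K (\<lambda>_. M)) (PiM I (\<lambda>_. M)) (\<lambda>x. \<lambda>i\<in>I. x (f i))"
    by (rule distr_PiM_reindex[symmetric]) (use assms prob_space_axioms in auto)
  then have "(\<integral>x. h x \<partial>PiM I (\<lambda>_. M)) = (\<integral>x. h x \<partial>distr (PiM K (\<lambda>_. M)) (PiM I (\<lambda>_. M)) (\<lambda>x. \<lambda>i\<in>I. x (f i)))"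
    by simp
  also have "\<dots> = (\<integral>x. h (\<lambda>i\<in>I. x (f i)) \<partial>PiM K (\<lambda>_. M))"
    using assms by (intro integral_distr) (auto intro!: measurable_restrict measurable_component_singleton)
  finally show ?thesis by simp
qed

lemma (in prob_space) integral_PiM_component:
  fixes h :: "'a \<Rightarrow> real"
  assumes "i \<in> I" and h[measurable]: "h \<in> borel_measurable M"
  shows "(\<integral>x. h (x i) \<partial>PiM I (\<lambda>_. M)) = expectation h"
proof -
  have "M = distr (PiM I (\<lambda>_. M)) M (\<lambda>x. x i)"
    using assms(1) by (rule distr_PiM_component[of I "\<lambda>_. M", symmetric, rotated]) (rule prob_space_axioms)
  then have "expectation h = integral\<^sup>L (distr (PiM I (\<lambda>_. M)) M (\<lambda>x. x i)) h" by simp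
  also have "\<dots> = (\<integral>x. h (x i) \<partial>PiM I (\<lambda>_. M))"
    using assms by (intro integral_distr measurable_component_singleton)
  finally show ?thesis by simp
qed

lemma (in prob_space) integral_PiM_distr:
  fixes h :: "('i \<Rightarrow> 'b) \<Rightarrow> real"
  assumes "finite I" and X[measurable]: "X \<in> measurable M N"
    and h: "h \<in> borel_measurable (PiM I (\<lambda>_. N))"
  shows "(\<integral>x. h x \<partial>PiM I (\<lambda>_. distr M N X)) = (\<integral>x. h (\<lambda>i\<in>I. X (x i)) \<partial>PiM I (\<lambda>_. M))"
proof -
  let ?N = "distr M N X"
  have "distr (PiM I (\<lambda>_. M)) (PiM I (\<lambda>_. ?N)) (compose I X) = PiM I (\<lambda>_. distr M ?N X)"
    using prob_space_distr[OF X] prob_space_axioms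
    by (intro distr_PiM_finite_prob_space') (auto simp: assms(1))
  also have "distr M ?N X = ?N" by (rule distr_cong) auto
  finally have "(\<integral>x. h x \<partial>PiM I (\<lambda>_. ?N)) = (\<integral>x. h x \<partial>distr (PiM I (\<lambda>_. M)) (PiM I (\<lambda>_. ?N)) (compose I X))"
    by simp
  also have "\<dots> = (\<integral>x. h (compose I X x) \<partial>PiM I (\<lambda>_. M))"
  proof (rule integral_distr)
    show "compose I X \<in> measurable (PiM I (\<lambda>_. M)) (PiM I (\<lambda>_. ?N))"
      unfolding compose_def
      by (intro measurable_restrict measurable_compose[OF measurable_component_singleton]) auto
    show "h \<in> borel_measurable (PiM I (\<lambda>_. ?N))"
      using h by (subst measurable_cong_sets[OF sets_PiM_cong refl]) auto
  qed
  finally show ?thesis by (simp add: compose_def)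
qed

text \<open>
  Averaging a signed sum of length \<open>n\<close> over its \<open>n\<close> cyclic windows of length \<open>k\<close>.
\<close>

lemma (in bounded_class) rademacher_antimono:
  assumes k: "1 \<le> k" "k \<le> n"
  shows "rademacher D n F \<le> rademacher D k F"
proof -
  \<comment> \<open>This is \<open>i + j\<close> modulo \<open>n\<close>. Wrapping around makes the
    windows cover all positions evenly for every \<open>k \<le> n\<close>, without
    divisibility.\<close>
  define s :: "nat \<Rightarrow> nat \<Rightarrow> nat" where "s j i = (if i + j < n then i + j else i + j - n)" for j i
  let ?P = "\<lambda>n. \<Pi>\<^sub>M i\<in>{..<n}. D"
  define A where "A n = (\<integral>x. sign_mean n (\<lambda>\<sigma>. signed_sup F n \<sigma> x) \<partial>?P n)" for n
  define V where "V \<sigma> x j = signed_sup F k (\<lambda>i. if i < k then \<sigma> (s j i) else 0) (\<lambda>i\<in>{..<k}. x (s j i))" for \<sigma> x j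
  have s_bij: "bij_betw (\<lambda>j. s j i) {..<n} {..<n}" if "i < n" for i
    using that by (intro bij_betw_byWitness[where f'="\<lambda>j. if i \<le> j then j - i else j + n - i"]) (auto simp: s_def)
  have windows: "real k * signed_sup F n \<sigma> x \<le> (\<Sum>j<n. V \<sigma> x j)" for \<sigma> x
  proof -
    have "signed_sup F n \<sigma> x \<le> (\<Sum>j<n. V \<sigma> x j) / k"
      unfolding signed_sup_def
    proof (rule cSUP_least[OF F_nonempty])
      fix f assume f: "f \<in> F"
      let ?a = "\<lambda>i. \<sigma> i * f (x i)"
      \<comment> \<open>For a fixed offset \<open>i\<close> the window start \<open>j\<close> runs
        through a permutation of the positions, so each position is counted \<open>k\<close>
        times.\<close>
      have "real k * (\<Sum>i<n. ?a i) = (\<Sum>i<k. \<Sum>j<n. ?a (s j i))"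
        using sum.reindex_bij_betw[OF s_bij, of _ ?a] k by simp
      also have "\<dots> = (\<Sum>j<n. \<Sum>i<k. ?a (s j i))" by (rule sum.swap)
      also have "\<dots> \<le> (\<Sum>j<n. V \<sigma> x j)"
      proof (rule sum_mono)
        fix j
        have "(\<Sum>i<k. ?a (s j i)) = (\<Sum>i<k. (if i < k then \<sigma> (s j i) else 0) * f ((\<lambda>i\<in>{..<k}. x (s j i)) i))"
          by (intro sum.cong) auto
        also have "\<dots> \<le> V \<sigma> x j"
          unfolding V_def signed_sup_def by (rule cSUP_upper[OF f bdd_signed_sum])
        finally show "(\<Sum>i<k. ?a (s j i)) \<le> V \<sigma> x j" .
      qed
      finally show "(\<Sum>i<n. ?a i) \<le> (\<Sum>j<n. V \<sigma> x j) / k"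
        using k by (simp add: field_simps)
    qed
    then show ?thesis using k by (simp add: field_simps)
  qed
  have V: "sign_mean n (\<lambda>\<sigma>. V \<sigma> x j) = sign_mean k (\<lambda>\<tau>. signed_sup F k \<tau> (\<lambda>i\<in>{..<k}. x (s j i)))"
    and V_int: "(\<integral>x. sign_mean k (\<lambda>\<tau>. signed_sup F k \<tau> (\<lambda>i\<in>{..<k}. x (s j i))) \<partial>?P n) = A k"
    and V_integrable: "integrable (?P n) (\<lambda>x. sign_mean k (\<lambda>\<tau>. signed_sup F k \<tau> (\<lambda>i\<in>{..<k}. x (s j i))))"
    if "j < n" for j x
  proof -
    have inj: "inj_on (s j) {..<k}" and img: "s j ` {..<k} \<subseteq> {..<n}"
      using that k by (auto simp: s_def inj_on_def split: if_splits)
    show "sign_mean n (\<lambda>\<sigma>. V \<sigma> x j) = sign_mean k (\<lambda>\<tau>. signed_sup F k \<tau> (\<lambda>i\<in>{..<k}. x (s j i)))"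
      unfolding V_def by (rule sign_mean_reindex[OF inj img])
    show "(\<integral>x. sign_mean k (\<lambda>\<tau>. signed_sup F k \<tau> (\<lambda>i\<in>{..<k}. x (s j i))) \<partial>?P n) = A k"
      unfolding A_def
      by (rule integral_PiM_reindex[OF inj img, of "\<lambda>x. sign_mean k (\<lambda>\<tau>. signed_sup F k \<tau> x)"])
        (rule measurable_sign_mean_sup, simp)
    have "(\<lambda>x. \<lambda>i\<in>{..<k}. x (s j i)) \<in> measurable (?P n) (?P k)"
      using img by (intro measurable_restrict measurable_component_singleton) auto
    then show "integrable (?P n) (\<lambda>x. sign_mean k (\<lambda>\<tau>. signed_sup F k \<tau> (\<lambda>i\<in>{..<k}. x (s j i))))"
      by (intro prob_space.integrable_bounded[OF prob_space_sample, where B="real k"]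
          abs_sign_mean_le abs_signed_sup_le)
        (auto intro: measurable_compose[OF _ measurable_sign_mean_sup[of "\<lambda>x. x"]])
  qed
  have "real k * A n = (\<integral>x. sign_mean n (\<lambda>\<sigma>. real k * signed_sup F n \<sigma> x) \<partial>?P n)"
    unfolding A_def sign_mean_cmult by simp
  also have "\<dots> \<le> (\<integral>x. (\<Sum>j<n. sign_mean k (\<lambda>\<tau>. signed_sup F k \<tau> (\<lambda>i\<in>{..<k}. x (s j i)))) \<partial>?P n)"
  proof (rule integral_mono)
    show "integrable (?P n) (\<lambda>x. sign_mean n (\<lambda>\<sigma>. real k * signed_sup F n \<sigma> x))"
      unfolding sign_mean_cmult by (intro integrable_mult_right integrable_sign_mean_sup)
    show "integrable (?P n) (\<lambda>x. \<Sum>j<n. sign_mean k (\<lambda>\<tau>. signed_sup F k \<tau> (\<lambda>i\<in>{..<k}. x (s j i))))"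
      by (intro Bochner_Integration.integrable_sum V_integrable) auto
    fix x
    have "sign_mean n (\<lambda>\<sigma>. real k * signed_sup F n \<sigma> x) \<le> sign_mean n (\<lambda>\<sigma>. \<Sum>j<n. V \<sigma> x j)"
      by (intro sign_mean_mono windows)
    also have "\<dots> = (\<Sum>j<n. sign_mean n (\<lambda>\<sigma>. V \<sigma> x j))"
      unfolding sign_mean_def by (subst sum.swap) (simp add: sum_divide_distrib)
    finally show "sign_mean n (\<lambda>\<sigma>. real k * signed_sup F n \<sigma> x)
        \<le> (\<Sum>j<n. sign_mean k (\<lambda>\<tau>. signed_sup F k \<tau> (\<lambda>i\<in>{..<k}. x (s j i))))"
      by (simp add: V)
  qed
  also have "\<dots> = real n * A k"
    by (subst Bochner_Integration.integral_sum) (auto simp: V_int intro: V_integrable)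
  finally show ?thesis
    using k unfolding rademacher_eq_sign_mean A_def[symmetric] by (simp add: field_simps)
qed

text \<open>The complexity integrates over features, the deviations over examples; \<open>X\<close>
  projects examples to features. It is applied to triples as well as to pairs of features and label,
  whose feature marginals agree.\<close>

lemma (in bounded_class) rademacher_mgf_sample:
  assumes M: "prob_space M" and X: "X \<in> measurable M N" and D: "D = distr M N X"
    and l: "l \<ge> 0" and n: "n \<ge> 1"
  shows "(\<integral>x. sign_mean n (\<lambda>\<sigma>. exp (l / n * signed_sup F n \<sigma> (\<lambda>i. X (x i)))) \<partial>(\<Pi>\<^sub>M i\<in>{..<n}. M))
    \<le> exp (l * rademacher D n F + l\<^sup>2 / n)"
proof -
  let ?h = "\<lambda>x. sign_mean n (\<lambda>\<sigma>. exp (l / n * signed_sup F n \<sigma> x))"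
  have "sets (\<Pi>\<^sub>M i\<in>{..<n}. D) = sets (\<Pi>\<^sub>M i\<in>{..<n}. N)"
    by (intro sets_PiM_cong) (auto simp: D)
  moreover have "?h \<in> borel_measurable (\<Pi>\<^sub>M i\<in>{..<n}. D)"
    by (rule measurable_sign_mean_sup) simp
  ultimately have "?h \<in> borel_measurable (\<Pi>\<^sub>M i\<in>{..<n}. N)"
    by (simp cong: measurable_cong_sets)
  then have "(\<integral>x. ?h x \<partial>(\<Pi>\<^sub>M i\<in>{..<n}. D)) = (\<integral>x. ?h (\<lambda>i\<in>{..<n}. X (x i)) \<partial>(\<Pi>\<^sub>M i\<in>{..<n}. M))"
    unfolding D by (intro prob_space.integral_PiM_distr[OF M _ X]) auto
  also have "(\<lambda>x. ?h (\<lambda>i\<in>{..<n}. X (x i))) = (\<lambda>x. ?h (\<lambda>i. X (x i)))"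
    by (intro ext sign_mean_cong arg_cong[where f=exp] arg_cong2[where f="(*)"] refl signed_sup_cong) auto
  finally show ?thesis using rademacher_mgf[OF l n] by simp
qed

text \<open>
  The supremum over \<open>K\<close> need not be measurable in the sample.  Swapping the ghost sample is
  therefore carried out for the selected element \<open>A S\<close>, and the supremum enters only pointwise.
\<close>

lemma (in prob_space) symmetrization_mgf:
  fixes loss :: "'k \<Rightarrow> 'a \<Rightarrow> real" and A :: "(nat \<Rightarrow> 'a) \<Rightarrow> 'k" and Q :: "(nat \<Rightarrow> 'a) \<Rightarrow> real"
  assumes l: "l \<ge> 0" and n: "n \<ge> 1"
    and meas: "(\<lambda>(S, z). loss (A S) z) \<in> borel_measurable ((\<Pi>\<^sub>M i\<in>{..<n}. M) \<Otimes>\<^sub>M M)"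
    and AK: "\<And>S. S \<in> space (\<Pi>\<^sub>M i\<in>{..<n}. M) \<Longrightarrow> A S \<in> K"
    and B: "\<And>k z. k \<in> K \<Longrightarrow> z \<in> space M \<Longrightarrow> \<bar>loss k z\<bar> \<le> B"
    and Q: "integrable (\<Pi>\<^sub>M i\<in>{..<n}. M) Q"
    and QB: "\<And>S. S \<in> space (\<Pi>\<^sub>M i\<in>{..<n}. M) \<Longrightarrow>
      sign_mean n (\<lambda>\<sigma>. exp (2 * l / n * (SUP k\<in>K. \<Sum>i<n. \<sigma> i * loss k (S i)))) \<le> Q S"
  shows "(\<integral>S. exp (l * (expectation (loss (A S)) - (\<Sum>i<n. loss (A S) (S i)) / n)) \<partial>(\<Pi>\<^sub>M i\<in>{..<n}. M))
    \<le> (\<integral>S. Q S \<partial>(\<Pi>\<^sub>M i\<in>{..<n}. M))"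
proof -
  \<comment> \<open>The sample occupies \<open>I\<close>, the ghost sample \<open>J\<close>, and
    both live on the single product indexed by \<open>L\<close>, so that exchanging them is a
    permutation of indices.\<close>
  define I J L where "I = {..<n}" and "J = {n..<2 * n}" and "L = {..<2 * n}"
  have IJ: "I \<union> J = L" "I \<inter> J = {}" "finite I" "finite J" "I \<subseteq> L" "J \<subseteq> L"
    by (auto simp: I_def J_def L_def)
  have idx: "i \<in> I" "n + i \<in> J" "i \<in> L" "n + i \<in> L" "n + i \<notin> I" if "i < n" for i
    using that by (auto simp: I_def J_def L_def)
  let ?P = "\<lambda>I. \<Pi>\<^sub>M i\<in>I. M"
  have pI: "prob_space (?P I)" for I :: "nat set" by (rule prob_space_PiM) (rule prob_space_axioms)
  have psf: "product_sigma_finite (\<lambda>_::nat. M)"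
    by (simp add: product_sigma_finite_def sigma_finite_measure_axioms)
  note [measurable] = meas[folded I_def]
  have comp: "x i \<in> space M" if "x \<in> space (?P I)" "i \<in> I" for x i and I :: "nat set"
    using that by (auto simp: space_PiM)
  have lA: "loss (A S) \<in> borel_measurable M" if "S \<in> space (?P I)" for S
    using that measurable_compose[OF measurable_Pair1' meas[folded I_def]] by simp
  define W where "W \<omega> = exp (l / n * (\<Sum>i<n. loss (A (restrict \<omega> I)) (\<omega> (n + i)) - loss (A (restrict \<omega> I)) (\<omega> i)))" for \<omega>
  have restr[measurable]: "(\<lambda>\<omega>. restrict \<omega> I) \<in> measurable (?P L) (?P I)"
    using IJ by (intro measurable_restrict_subset) auto
  have ev[measurable]: "(\<lambda>\<omega>. loss (A (restrict \<omega> I)) (\<omega> j)) \<in> borel_measurable (?P L)" if "j \<in> L" for j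
    using measurable_compose[OF measurable_Pair[OF restr measurable_component_singleton[OF that, of "\<lambda>_. M"]] meas[folded I_def]]
    by simp
  have W_meas[measurable]: "W \<in> borel_measurable (?P L)"
    unfolding W_def by (intro borel_measurable_exp measurable_compose[OF _ borel_measurable_exp] borel_measurable_times borel_measurable_const borel_measurable_sum borel_measurable_diff ev)
      (auto simp: L_def)
  have B0: "0 \<le> B"
  proof -
    obtain S z where "S \<in> space (?P {..<n})" "z \<in> space M"
      using prob_space.not_empty[OF pI] not_empty by blast
    then show ?thesis using B[OF AK, of S z] by linarith
  qed
  have W_bound: "\<bar>W \<omega>\<bar> \<le> exp (l / n * (n * (2 * B)))" if w: "\<omega> \<in> space (?P L)" for \<omega>
  proof -
    have "A (restrict \<omega> I) \<in> K"
      using AK[folded I_def] measurable_space[OF restr w] by simp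
    then have "(\<Sum>i<n. loss (A (restrict \<omega> I)) (\<omega> (n + i)) - loss (A (restrict \<omega> I)) (\<omega> i)) \<le> (\<Sum>i<n. 2 * B)"
      using B[of _ "\<omega> _"] comp[OF w] idx by (intro sum_mono) (smt (verit, best) lessThan_iff)
    then have "l / n * (\<Sum>i<n. loss (A (restrict \<omega> I)) (\<omega> (n + i)) - loss (A (restrict \<omega> I)) (\<omega> i)) \<le> l / n * (n * (2 * B))"
      using l by (intro mult_left_mono) auto
    then show ?thesis by (simp add: W_def)
  qed
  have W_int: "integrable (?P L) W"
    using W_bound by (intro prob_space.integrable_bounded[OF pI]) auto

  \<comment> \<open>Given the sample, the element \<open>A S\<close> is fixed and the ghost averages
    have the true expectation as their mean; convexity moves the integral over the ghost sample
    outside the exponential.\<close>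
  have jensen: "exp (l * (expectation (loss (A S)) - (\<Sum>i<n. loss (A S) (S i)) / n))
      \<le> (\<integral>S'. W (merge I J (S, S')) \<partial>?P J)" if S: "S \<in> space (?P I)" for S
  proof -
    interpret J: prob_space "?P J" by (rule pI)
    let ?X = "\<lambda>S'. l / n * (\<Sum>i<n. loss (A S) (S' (n + i)) - loss (A S) (S i))"
    have AS: "A S \<in> K" using AK S by (simp add: I_def)
    have [measurable]: "loss (A S) \<in> borel_measurable M" by (rule lA[OF S])
    have c_meas: "(\<lambda>S'. loss (A S) (S' (n + i))) \<in> borel_measurable (?P J)" if "i < n" for i
      by (rule measurable_compose[OF _ lA[OF S]], rule measurable_component_singleton) (rule idx[OF that])
    have c_int: "integrable (?P J) (\<lambda>S'. loss (A S) (S' (n + i)))" if "i < n" for i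
      using c_meas[OF that] B[OF AS] comp[of _ J] idx[OF that] by (intro J.integrable_bounded[where B=B]) auto
    have "(\<integral>S'. loss (A S) (S' (n + i)) \<partial>?P J) = expectation (loss (A S))" if "i < n" for i
      using idx[OF that] by (intro integral_PiM_component) auto
    then have "(\<integral>S'. ?X S' \<partial>?P J) = l / n * (\<Sum>i<n. expectation (loss (A S)) - loss (A S) (S i))"
      using c_int by (simp add: J.prob_space)
    also have "\<dots> = l * (expectation (loss (A S)) - (\<Sum>i<n. loss (A S) (S i)) / n)"
      using n by (simp add: sum_subtractf field_simps)
    finally have mean: "(\<integral>S'. ?X S' \<partial>?P J) = l * (expectation (loss (A S)) - (\<Sum>i<n. loss (A S) (S i)) / n)" .
    have W_merge: "W (merge I J (S, S')) = exp (?X S')" for S'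
    proof -
      have "restrict (merge I J (S, S')) I = S"
        using S by (auto simp: space_PiM PiE_def extensional_def merge_def fun_eq_iff)
      moreover have "merge I J (S, S') i = S i" "merge I J (S, S') (n + i) = S' (n + i)" if "i < n" for i
        using idx[OF that] by (auto simp: merge_def)
      ultimately show ?thesis
        unfolding W_def by (intro arg_cong[where f=exp] arg_cong2[where f="(*)"] sum.cong) auto
    qed
    have X_int: "integrable (?P J) ?X"
      by (intro integrable_mult_right Bochner_Integration.integrable_sum Bochner_Integration.integrable_diff
          c_int J.integrable_const) auto
    have "exp (\<integral>S'. ?X S' \<partial>?P J) \<le> (\<integral>S'. exp (?X S') \<partial>?P J)"
    proof (rule J.jensens_inequality[OF X_int, of UNIV])
      show "integrable (?P J) (\<lambda>S'. exp (?X S'))"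
      proof (rule J.integrable_bounded)
        show "(\<lambda>S'. exp (?X S')) \<in> borel_measurable (?P J)"
          using X_int by auto
        fix S' assume S': "S' \<in> space (?P J)"
        have "merge I J (S, S') \<in> space (?P L)"
          using S S' IJ by (auto simp: space_PiM PiE_def extensional_def merge_def)
        then show "\<bar>exp (?X S')\<bar> \<le> exp (l / n * (n * (2 * B)))"
          using W_bound W_merge by metis
      qed
    qed (auto intro: exp_convex)
    then show ?thesis by (simp only: mean W_merge)
  qed

  \<comment> \<open>The positions \<open>j\<close> and \<open>n + j\<close> trade places exactly
    where the sign is not 1. The product law is invariant under this permutation, whichever signs
    are used.\<close>
  define sw where "sw \<sigma> j = (if j < n then if \<sigma> j = (1::real) then j else n + j
    else if \<sigma> (j - n) = 1 then j else j - n)" for \<sigma> j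
  define T where "T \<sigma> \<omega> = (\<lambda>j\<in>L. \<omega> (sw \<sigma> j) :: 'a)" for \<sigma> \<omega>
  have sw_inj: "inj_on (sw \<sigma>) L" and sw_img: "sw \<sigma> ` L \<subseteq> L" for \<sigma>
    by (auto simp: sw_def L_def inj_on_def split: if_splits)
  have T_meas[measurable]: "T \<sigma> \<in> measurable (?P L) (?P L)" for \<sigma>
    unfolding T_def using sw_img[of \<sigma>] by (intro measurable_restrict measurable_component_singleton) auto
  have T_int: "(\<integral>\<omega>. W (T \<sigma> \<omega>) \<partial>?P L) = (\<integral>\<omega>. W \<omega> \<partial>?P L)" for \<sigma>
    unfolding T_def by (rule integral_PiM_reindex[OF sw_inj sw_img W_meas])
  define S1 where "S1 \<omega> = (\<lambda>i\<in>I. \<omega> i :: 'a)" for \<omega>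
  define S2 where "S2 \<omega> = (\<lambda>i\<in>I. \<omega> (n + i) :: 'a)" for \<omega>
  have S_meas[measurable]: "S1 \<in> measurable (?P L) (?P I)" "S2 \<in> measurable (?P L) (?P I)"
    unfolding S1_def S2_def by (auto intro!: measurable_restrict measurable_component_singleton simp: I_def L_def)
  have Q_meas[measurable]: "Q \<in> borel_measurable (?P I)" using Q by (auto simp: I_def)
  have inj1: "inj_on (\<lambda>i. i) I" "(\<lambda>i. i) ` I \<subseteq> L" and inj2: "inj_on ((+) n) I" "(+) n ` I \<subseteq> L"
    using IJ idx by (auto simp: I_def L_def)
  have S1_int: "(\<integral>\<omega>. Q (S1 \<omega>) \<partial>?P L) = (\<integral>S. Q S \<partial>?P I)"
    unfolding S1_def by (rule integral_PiM_reindex[OF inj1 Q_meas])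
  have S2_int: "(\<integral>\<omega>. Q (S2 \<omega>) \<partial>?P L) = (\<integral>S. Q S \<partial>?P I)"
    unfolding S2_def by (rule integral_PiM_reindex[OF inj2 Q_meas])
  have Q_integrable: "integrable (?P L) (\<lambda>\<omega>. Q (S1 \<omega>))" "integrable (?P L) (\<lambda>\<omega>. Q (S2 \<omega>))"
  proof -
    have "integrable (distr (?P L) (?P I) S1) Q"
      unfolding S1_def using Q[folded I_def] inj1 prob_space_axioms by (subst distr_PiM_reindex) auto
    then show "integrable (?P L) (\<lambda>\<omega>. Q (S1 \<omega>))" by (subst (asm) integrable_distr_eq) auto
    have "integrable (distr (?P L) (?P I) S2) Q"
      unfolding S2_def using Q[folded I_def] inj2 prob_space_axioms by (subst distr_PiM_reindex) auto
    then show "integrable (?P L) (\<lambda>\<omega>. Q (S2 \<omega>))" by (subst (asm) integrable_distr_eq) auto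
  qed

  have swapped: "sign_mean n (\<lambda>\<sigma>. W (T \<sigma> \<omega>)) \<le> (Q (S2 \<omega>) + Q (S1 \<omega>)) / 2"
    if w: "\<omega> \<in> space (?P L)" for \<omega>
  proof -
    define U where "U \<sigma> S = (SUP k\<in>K. \<Sum>i<n. \<sigma> i * loss k (S i))" for \<sigma> and S :: "nat \<Rightarrow> 'a"
    have sp: "S1 \<omega> \<in> space (?P I)" "S2 \<omega> \<in> space (?P I)"
      using measurable_space[OF S_meas(1) w] measurable_space[OF S_meas(2) w] by auto
    have bdd: "bdd_above ((\<lambda>k. \<Sum>i<n. \<sigma> i * loss k (S i)) ` K)" if "S \<in> space (?P I)" for \<sigma> S
      using B comp[OF that] idx(1)
      by (intro bdd_above_coefficient_sum[where t="\<lambda>k i. loss k (S i)" and B=B]) auto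
    have "W (T \<sigma> \<omega>) \<le> (exp (2 * l / n * U \<sigma> (S2 \<omega>)) + exp (2 * l / n * U (\<lambda>i. -1 * \<sigma> i) (S1 \<omega>))) / 2"
      if \<sigma>: "\<sigma> \<in> signs n" for \<sigma>
    proof -
      \<comment> \<open>The exchange alters the half on which \<open>A\<close> is trained, so
        \<open>k\<close> depends on \<open>\<sigma>\<close>. Passing to the suprema in
        \<open>U\<close> removes this dependence before signs are averaged.\<close>
      define k where "k = A (restrict (T \<sigma> \<omega>) I)"
      have "T \<sigma> \<omega> \<in> space (?P L)" using measurable_space[OF T_meas w] .
      from measurable_space[OF restr this] have k: "k \<in> K"
        unfolding k_def using AK by (simp add: I_def)
      have "loss k (T \<sigma> \<omega> (n + i)) - loss k (T \<sigma> \<omega> i) = \<sigma> i * loss k (S2 \<omega> i) + (-1 * \<sigma> i) * loss k (S1 \<omega> i)"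
        if "i < n" for i
        using signsD[OF \<sigma> that] idx[OF that] that by (auto simp: T_def sw_def S1_def S2_def)
      then have "(\<Sum>i<n. loss k (T \<sigma> \<omega> (n + i)) - loss k (T \<sigma> \<omega> i))
          = (\<Sum>i<n. \<sigma> i * loss k (S2 \<omega> i)) + (\<Sum>i<n. (-1 * \<sigma> i) * loss k (S1 \<omega> i))"
        unfolding sum.distrib[symmetric] by (intro sum.cong) auto
      also have "\<dots> \<le> U \<sigma> (S2 \<omega>) + U (\<lambda>i. -1 * \<sigma> i) (S1 \<omega>)"
        unfolding U_def by (intro add_mono cSUP_upper k bdd sp)
      finally have "l / n * (\<Sum>i<n. loss k (T \<sigma> \<omega> (n + i)) - loss k (T \<sigma> \<omega> i))
          \<le> l / n * (U \<sigma> (S2 \<omega>) + U (\<lambda>i. -1 * \<sigma> i) (S1 \<omega>))"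
        using l by (intro mult_left_mono) auto
      then have "W (T \<sigma> \<omega>) \<le> exp (l / n * (U \<sigma> (S2 \<omega>) + U (\<lambda>i. -1 * \<sigma> i) (S1 \<omega>)))"
        by (simp add: W_def k_def)
      \<comment> \<open>The split leaves one half of the double sample in each exponential, as
        \<open>Q\<close> requires; this is where \<open>l\<close> turns into
        \<open>2 * l\<close>.\<close>
      also have "\<dots> \<le> (exp (2 * l / n * U \<sigma> (S2 \<omega>)) + exp (2 * l / n * U (\<lambda>i. -1 * \<sigma> i) (S1 \<omega>))) / 2"
      proof -
        have "l / n * (U \<sigma> (S2 \<omega>) + U (\<lambda>i. -1 * \<sigma> i) (S1 \<omega>))
            = (2 * l / n * U \<sigma> (S2 \<omega>) + 2 * l / n * U (\<lambda>i. -1 * \<sigma> i) (S1 \<omega>)) / 2"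
          by (simp add: algebra_simps add_divide_distrib)
        then show ?thesis by (simp only: exp_half_sum_le)
      qed
      finally show ?thesis .
    qed
    then have "sign_mean n (\<lambda>\<sigma>. W (T \<sigma> \<omega>))
      \<le> sign_mean n (\<lambda>\<sigma>. (1/2) * (exp (2 * l / n * U \<sigma> (S2 \<omega>)) + exp (2 * l / n * U (\<lambda>i. -1 * \<sigma> i) (S1 \<omega>))))"
      by (intro sign_mean_mono) auto
    also have "\<dots> = (1/2) * (sign_mean n (\<lambda>\<sigma>. exp (2 * l / n * U \<sigma> (S2 \<omega>)))
        + sign_mean n (\<lambda>\<sigma>. exp (2 * l / n * U (\<lambda>i. -1 * \<sigma> i) (S1 \<omega>))))"
      by (simp only: sign_mean_cmult sign_mean_add)
    also have "sign_mean n (\<lambda>\<sigma>. exp (2 * l / n * U (\<lambda>i. -1 * \<sigma> i) (S1 \<omega>)))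
        = sign_mean n (\<lambda>\<sigma>. exp (2 * l / n * U \<sigma> (S1 \<omega>)))"
      by (rule sign_mean_flip) auto
    also have "(1/2) * (sign_mean n (\<lambda>\<sigma>. exp (2 * l / n * U \<sigma> (S2 \<omega>)))
        + sign_mean n (\<lambda>\<sigma>. exp (2 * l / n * U \<sigma> (S1 \<omega>)))) \<le> (1/2) * (Q (S2 \<omega>) + Q (S1 \<omega>))"
      unfolding U_def using sp by (intro mult_left_mono add_mono QB) (auto simp: I_def)
    finally show ?thesis by simp
  qed

  have "(\<integral>S. exp (l * (expectation (loss (A S)) - (\<Sum>i<n. loss (A S) (S i)) / n)) \<partial>?P I)
      \<le> (\<integral>S. (\<integral>S'. W (merge I J (S, S')) \<partial>?P J) \<partial>?P I)"
  proof (rule integral_mono')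
    have "W \<circ> merge I J \<in> borel_measurable (?P I \<Otimes>\<^sub>M ?P J)"
      using measurable_comp[OF measurable_merge W_meas[folded IJ(1)]] .
    then have [measurable]: "(\<lambda>(S, S'). W (merge I J (S, S'))) \<in> borel_measurable (?P I \<Otimes>\<^sub>M ?P J)"
      by (simp add: comp_def case_prod_unfold)
    have W_mI: "merge I J (S, S') \<in> space (?P L)" if "S \<in> space (?P I)" "S' \<in> space (?P J)" for S S'
      using that IJ by (auto simp: space_PiM PiE_def extensional_def merge_def)
    interpret J: prob_space "?P J" by (rule pI)
    show "integrable (?P I) (\<lambda>S. \<integral>S'. W (merge I J (S, S')) \<partial>?P J)"
    proof (rule prob_space.integrable_bounded[OF pI])
      show "(\<lambda>S. \<integral>S'. W (merge I J (S, S')) \<partial>?P J) \<in> borel_measurable (?P I)"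
        by measurable
      fix S assume S: "S \<in> space (?P I)"
      show "\<bar>\<integral>S'. W (merge I J (S, S')) \<partial>?P J\<bar> \<le> exp (l / n * (n * (2 * B)))"
        using W_bound[OF W_mI[OF S]] S by (intro J.abs_expectation_le) measurable
    qed
    show "0 \<le> (\<integral>S'. W (merge I J (S, S')) \<partial>?P J)" for S
      by (intro Bochner_Integration.integral_nonneg) (simp add: W_def)
  qed (rule jensen)
  also have "\<dots> = (\<integral>\<omega>. W \<omega> \<partial>?P L)"
    unfolding IJ(1)[symmetric] using W_int IJ
    by (intro product_sigma_finite.product_integral_fold[OF psf, symmetric]) auto
  also have "\<dots> = sign_mean n (\<lambda>\<sigma>. \<integral>\<omega>. W (T \<sigma> \<omega>) \<partial>?P L)"
    by (simp add: T_int sign_mean_const)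
  also have "\<dots> = (\<integral>\<omega>. sign_mean n (\<lambda>\<sigma>. W (T \<sigma> \<omega>)) \<partial>?P L)"
  proof -
    have "integrable (?P L) (\<lambda>\<omega>. W (T \<sigma> \<omega>))" for \<sigma>
      using W_bound measurable_space[OF T_meas]
      by (intro prob_space.integrable_bounded[OF pI measurable_compose[OF T_meas W_meas]]) auto
    then show ?thesis unfolding sign_mean_def by (simp add: Bochner_Integration.integral_sum)
  qed
  also have "\<dots> \<le> (\<integral>\<omega>. (Q (S2 \<omega>) + Q (S1 \<omega>)) / 2 \<partial>?P L)"
  proof (rule integral_mono')
    show "integrable (?P L) (\<lambda>\<omega>. (Q (S2 \<omega>) + Q (S1 \<omega>)) / 2)"
      using Q_integrable by auto
    fix \<omega> assume w: "\<omega> \<in> space (?P L)"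
    show "sign_mean n (\<lambda>\<sigma>. W (T \<sigma> \<omega>)) \<le> (Q (S2 \<omega>) + Q (S1 \<omega>)) / 2"
      by (rule swapped[OF w])
    moreover have "0 \<le> sign_mean n (\<lambda>\<sigma>. W (T \<sigma> \<omega>))"
      unfolding sign_mean_def W_def by (intro divide_nonneg_nonneg sum_nonneg) auto
    ultimately show "0 \<le> (Q (S2 \<omega>) + Q (S1 \<omega>)) / 2" by simp
  qed
  also have "\<dots> = (\<integral>S. Q S \<partial>?P I)"
    using Q_integrable S1_int S2_int by simp
  finally show ?thesis by (simp add: I_def)
qed

section \<open>Deviations of learned functions\<close>

text \<open>A one-sided condition centred at an upper level \<open>m\<close>, which need not be the
  mean, so \<open>m\<close> may always be raised. On a probability space, measurability and
  boundedness make the exponentials integrable, so the integral is not the default value 0. In the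
  usual normalization the variance proxy is \<open>2 * v\<close>.\<close>

definition sub_gaussian_above :: "'a measure \<Rightarrow> ('a \<Rightarrow> real) \<Rightarrow> real \<Rightarrow> real \<Rightarrow> bool" where
  "sub_gaussian_above M X m v \<longleftrightarrow> X \<in> borel_measurable M \<and> (\<exists>B. \<forall>x\<in>space M. \<bar>X x\<bar> \<le> B) \<and>
     (\<forall>l\<ge>0. (\<integral>x. exp (l * (X x - m)) \<partial>M) \<le> exp (v * l\<^sup>2))"

lemma sub_gaussian_aboveI:
  assumes "X \<in> borel_measurable M" "\<And>x. x \<in> space M \<Longrightarrow> \<bar>X x\<bar> \<le> B"
    and "\<And>l. l \<ge> 0 \<Longrightarrow> (\<integral>x. exp (l * (X x - m)) \<partial>M) \<le> exp (v * l\<^sup>2)"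
  shows "sub_gaussian_above M X m v"
  using assms unfolding sub_gaussian_above_def by blast

lemma sub_gaussian_above_measurable: "sub_gaussian_above M X m v \<Longrightarrow> X \<in> borel_measurable M"
  by (simp add: sub_gaussian_above_def)

lemma (in prob_space) integrable_exp:
  fixes X :: "'a \<Rightarrow> real" and l m B :: real
  assumes "X \<in> borel_measurable M" "\<And>x. x \<in> space M \<Longrightarrow> \<bar>X x\<bar> \<le> B"
  shows "integrable M (\<lambda>x. exp (l * (X x - m)))"
proof (rule integrable_bounded)
  fix x assume "x \<in> space M"
  have "l * (X x - m) \<le> \<bar>l\<bar> * \<bar>X x - m\<bar>" by (metis abs_ge_self abs_mult)
  also have "\<dots> \<le> \<bar>l\<bar> * (B + \<bar>m\<bar>)"
    using assms(2)[OF \<open>x \<in> space M\<close>] by (intro mult_left_mono) auto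
  finally show "\<bar>exp (l * (X x - m))\<bar> \<le> exp (\<bar>l\<bar> * (B + \<bar>m\<bar>))" by simp
qed (use assms in auto)

lemma (in prob_space) integrable_exp_sub_gaussian_above:
  "sub_gaussian_above M X m v \<Longrightarrow> integrable M (\<lambda>x. exp (l * (X x - m')))"
  unfolding sub_gaussian_above_def using integrable_exp by metis

lemma (in prob_space) sub_gaussian_above_mono:
  assumes X: "sub_gaussian_above M X m v" and "m \<le> m'" "v \<le> v'"
  shows "sub_gaussian_above M X m' v'"
proof -
  obtain B where B: "\<And>x. x \<in> space M \<Longrightarrow> \<bar>X x\<bar> \<le> B"
    using X by (auto simp: sub_gaussian_above_def)
  show ?thesis
  proof (rule sub_gaussian_aboveI[OF sub_gaussian_above_measurable[OF X] B])
    fix l :: real assume l: "l \<ge> 0"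
    have "(\<integral>x. exp (l * (X x - m')) \<partial>M) \<le> (\<integral>x. exp (l * (X x - m)) \<partial>M)"
      using l assms(2) by (intro integral_mono integrable_exp_sub_gaussian_above[OF X]) (simp add: mult_left_mono)
    also have "\<dots> \<le> exp (v * l\<^sup>2)" using X l by (auto simp: sub_gaussian_above_def)
    also have "\<dots> \<le> exp (v' * l\<^sup>2)" using assms(3) by (simp add: mult_right_mono)
    finally show "(\<integral>x. exp (l * (X x - m')) \<partial>M) \<le> exp (v' * l\<^sup>2)" .
  qed
qed

text \<open>
  No independence is assumed, which costs the factor 4.
\<close>

lemma (in prob_space) sub_gaussian_above_add:
  assumes X: "sub_gaussian_above M X m v" and Y: "sub_gaussian_above M Y m' v"
  shows "sub_gaussian_above M (\<lambda>x. X x + Y x) (m + m') (4 * v)"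
proof -
  obtain B B' where B: "\<And>x. x \<in> space M \<Longrightarrow> \<bar>X x\<bar> \<le> B" "\<And>x. x \<in> space M \<Longrightarrow> \<bar>Y x\<bar> \<le> B'"
    using X Y unfolding sub_gaussian_above_def by blast
  have XY: "X \<in> borel_measurable M" "Y \<in> borel_measurable M"
    using X Y by (auto dest: sub_gaussian_above_measurable)
  have bound: "\<bar>X x + Y x\<bar> \<le> B + B'" if "x \<in> space M" for x
    using B[OF that] by linarith
  show ?thesis
  proof (rule sub_gaussian_aboveI[OF borel_measurable_add[OF XY] bound])
    fix l :: real assume l: "l \<ge> 0"
    note int = integrable_exp_sub_gaussian_above[OF X, of "2 * l" m] integrable_exp_sub_gaussian_above[OF Y, of "2 * l" m']
    have "(\<integral>x. exp (l * (X x + Y x - (m + m'))) \<partial>M)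
        \<le> (\<integral>x. (exp (2 * l * (X x - m)) + exp (2 * l * (Y x - m'))) / 2 \<partial>M)"
    proof (rule integral_mono)
      show "integrable M (\<lambda>x. exp (l * (X x + Y x - (m + m'))))"
        using XY bound by (intro integrable_exp) auto
      show "integrable M (\<lambda>x. (exp (2 * l * (X x - m)) + exp (2 * l * (Y x - m'))) / 2)"
        using int by auto
      fix x
      show "exp (l * (X x + Y x - (m + m'))) \<le> (exp (2 * l * (X x - m)) + exp (2 * l * (Y x - m'))) / 2"
      proof -
        have "l * (X x + Y x - (m + m')) = (2 * l * (X x - m) + 2 * l * (Y x - m')) / 2"
          by (simp add: algebra_simps)
        then show ?thesis by (simp only: exp_half_sum_le)
      qed
    qed
    also have "\<dots> = ((\<integral>x. exp (2 * l * (X x - m)) \<partial>M) + (\<integral>x. exp (2 * l * (Y x - m')) \<partial>M)) / 2"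
      using int by simp
    also have "\<dots> \<le> (exp (v * (2 * l)\<^sup>2) + exp (v * (2 * l)\<^sup>2)) / 2"
    proof (intro divide_right_mono add_mono)
      have "2 * l \<ge> 0" using l by simp
      then show "(\<integral>x. exp (2 * l * (X x - m)) \<partial>M) \<le> exp (v * (2 * l)\<^sup>2)"
        "(\<integral>x. exp (2 * l * (Y x - m')) \<partial>M) \<le> exp (v * (2 * l)\<^sup>2)"
        using X Y unfolding sub_gaussian_above_def by blast+
    qed simp
    finally show "(\<integral>x. exp (l * (X x + Y x - (m + m'))) \<partial>M) \<le> exp (4 * v * l\<^sup>2)"
      by (simp add: power_mult_distrib mult_ac)
  qed
qed

lemma (in prob_space) sub_gaussian_above_nonpos:
  assumes [measurable]: "X \<in> borel_measurable M" and B: "\<And>x. x \<in> space M \<Longrightarrow> \<bar>X x\<bar> \<le> B"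
    and "\<And>x. x \<in> space M \<Longrightarrow> X x \<le> 0" and v: "v \<ge> 0"
  shows "sub_gaussian_above M X 0 v"
proof (rule sub_gaussian_aboveI[OF _ B])
  fix l :: real assume "l \<ge> 0"
  then have "(\<integral>x. exp (l * (X x - 0)) \<partial>M) \<le> (\<integral>x. 1 \<partial>M)"
    using assms B by (intro integral_mono integrable_exp) (auto simp: mult_nonneg_nonpos)
  also have "\<dots> \<le> exp (v * l\<^sup>2)" using v by (simp add: prob_space)
  finally show "(\<integral>x. exp (l * (X x - 0)) \<partial>M) \<le> exp (v * l\<^sup>2)" .
qed auto

lemma (in prob_space) sub_gaussian_above_tail:
  assumes X: "sub_gaussian_above M X m v" and v: "v > 0" and t: "t \<ge> 0"
  shows "prob {x \<in> space M. X x \<le> m + t} \<ge> 1 - exp (- (t\<^sup>2 / (4 * v)))"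
proof -
  have [measurable]: "X \<in> borel_measurable M" by (rule sub_gaussian_above_measurable[OF X])
  \<comment> \<open>The minimizer of \<open>v * l\<^sup>2 - l * t\<close>.\<close>
  define l where "l = t / (2 * v)"
  have l: "l \<ge> 0" using v t by (simp add: l_def)
  have "prob {x \<in> space M. exp (l * t) \<le> exp (l * (X x - m))}
      \<le> (\<integral>x. exp (l * (X x - m)) \<partial>M) / exp (l * t)"
    using integral_Markov_inequality_measure[OF integrable_exp_sub_gaussian_above[OF X, of l m],
        of "{}" "exp (l * t)"] by simp
  also have "\<dots> \<le> exp (v * l\<^sup>2) / exp (l * t)"
    using X l by (intro divide_right_mono) (auto simp: sub_gaussian_above_def)
  also have "\<dots> = exp (v * l\<^sup>2 - l * t)" by (simp add: exp_diff)
  also have "v * l\<^sup>2 - l * t = - (t\<^sup>2 / (4 * v))"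
    using v by (simp add: l_def power2_eq_square field_simps)
  finally have "prob {x \<in> space M. exp (l * t) \<le> exp (l * (X x - m))} \<le> exp (- (t\<^sup>2 / (4 * v)))" .
  moreover have "prob {x \<in> space M. \<not> X x \<le> m + t} \<le> prob {x \<in> space M. exp (l * t) \<le> exp (l * (X x - m))}"
    using l by (intro finite_measure_mono) (auto intro!: mult_left_mono)
  moreover have "prob {x \<in> space M. \<not> X x \<le> m + t} = 1 - prob {x \<in> space M. X x \<le> m + t}"
    by (rule prob_neg) measurable
  ultimately show ?thesis by linarith
qed

text \<open>Conditioning on the second component: a bound whose level and constant are the same for
  every fixed \<open>y\<close> survives integration over \<open>y\<close>. In staged learning
  \<open>y\<close> is the sample that trains the classifier.\<close>

lemma sub_gaussian_above_pair_fst: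
  assumes M: "prob_space M" and N: "prob_space N"
    and X: "X \<in> borel_measurable (M \<Otimes>\<^sub>M N)" and B: "\<And>z. z \<in> space (M \<Otimes>\<^sub>M N) \<Longrightarrow> \<bar>X z\<bar> \<le> B"
    and sec: "\<And>y. y \<in> space N \<Longrightarrow> sub_gaussian_above M (\<lambda>x. X (x, y)) m v"
  shows "sub_gaussian_above (M \<Otimes>\<^sub>M N) X m v"
proof -
  interpret M: prob_space M by fact
  interpret N: prob_space N by fact
  interpret pair_prob_space M N ..
  show ?thesis
  proof (rule sub_gaussian_aboveI[OF X B])
    fix l :: real assume l: "l \<ge> 0"
    have int: "integrable (M \<Otimes>\<^sub>M N) (\<lambda>z. exp (l * (X z - m)))" using X B by (rule integrable_exp)
    have "(\<integral>z. exp (l * (X z - m)) \<partial>(M \<Otimes>\<^sub>M N)) = (\<integral>y. (\<integral>x. exp (l * (X (x, y) - m)) \<partial>M) \<partial>N)"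
      using integral_snd[of "\<lambda>x y. exp (l * (X (x, y) - m))"] int by (simp add: case_prod_unfold)
    also have "\<dots> \<le> (\<integral>y. exp (v * l\<^sup>2) \<partial>N)"
      using sec l by (intro integral_mono') (auto simp: sub_gaussian_above_def)
    finally show "(\<integral>z. exp (l * (X z - m)) \<partial>(M \<Otimes>\<^sub>M N)) \<le> exp (v * l\<^sup>2)"
      by (simp add: N.prob_space)
  qed
qed

lemma sub_gaussian_above_pair_snd:
  assumes M: "prob_space M" and N: "prob_space N" and Y: "sub_gaussian_above N Y m v"
  shows "sub_gaussian_above (M \<Otimes>\<^sub>M N) (\<lambda>z. Y (snd z)) m v"
proof -
  interpret M: prob_space M by fact
  interpret N: prob_space N by fact
  interpret pair_prob_space M N ..
  obtain B where B: "\<And>y. y \<in> space N \<Longrightarrow> \<bar>Y y\<bar> \<le> B"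
    using Y by (auto simp: sub_gaussian_above_def)
  have [measurable]: "Y \<in> borel_measurable N" by (rule sub_gaussian_above_measurable[OF Y])
  show ?thesis
  proof (rule sub_gaussian_aboveI)
    show "\<bar>Y (snd z)\<bar> \<le> B" if "z \<in> space (M \<Otimes>\<^sub>M N)" for z
      using that B by (auto simp: space_pair_measure)
    fix l :: real assume l: "l \<ge> 0"
    have int: "integrable (M \<Otimes>\<^sub>M N) (\<lambda>z. exp (l * (Y (snd z) - m)))"
      using B by (intro integrable_exp[where B=B]) (auto simp: space_pair_measure)
    have "(\<integral>z. exp (l * (Y (snd z) - m)) \<partial>(M \<Otimes>\<^sub>M N)) = (\<integral>y. exp (l * (Y y - m)) \<partial>N)"
      using integral_fst'[OF int] by (simp add: M.prob_space)
    also have "\<dots> \<le> exp (v * l\<^sup>2)" using Y l by (simp add: sub_gaussian_above_def)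
    finally show "(\<integral>z. exp (l * (Y (snd z) - m)) \<partial>(M \<Otimes>\<^sub>M N)) \<le> exp (v * l\<^sup>2)" .
  qed measurable
qed

section \<open>Deviations of fixed functions and of learning rules\<close>

lemma (in prob_space) abs_sample_mean_le:
  fixes f :: "'a \<Rightarrow> real"
  assumes "n \<ge> 1" "S \<in> space (\<Pi>\<^sub>M i\<in>{..<n}. M)" "\<And>z. z \<in> space M \<Longrightarrow> \<bar>f z\<bar> \<le> (B::real)"
  shows "\<bar>(\<Sum>i<n. f (S i)) / real n\<bar> \<le> B"
proof -
  have "\<bar>\<Sum>i<n. f (S i)\<bar> \<le> (\<Sum>i<n. B)"
    using assms by (intro order_trans[OF sum_abs] sum_mono) (auto simp: space_PiM)
  then show ?thesis using assms(1) by (simp add: field_simps)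
qed

text \<open>A function chosen independently of the sample pays no complexity. This is the reversed
  deviation, needed for the competitor of an empirical minimizer; McDiarmid's inequality even gives
  half the stated constant.\<close>

lemma (in prob_space) sub_gaussian_above_sample_mean:
  fixes f :: "'a \<Rightarrow> real" and n :: nat
  assumes f[measurable]: "f \<in> borel_measurable M" and B: "\<And>z. z \<in> space M \<Longrightarrow> \<bar>f z\<bar> \<le> 1"
    and n: "n \<ge> 1"
  shows "sub_gaussian_above (\<Pi>\<^sub>M i\<in>{..<n}. M) (\<lambda>S. (\<Sum>i<n. f (S i)) / n - expectation f) 0 (1 / n)"
proof (rule sub_gaussian_aboveI)
  let ?P = "\<Pi>\<^sub>M i\<in>{..<n}. M"
  interpret P: prob_space ?P by (rule prob_space_PiM) (rule prob_space_axioms)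
  let ?X = "\<lambda>S. (\<Sum>i<n. f (S i)) / n - expectation f"
  have comp: "(\<lambda>S. f (S i)) \<in> borel_measurable ?P" if "i < n" for i
    by (rule measurable_compose[OF _ f], rule measurable_component_singleton) (use that in simp)
  show X[measurable]: "?X \<in> borel_measurable ?P"
    using comp by (intro borel_measurable_diff borel_measurable_divide borel_measurable_sum) auto
  have Ef: "\<bar>expectation f\<bar> \<le> 1" using f B by (rule abs_expectation_le)
  show X_bound: "\<bar>?X S\<bar> \<le> 2" if S: "S \<in> space ?P" for S
  proof -
    have "\<bar>(\<Sum>i<n. f (S i)) / real n\<bar> \<le> 1" using n S B by (rule abs_sample_mean_le)
    then show ?thesis using Ef by linarith
  qed
  fix l :: real assume l: "l \<ge> 0"
  have X_mean: "(\<integral>S. ?X S \<partial>?P) = 0"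
  proof -
    have int: "integrable ?P (\<lambda>S. f (S i))" if "i < n" for i
      using that B by (intro P.integrable_bounded[where B=1] comp) (auto simp: space_PiM)
    then have "integrable ?P (\<lambda>S. (\<Sum>i<n. f (S i)) / n)"
      by (intro integrable_divide Bochner_Integration.integrable_sum) auto
    then have "(\<integral>S. ?X S \<partial>?P) = (\<Sum>i<n. (\<integral>S. f (S i) \<partial>?P)) / n - expectation f"
      using int
      by (subst Bochner_Integration.integral_diff) (auto simp: P.prob_space Bochner_Integration.integral_sum)
    also have "(\<Sum>i<n. (\<integral>S. f (S i) \<partial>?P)) = (\<Sum>i<n. expectation f)"
      by (intro sum.cong integral_PiM_component) auto
    finally show ?thesis using n by simp
  qed
  have "(\<integral>S. exp (l * ?X S) \<partial>?P) \<le> exp ((\<integral>S. l * ?X S \<partial>?P) + card {..<n} * (l / n * 2)\<^sup>2 / 8)"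
  proof (rule mcdiarmid_mgf)
    show "(\<lambda>S. l * ?X S) \<in> borel_measurable ?P" using X by measurable
    show "\<bar>l * ?X S\<bar> \<le> l * 2" if "S \<in> space ?P" for S
      using X_bound[OF that] l unfolding abs_mult by (intro mult_mono) auto
    fix S i y assume S: "S \<in> space ?P" and i: "i \<in> {..<n}" and y: "y \<in> space M"
    have "(\<Sum>j<n. f (S j)) - (\<Sum>j<n. f ((S(i := y)) j)) = (\<Sum>j<n. if j = i then f (S i) - f y else 0)"
      unfolding sum_subtractf[symmetric] by (intro sum.cong) auto
    also have "\<dots> = f (S i) - f y" using i by simp
    finally have "l * ?X S - l * ?X (S(i := y)) = l / n * (f (S i) - f y)"
      by (simp flip: right_diff_distrib diff_divide_distrib)
    moreover have "\<bar>f (S i) - f y\<bar> \<le> 2"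
      using B[OF y] B[of "S i"] S i by (force simp: space_PiM)
    then have "l / n * \<bar>f (S i) - f y\<bar> \<le> l / n * 2"
      using l by (intro mult_left_mono) auto
    ultimately show "\<bar>l * ?X S - l * ?X (S(i := y))\<bar> \<le> l / n * 2"
      using l by (simp only: abs_mult) simp
  qed simp
  also have "(\<integral>S. l * ?X S \<partial>?P) = 0" using X_mean by simp
  also have "0 + card {..<n} * (l / n * 2)\<^sup>2 / 8 \<le> 1 / n * l\<^sup>2"
    using n by (simp add: power2_eq_square field_simps)
  finally show "(\<integral>S. exp (l * (?X S - 0)) \<partial>?P) \<le> exp (1 / n * l\<^sup>2)" by simp
qed

lemma (in prob_space) rule_deviation_measurable:
  fixes g :: "(nat \<Rightarrow> 'a) \<Rightarrow> 'a \<Rightarrow> real"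
  assumes n: "n \<ge> 1"
    and meas: "(\<lambda>(S, z). g S z) \<in> borel_measurable ((\<Pi>\<^sub>M i\<in>{..<n}. M) \<Otimes>\<^sub>M M)"
  shows "(\<lambda>S. expectation (g S) - (\<Sum>i<n. g S (S i)) / real n) \<in> borel_measurable (\<Pi>\<^sub>M i\<in>{..<n}. M)"
proof -
  let ?P = "\<Pi>\<^sub>M i\<in>{..<n}. M"
  have "(\<lambda>S. g S (S i)) \<in> borel_measurable ?P" if "i < n" for i
    using that measurable_compose[OF measurable_Pair[OF measurable_ident_sets[OF refl]
        measurable_component_singleton[of i "{..<n}" "\<lambda>_. M"]] meas] by simp
  moreover have "(\<lambda>S. expectation (g S)) \<in> borel_measurable ?P"
    using borel_measurable_lebesgue_integral[OF meas] by simp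
  ultimately show ?thesis by auto
qed

lemma (in prob_space) rule_deviation_bounded:
  fixes f :: "'a \<Rightarrow> real"
  assumes n: "n \<ge> 1" and S: "S \<in> space (\<Pi>\<^sub>M i\<in>{..<n}. M)"
    and "f \<in> borel_measurable M" "\<And>z. z \<in> space M \<Longrightarrow> \<bar>f z\<bar> \<le> (B::real)"
  shows "\<bar>expectation f - (\<Sum>i<n. f (S i)) / real n\<bar> \<le> 2 * B"
proof -
  have "\<bar>expectation f\<bar> \<le> B" using assms(3,4) by (rule abs_expectation_le)
  moreover have "\<bar>(\<Sum>i<n. f (S i)) / real n\<bar> \<le> B" using n S assms(4) by (rule abs_sample_mean_le)
  ultimately show ?thesis by linarith
qed

text \<open>The majorant \<open>Q l\<close> may vary with \<open>l\<close>, because symmetrization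
  acts at one exponent at a time. It carries the measurability that the supremum over
  \<open>K\<close> may lack.\<close>

lemma (in prob_space) sub_gaussian_above_rule:
  fixes loss :: "'k \<Rightarrow> 'a \<Rightarrow> real" and A :: "(nat \<Rightarrow> 'a) \<Rightarrow> 'k" and Q :: "real \<Rightarrow> (nat \<Rightarrow> 'a) \<Rightarrow> real"
  assumes n: "n \<ge> 1"
    and meas: "(\<lambda>(S, z). loss (A S) z) \<in> borel_measurable ((\<Pi>\<^sub>M i\<in>{..<n}. M) \<Otimes>\<^sub>M M)"
    and AK: "\<And>S. S \<in> space (\<Pi>\<^sub>M i\<in>{..<n}. M) \<Longrightarrow> A S \<in> K"
    and B: "\<And>k z. k \<in> K \<Longrightarrow> z \<in> space M \<Longrightarrow> \<bar>loss k z\<bar> \<le> B"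
    and Q: "\<And>l. l \<ge> 0 \<Longrightarrow> integrable (\<Pi>\<^sub>M i\<in>{..<n}. M) (Q l)"
    and QB: "\<And>l S. l \<ge> 0 \<Longrightarrow> S \<in> space (\<Pi>\<^sub>M i\<in>{..<n}. M) \<Longrightarrow>
      sign_mean n (\<lambda>\<sigma>. exp (2 * l / n * (SUP k\<in>K. \<Sum>i<n. \<sigma> i * loss k (S i)))) \<le> Q l S"
    and Q_int: "\<And>l. l \<ge> 0 \<Longrightarrow> (\<integral>S. Q l S \<partial>(\<Pi>\<^sub>M i\<in>{..<n}. M)) \<le> exp (l * m + v * l\<^sup>2)"
  shows "sub_gaussian_above (\<Pi>\<^sub>M i\<in>{..<n}. M)
    (\<lambda>S. expectation (loss (A S)) - (\<Sum>i<n. loss (A S) (S i)) / n) m v"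
proof (rule sub_gaussian_aboveI)
  let ?P = "\<Pi>\<^sub>M i\<in>{..<n}. M"
  let ?X = "\<lambda>S. expectation (loss (A S)) - (\<Sum>i<n. loss (A S) (S i)) / n"
  show "?X \<in> borel_measurable ?P"
    by (rule rule_deviation_measurable[OF n meas])
  show "\<bar>?X S\<bar> \<le> 2 * B" if S: "S \<in> space ?P" for S
    using measurable_compose[OF measurable_Pair1'[OF S] meas] B[OF AK[OF S]]
    by (intro rule_deviation_bounded[OF n S]) auto
  fix l :: real assume l: "l \<ge> 0"
  have "(\<integral>S. exp (l * (?X S - m)) \<partial>?P) = (\<integral>S. exp (- (l * m)) * exp (l * ?X S) \<partial>?P)"
    by (simp add: algebra_simps flip: exp_add)
  also have "\<dots> = exp (- (l * m)) * (\<integral>S. exp (l * ?X S) \<partial>?P)" by simp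
  also have "\<dots> \<le> exp (- (l * m)) * exp (l * m + v * l\<^sup>2)"
    using order_trans[OF symmetrization_mgf[OF l n meas AK B Q[OF l] QB[OF l]] Q_int[OF l]]
    by (intro mult_left_mono) auto
  finally show "(\<integral>S. exp (l * (?X S - m)) \<partial>?P) \<le> exp (v * l\<^sup>2)"
    by (simp flip: exp_add)
qed

definition sign_mgf :: "('a \<Rightarrow> real) set \<Rightarrow> nat \<Rightarrow> real \<Rightarrow> (nat \<Rightarrow> 'a) \<Rightarrow> real" where
  "sign_mgf F n l x = sign_mean n (\<lambda>\<sigma>. exp (l / n * signed_sup F n \<sigma> x))"

lemma (in bounded_class) integrable_sign_mgf_sample:
  assumes M: "prob_space M" and X: "X \<in> measurable M N" and D: "D = distr M N X"
  shows "integrable (\<Pi>\<^sub>M i\<in>{..<n}. M) (\<lambda>S. sign_mgf F n l (\<lambda>i. X (S i)))"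
proof -
  let ?h = "sign_mgf F n l"
  have P: "prob_space (\<Pi>\<^sub>M i\<in>{..<n}. M)" using M by (intro prob_space_PiM)
  have "sets (\<Pi>\<^sub>M i\<in>{..<n}. D) = sets (\<Pi>\<^sub>M i\<in>{..<n}. N)"
    by (intro sets_PiM_cong) (auto simp: D)
  moreover have "?h \<in> borel_measurable (\<Pi>\<^sub>M i\<in>{..<n}. D)"
    unfolding sign_mgf_def by (rule measurable_sign_mean_sup) simp
  ultimately have h: "?h \<in> borel_measurable (\<Pi>\<^sub>M i\<in>{..<n}. N)"
    by (simp cong: measurable_cong_sets)
  have "(\<lambda>S. \<lambda>i\<in>{..<n}. X (S i)) \<in> measurable (\<Pi>\<^sub>M i\<in>{..<n}. M) (\<Pi>\<^sub>M i\<in>{..<n}. N)"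
    by (intro measurable_restrict measurable_compose[OF _ X]) (rule measurable_component_singleton)
  from measurable_compose[OF this h]
  have "(\<lambda>S. ?h (\<lambda>i\<in>{..<n}. X (S i))) \<in> borel_measurable (\<Pi>\<^sub>M i\<in>{..<n}. M)" .
  also have "(\<lambda>S. ?h (\<lambda>i\<in>{..<n}. X (S i))) = (\<lambda>S. ?h (\<lambda>i. X (S i)))"
    unfolding sign_mgf_def
    by (intro ext sign_mean_cong arg_cong[where f=exp] arg_cong2[where f="(*)"] refl signed_sup_cong) auto
  finally show ?thesis
  proof (rule prob_space.integrable_bounded[OF P])
    fix S
    show "\<bar>?h (\<lambda>i. X (S i))\<bar> \<le> exp (\<bar>l / n\<bar> * n)"
      unfolding sign_mgf_def
    proof (rule abs_sign_mean_le)
      fix \<sigma> assume \<sigma>: "\<sigma> \<in> signs n"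
      have "l / n * signed_sup F n \<sigma> (\<lambda>i. X (S i)) \<le> \<bar>l / n\<bar> * \<bar>signed_sup F n \<sigma> (\<lambda>i. X (S i))\<bar>"
        by (metis abs_ge_self abs_mult)
      also have "\<dots> \<le> \<bar>l / n\<bar> * n" using abs_signed_sup_le[OF \<sigma>] by (intro mult_left_mono) auto
      finally show "\<bar>exp (l / n * signed_sup F n \<sigma> (\<lambda>i. X (S i)))\<bar> \<le> exp (\<bar>l / n\<bar> * n)" by simp
    qed
  qed
qed

text \<open>Multiplication by \<open>w (S i) / c\<close> is a contraction that fixes 0, so the
  weights disappear and the class is met at the exponent \<open>2 * c * l\<close>. The choice
  \<open>c = 1/2\<close> covers the classification error, up to a constant, and \<open>c = 1\<close>
  the losses that are linear in the rejector.\<close>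

lemma (in bounded_class) sub_gaussian_above_weighted_rule:
  fixes f :: "'k \<Rightarrow> 'a \<Rightarrow> real" and w :: "'b \<Rightarrow> real"
  assumes M: "prob_space M" and X: "X \<in> measurable M N" and D: "D = distr M N X"
    and F: "F = f ` K" and n: "n \<ge> 1" and c: "c > 0"
    and w: "\<And>z. z \<in> space M \<Longrightarrow> \<bar>w z\<bar> \<le> c"
    and meas: "(\<lambda>(S, z). w z * f (A S) (X z)) \<in> borel_measurable ((\<Pi>\<^sub>M i\<in>{..<n}. M) \<Otimes>\<^sub>M M)"
    and AK: "\<And>S. S \<in> space (\<Pi>\<^sub>M i\<in>{..<n}. M) \<Longrightarrow> A S \<in> K"
  shows "sub_gaussian_above (\<Pi>\<^sub>M i\<in>{..<n}. M)
    (\<lambda>S. (\<integral>z. w z * f (A S) (X z) \<partial>M) - (\<Sum>i<n. w (S i) * f (A S) (X (S i))) / n)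
    (2 * c * rademacher D n F) (4 * c\<^sup>2 / n)"
proof (rule prob_space.sub_gaussian_above_rule[OF M n meas AK, where Q="\<lambda>l S. sign_mgf F n (2 * c * l) (\<lambda>i. X (S i))"])
  have f1: "\<bar>f k x\<bar> \<le> 1" if "k \<in> K" for k x using that F_bounded F by auto
  show "\<bar>w z * f k (X z)\<bar> \<le> c * 1" if "k \<in> K" "z \<in> space M" for k z
    unfolding abs_mult using that w f1 c by (intro mult_mono) auto
  show "integrable (\<Pi>\<^sub>M i\<in>{..<n}. M) (\<lambda>S. sign_mgf F n (2 * c * l) (\<lambda>i. X (S i)))" for l
    by (rule integrable_sign_mgf_sample[OF M X D])
  fix l :: real assume l: "l \<ge> 0"
  show "(\<integral>S. sign_mgf F n (2 * c * l) (\<lambda>i. X (S i)) \<partial>(\<Pi>\<^sub>M i\<in>{..<n}. M))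
      \<le> exp (l * (2 * c * rademacher D n F) + 4 * c\<^sup>2 / n * l\<^sup>2)"
    using rademacher_mgf_sample[OF M X D _ n, of "2 * c * l"] l c
    by (simp add: sign_mgf_def power_mult_distrib mult_ac)
  fix S assume S: "S \<in> space (\<Pi>\<^sub>M i\<in>{..<n}. M)"
  let ?\<phi> = "\<lambda>i t. w (S i) / c * t"
  have K: "K \<noteq> {}" using F F_nonempty by auto
  have wc: "\<bar>w (S i) / c\<bar> \<le> 1" if "i < n" for i
    using w[of "S i"] S that c by (auto simp: space_PiM)
  have "sign_mean n (\<lambda>\<sigma>. exp (2 * l / n * (SUP k\<in>K. \<Sum>i<n. \<sigma> i * (w (S i) * f k (X (S i))))))
      \<le> sign_mean n (\<lambda>\<sigma>. exp (2 * c * l / n * (SUP k\<in>K. \<Sum>i<n. \<sigma> i * ?\<phi> i (f k (X (S i))))))"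
  proof (intro sign_mean_mono exp_le_cancel_iff[THEN iffD2])
    fix \<sigma> :: "nat \<Rightarrow> real"
    have phi1: "\<bar>?\<phi> i (f k (X (S i)))\<bar> \<le> 1" if "k \<in> K" "i < n" for k i
      using mult_mono[OF wc f1, of i k "X (S i)"] that by (simp add: abs_mult)
    have "(SUP k\<in>K. \<Sum>i<n. \<sigma> i * (w (S i) * f k (X (S i))))
        \<le> c * (SUP k\<in>K. \<Sum>i<n. \<sigma> i * ?\<phi> i (f k (X (S i))))"
    proof (rule cSUP_least[OF K])
      fix k assume k: "k \<in> K"
      have "(\<Sum>i<n. \<sigma> i * (w (S i) * f k (X (S i)))) = c * (\<Sum>i<n. \<sigma> i * ?\<phi> i (f k (X (S i))))"
        using c by (simp add: sum_distrib_left mult_ac)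
      also have "\<dots> \<le> c * (SUP k\<in>K. \<Sum>i<n. \<sigma> i * ?\<phi> i (f k (X (S i))))"
        using c by (intro mult_left_mono cSUP_upper[OF k] bdd_above_coefficient_sum[where B=1] phi1) auto
      finally show "(\<Sum>i<n. \<sigma> i * (w (S i) * f k (X (S i))))
        \<le> c * (SUP k\<in>K. \<Sum>i<n. \<sigma> i * ?\<phi> i (f k (X (S i))))" .
    qed
    then have "2 * l / n * (SUP k\<in>K. \<Sum>i<n. \<sigma> i * (w (S i) * f k (X (S i))))
        \<le> 2 * l / n * (c * (SUP k\<in>K. \<Sum>i<n. \<sigma> i * ?\<phi> i (f k (X (S i)))))"
      using l by (intro mult_left_mono) auto
    then show "2 * l / n * (SUP k\<in>K. \<Sum>i<n. \<sigma> i * (w (S i) * f k (X (S i))))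
        \<le> 2 * c * l / n * (SUP k\<in>K. \<Sum>i<n. \<sigma> i * ?\<phi> i (f k (X (S i))))"
      by (simp add: mult_ac)
  qed
  also have "\<dots> \<le> sign_mean n (\<lambda>\<sigma>. exp (2 * c * l / n * (SUP k\<in>K. \<Sum>i<n. \<sigma> i * f k (X (S i)))))"
  proof (rule contraction_exp[OF K, where B=1])
    fix i x y assume "i < n"
    then show "\<bar>?\<phi> i x - ?\<phi> i y\<bar> \<le> \<bar>x - y\<bar>"
      unfolding right_diff_distrib[symmetric] abs_mult by (intro mult_left_le_one_le wc) auto
  qed (use f1 l c in auto)
  also have "\<dots> = sign_mgf F n (2 * c * l) (\<lambda>i. X (S i))"
    unfolding sign_mgf_def signed_sup_def F by (simp add: image_image)
  finally show "sign_mean n (\<lambda>\<sigma>. exp (2 * l / n * (SUP k\<in>K. \<Sum>i<n. \<sigma> i * (w (S i) * f k (X (S i))))))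
      \<le> sign_mgf F n (2 * c * l) (\<lambda>i. X (S i))" .
qed

section \<open>The deferral problem\<close>

abbreviation deviation :: "'a measure \<Rightarrow> nat \<Rightarrow> ('a \<Rightarrow> real) \<Rightarrow> (nat \<Rightarrow> 'a) \<Rightarrow> real" where
  "deviation M n f S \<equiv> (\<integral>z. f z \<partial>M) - (\<Sum>i<n. f (S i)) / real n"

lemma deviation_add:
  assumes "integrable M f" "integrable M g"
  shows "deviation M n (\<lambda>z. f z + g z) S = deviation M n f S + deviation M n g S"
  using assms by (simp add: sum.distrib add_divide_distrib)

lemma (in prob_space) deviation_add_const:
  assumes f: "integrable M f" and n: "n \<ge> 1"
  shows "deviation M n (\<lambda>z. f z + c) S = deviation M n f S"
proof -
  have "deviation M n (\<lambda>z. c) S = 0" using n by (simp add: prob_space)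
  moreover have "deviation M n (\<lambda>z. f z + c) S = deviation M n f S + deviation M n (\<lambda>z. c) S"
    by (rule deviation_add[OF f integrable_const])
  ultimately show ?thesis by simp
qed

locale deferral =
  fixes MX :: "'a measure" and \<mu> :: "('a \<times> bool \<times> bool) measure"
    and H R :: "('a \<Rightarrow> bool) set"
  assumes setting: "deferral_setting MX \<mu> H R" and H_nonempty: "H \<noteq> {}" and R_nonempty: "R \<noteq> {}"
begin

lemma prob_mu: "prob_space \<mu>"
  and sets_mu [measurable_cong]: "sets \<mu> = sets (MX \<Otimes>\<^sub>M (count_space UNIV \<Otimes>\<^sub>M count_space UNIV))"
  and H_measurable: "h \<in> H \<Longrightarrow> h \<in> MX \<rightarrow>\<^sub>M count_space UNIV"
  and R_measurable: "r \<in> R \<Longrightarrow> r \<in> MX \<rightarrow>\<^sub>M count_space UNIV"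
  using setting by (auto simp: deferral_setting_def)

sublocale mu: prob_space \<mu> by (rule prob_mu)

lemma fst_measurable [measurable]: "fst \<in> \<mu> \<rightarrow>\<^sub>M MX"
  and label_measurable [measurable]: "(\<lambda>z. fst (snd z)) \<in> \<mu> \<rightarrow>\<^sub>M count_space UNIV"
  and expert_measurable [measurable]: "(\<lambda>z. snd (snd z)) \<in> \<mu> \<rightarrow>\<^sub>M count_space UNIV"
  by measurable

definition "law2 = law_XY MX \<mu>"

lemma law2_eq: "law2 = distr \<mu> (MX \<Otimes>\<^sub>M count_space UNIV) (\<lambda>z. (fst z, fst (snd z)))"
  unfolding law2_def law_XY_def by (simp add: case_prod_unfold)

lemma sets_law2 [measurable_cong]: "sets law2 = sets (MX \<Otimes>\<^sub>M count_space UNIV)"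
  by (simp add: law2_eq)

lemma XY_measurable: "(\<lambda>z. (fst z, fst (snd z))) \<in> \<mu> \<rightarrow>\<^sub>M MX \<Otimes>\<^sub>M count_space UNIV"
  by measurable

sublocale law2: prob_space law2
  unfolding law2_eq by (rule mu.prob_space_distr[OF XY_measurable])

lemma law2_fst_measurable [measurable]: "fst \<in> law2 \<rightarrow>\<^sub>M MX"
  and law2_snd_measurable [measurable]: "snd \<in> law2 \<rightarrow>\<^sub>M count_space UNIV"
  by measurable

lemma law_X_eq: "law_X MX \<mu> = distr \<mu> MX fst" "law_X MX \<mu> = distr law2 MX fst"
proof -
  show "law_X MX \<mu> = distr \<mu> MX fst" by (simp add: law_X_def)
  show "law_X MX \<mu> = distr law2 MX fst"
    unfolding law_X_def law2_eq by (subst distr_distr) (auto simp: comp_def)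
qed

lemma measurable_suprema_law_X: "measurable_suprema MX F \<Longrightarrow> measurable_suprema (law_X MX \<mu>) F"
proof -
  have "sets (\<Pi>\<^sub>M i\<in>{..<n}. law_X MX \<mu>) = sets (\<Pi>\<^sub>M i\<in>{..<n}. MX)" for n :: nat
    by (intro sets_PiM_cong) (auto simp: law_X_def)
  then have "borel_measurable (\<Pi>\<^sub>M i\<in>{..<n}. law_X MX \<mu>) = borel_measurable (\<Pi>\<^sub>M i\<in>{..<n}. MX)" for n :: nat
    by (intro measurable_cong_sets) auto
  then show "measurable_suprema MX F \<Longrightarrow> measurable_suprema (law_X MX \<mu>) F"
    by (auto simp: measurable_suprema_def)
qed

sublocale HC: bounded_class "law_X MX \<mu>" "classifier_functions H"
proof -
  interpret prob_space "law_X MX \<mu>" unfolding law_X_def by (rule mu.prob_space_distr) simp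
  show "bounded_class (law_X MX \<mu>) (classifier_functions H)"
    using setting H_nonempty measurable_suprema_law_X
    by unfold_locales (auto simp: classifier_functions_def deferral_setting_def split: if_splits)
qed

sublocale RC: bounded_class "law_X MX \<mu>" "rejector_functions R"
proof -
  interpret prob_space "law_X MX \<mu>" unfolding law_X_def by (rule mu.prob_space_distr) simp
  show "bounded_class (law_X MX \<mu>) (rejector_functions R)"
    using setting R_nonempty measurable_suprema_law_X
    by unfold_locales (auto simp: rejector_functions_def deferral_setting_def)
qed

abbreviation "radH n \<equiv> rademacher (law_X MX \<mu>) n (classifier_functions H)"
abbreviation "radR n \<equiv> rademacher (law_X MX \<mu>) n (rejector_functions R)"

lemma rule_measurable:
  assumes "measurable_rule T MX g" and X[measurable]: "X \<in> N \<rightarrow>\<^sub>M MX"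
  shows "(\<lambda>p. g (fst p) (X (snd p))) \<in> T \<Otimes>\<^sub>M N \<rightarrow>\<^sub>M count_space UNIV"
proof -
  have "(\<lambda>p. (fst p, X (snd p))) \<in> T \<Otimes>\<^sub>M N \<rightarrow>\<^sub>M T \<Otimes>\<^sub>M MX" by measurable
  from measurable_compose[OF this assms(1)[unfolded measurable_rule_def]]
  show ?thesis by (simp add: case_prod_unfold)
qed

lemma defer_loss_eq:
  "defer_loss h r z = of_bool (h (fst z) \<noteq> fst (snd z)) * of_bool (\<not> r (fst z))
    + of_bool (snd (snd z) \<noteq> fst (snd z)) * of_bool (r (fst z))"
  by (cases z) (simp add: defer_loss_def)

lemma loss01_eq: "loss01 h z = of_bool (h (fst z) \<noteq> snd z)"
  by (cases z) (simp add: loss01_def)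

lemma defer_loss_bounds: "0 \<le> defer_loss h r z" "defer_loss h r z \<le> 1"
  by (auto simp: defer_loss_eq)

lemma defer_loss_measurable:
  assumes [measurable]: "h \<in> MX \<rightarrow>\<^sub>M count_space UNIV" "r \<in> MX \<rightarrow>\<^sub>M count_space UNIV"
  shows "defer_loss h r \<in> borel_measurable \<mu>"
  unfolding defer_loss_eq[abs_def] by measurable

lemma loss01_measurable:
  assumes [measurable]: "h \<in> MX \<rightarrow>\<^sub>M count_space UNIV"
  shows "loss01 h \<in> borel_measurable law2"
  unfolding loss01_eq[abs_def] by measurable

lemma loss01_integral:
  assumes "h \<in> MX \<rightarrow>\<^sub>M count_space UNIV"
  shows "(\<integral>z. loss01 h z \<partial>law2) = (\<integral>z. of_bool (h (fst z) \<noteq> fst (snd z)) \<partial>\<mu>)"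
proof -
  have "loss01 h \<in> borel_measurable (MX \<Otimes>\<^sub>M count_space UNIV)"
    using loss01_measurable[OF assms] by (simp cong: measurable_cong_sets add: sets_law2)
  from integral_distr[OF XY_measurable this] show ?thesis
    by (simp add: law2_eq loss01_eq[abs_def])
qed

lemma L_def_measurable:
  assumes "measurable_rule T MX h" "measurable_rule T MX r"
  shows "(\<lambda>S. L_def \<mu> (h S) (r S)) \<in> borel_measurable T"
proof -
  note [measurable] = rule_measurable[OF assms(1) fst_measurable] rule_measurable[OF assms(2) fst_measurable]
  have "(\<lambda>p. defer_loss (h (fst p)) (r (fst p)) (snd p)) \<in> borel_measurable (T \<Otimes>\<^sub>M \<mu>)"
    unfolding defer_loss_eq by measurable
  then have "(\<lambda>S. \<integral>z. defer_loss (h S) (r S) z \<partial>\<mu>) \<in> borel_measurable T"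
    using mu.borel_measurable_lebesgue_integral[of "\<lambda>S z. defer_loss (h S) (r S) z" T]
    by (simp add: case_prod_unfold)
  then show ?thesis by (simp add: L_def_def)
qed

definition undeferred_loss :: "('a \<Rightarrow> bool) \<times> ('a \<Rightarrow> bool) \<Rightarrow> 'a \<times> bool \<times> bool \<Rightarrow> real" where
  "undeferred_loss k z = of_bool (fst k (fst z) \<noteq> fst (snd z)) * of_bool (\<not> snd k (fst z)) - 1 / 2"

text \<open>
  Let \<open>t\<close> be \<open>1/2\<close> or \<open>-1/2\<close>, according to whether the classifier errs, minus the value of the
  rejector.  Then the loss is \<open>max (t + 1/2) 0 - 1/2\<close>, a contraction of \<open>t\<close> that fixes 0; the
  shift by \<open>1/2\<close> is invisible to deviations.
\<close>

lemma sub_gaussian_above_undeferred: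
  assumes n: "n \<ge> 1"
    and h: "measurable_rule (\<Pi>\<^sub>M i\<in>{..<n}. \<mu>) MX h" and r: "measurable_rule (\<Pi>\<^sub>M i\<in>{..<n}. \<mu>) MX r"
    and HR: "\<And>S. S \<in> space (\<Pi>\<^sub>M i\<in>{..<n}. \<mu>) \<Longrightarrow> (h S, r S) \<in> H \<times> R"
  shows "sub_gaussian_above (\<Pi>\<^sub>M i\<in>{..<n}. \<mu>) (\<lambda>S. deviation \<mu> n (undeferred_loss (h S, r S)) S)
    (radH n + 2 * radR n) (16 / n)"
proof (rule mu.sub_gaussian_above_rule[OF n])
  let ?P = "\<Pi>\<^sub>M i\<in>{..<n}. \<mu>"
  define m where "m = radH n + 2 * radR n"
  let ?H = "classifier_functions H" and ?R = "rejector_functions R"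
  \<comment> \<open>Each exponential is centred at its own level before the two are averaged. That
    makes the levels of the two classes add up to \<open>m\<close>; averaging uncentred exponentials
    would yield the larger of the two doubled levels.\<close>
  define Q where "Q l S = exp (l * m) / 2 * (exp (- (2 * l * radH n)) * sign_mgf ?H n (2 * l) (\<lambda>i. fst (S i))
    + exp (- (4 * l * radR n)) * sign_mgf ?R n (4 * l) (\<lambda>i. fst (S i)))" for l and S :: "nat \<Rightarrow> 'a \<times> bool \<times> bool"
  note intH = HC.integrable_sign_mgf_sample[OF prob_mu fst_measurable law_X_eq(1)]
  note intR = RC.integrable_sign_mgf_sample[OF prob_mu fst_measurable law_X_eq(1)]
  show "(\<lambda>(S, z). undeferred_loss (h S, r S) z) \<in> borel_measurable (?P \<Otimes>\<^sub>M \<mu>)"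
  proof -
    note [measurable] = rule_measurable[OF h fst_measurable] rule_measurable[OF r fst_measurable]
    show ?thesis unfolding undeferred_loss_def case_prod_unfold fst_conv snd_conv by measurable
  qed
  show "\<And>S. S \<in> space ?P \<Longrightarrow> (h S, r S) \<in> H \<times> R" by (rule HR)
  show "\<bar>undeferred_loss k z\<bar> \<le> 1" for k z by (auto simp: undeferred_loss_def)
  show "integrable ?P (Q l)" for l
    unfolding Q_def[abs_def] using intH intR
    by (intro integrable_mult_right Bochner_Integration.integrable_add) auto
  fix l :: real assume l: "l \<ge> 0"
  show "(\<integral>S. Q l S \<partial>?P) \<le> exp (l * (radH n + 2 * radR n) + 16 / n * l\<^sup>2)"
  proof -
    have H: "(\<integral>S. sign_mgf ?H n (2 * l) (\<lambda>i. fst (S i)) \<partial>?P) \<le> exp (2 * l * radH n + (2 * l)\<^sup>2 / n)"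
      and R: "(\<integral>S. sign_mgf ?R n (4 * l) (\<lambda>i. fst (S i)) \<partial>?P) \<le> exp (4 * l * radR n + (4 * l)\<^sup>2 / n)"
      unfolding sign_mgf_def using l
      by (intro HC.rademacher_mgf_sample[OF prob_mu fst_measurable law_X_eq(1) _ n]
          RC.rademacher_mgf_sample[OF prob_mu fst_measurable law_X_eq(1) _ n]; simp)+
    have "(\<integral>S. Q l S \<partial>?P) = exp (l * m) / 2 * (exp (- (2 * l * radH n)) * (\<integral>S. sign_mgf ?H n (2 * l) (\<lambda>i. fst (S i)) \<partial>?P)
        + exp (- (4 * l * radR n)) * (\<integral>S. sign_mgf ?R n (4 * l) (\<lambda>i. fst (S i)) \<partial>?P))"
      unfolding Q_def using intH intR by simp
    also have "\<dots> \<le> exp (l * m) / 2 * (exp (- (2 * l * radH n)) * exp (2 * l * radH n + (2 * l)\<^sup>2 / n)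
        + exp (- (4 * l * radR n)) * exp (4 * l * radR n + (4 * l)\<^sup>2 / n))"
      by (intro mult_left_mono add_mono H R) auto
    also have "\<dots> = exp (l * m) / 2 * (exp ((2 * l)\<^sup>2 / n) + exp ((4 * l)\<^sup>2 / n))"
      by (simp flip: exp_add)
    \<comment> \<open>Symmetrization and the split into two classes double the exponent once each.
      The rejector thus appears at \<open>4 * l\<close>, which produces the 16; the classifier
      carries an extra 1/2 and appears at \<open>2 * l\<close>.\<close>
    also have "\<dots> \<le> exp (l * m) / 2 * (exp (16 / n * l\<^sup>2) + exp (16 / n * l\<^sup>2))"
      using n by (intro mult_left_mono add_mono) (auto simp: power_mult_distrib divide_right_mono)
    also have "\<dots> = exp (l * m + 16 / n * l\<^sup>2)" by (simp add: exp_add)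
    finally show ?thesis by (simp add: m_def)
  qed
  fix S assume S: "S \<in> space ?P"
  define s where "s i = (if fst (snd (S i)) then -1 else 1 :: real)" for i
  define x where "x i = fst (S i)" for i
  define hf where "hf k y = (if fst k y then 1 else -1 :: real)" for k :: "('a \<Rightarrow> bool) \<times> ('a \<Rightarrow> bool)" and y
  define rf where "rf k y = (of_bool (snd k y) :: real)" for k :: "('a \<Rightarrow> bool) \<times> ('a \<Rightarrow> bool)" and y
  define t where "t k i = s i / 2 * hf k (x i) - rf k (x i)" for k i
  define \<phi> where "\<phi> u = max (u + 1 / 2) 0 - (1 / 2 :: real)" for u
  have phi: "undeferred_loss k (S i) = \<phi> (t k i)" for k i
    by (auto simp: undeferred_loss_def \<phi>_def t_def s_def x_def hf_def rf_def)
  have hfH: "hf k \<in> ?H" and rfR: "rf k \<in> ?R" if "k \<in> H \<times> R" for k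
    using that by (auto simp: hf_def[abs_def] rf_def[abs_def] classifier_functions_def rejector_functions_def)
  \<comment> \<open>The labels, and the minus sign in front of the rejector, are moved into the
    signs; averaging over \<open>\<sigma>\<close> makes both changes disappear by
    \<open>sign_mean_flip\<close>.\<close>
  define a where "a \<sigma> = signed_sup ?H n (\<lambda>i. s i * \<sigma> i) x" for \<sigma>
  define b where "b \<sigma> = signed_sup ?R n (\<lambda>i. -1 * \<sigma> i) x" for \<sigma>
  have "sign_mean n (\<lambda>\<sigma>. exp (2 * l / n * (SUP k\<in>H \<times> R. \<Sum>i<n. \<sigma> i * undeferred_loss k (S i))))
      \<le> sign_mean n (\<lambda>\<sigma>. exp (2 * l / n * (SUP k\<in>H \<times> R. \<Sum>i<n. \<sigma> i * t k i)))"
    unfolding phi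
  proof (rule contraction_exp[where B=2])
    show "H \<times> R \<noteq> {}" using H_nonempty R_nonempty by auto
    show "\<bar>t k i\<bar> \<le> 2" for k i by (auto simp: t_def s_def hf_def rf_def)
    show "\<bar>\<phi> u - \<phi> v\<bar> \<le> \<bar>u - v\<bar>" for u v by (auto simp: \<phi>_def max_def)
  qed (use l in \<open>auto simp: \<phi>_def\<close>)
  also have "\<dots> \<le> sign_mean n (\<lambda>\<sigma>. exp (2 * l / n * (a \<sigma> / 2 + b \<sigma>)))"
  proof (intro sign_mean_mono exp_le_cancel_iff[THEN iffD2] mult_left_mono)
    fix \<sigma> :: "nat \<Rightarrow> real"
    show "(SUP k\<in>H \<times> R. \<Sum>i<n. \<sigma> i * t k i) \<le> a \<sigma> / 2 + b \<sigma>"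
    proof (rule cSUP_least)
      show "H \<times> R \<noteq> {}" using H_nonempty R_nonempty by auto
      fix k assume k: "k \<in> H \<times> R"
      have "(\<Sum>i<n. \<sigma> i * t k i) = (\<Sum>i<n. (s i * \<sigma> i) * hf k (x i)) / 2 + (\<Sum>i<n. (-1 * \<sigma> i) * rf k (x i))"
        unfolding sum_divide_distrib sum.distrib[symmetric]
        by (intro sum.cong refl) (simp add: t_def algebra_simps)
      also have "\<dots> \<le> a \<sigma> / 2 + b \<sigma>"
        unfolding a_def b_def signed_sup_def
        by (intro add_mono divide_right_mono cSUP_upper[OF hfH[OF k]] cSUP_upper[OF rfR[OF k]]
            HC.bdd_signed_sum RC.bdd_signed_sum) simp
      finally show "(\<Sum>i<n. \<sigma> i * t k i) \<le> a \<sigma> / 2 + b \<sigma>" .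
    qed
  qed (use l in simp)
  also have "\<dots> \<le> sign_mean n (\<lambda>\<sigma>. exp (l * m) / 2 * (exp (- (2 * l * radH n)) * exp (2 * l / n * a \<sigma>)
      + exp (- (4 * l * radR n)) * exp (4 * l / n * b \<sigma>)))"
  proof (rule sign_mean_mono)
    fix \<sigma>
    let ?A = "2 * l / n * a \<sigma> - 2 * l * radH n" and ?B = "4 * l / n * b \<sigma> - 4 * l * radR n"
    have "2 * l / n * (a \<sigma> / 2 + b \<sigma>) = l * m + (?A + ?B) / 2"
      by (simp add: m_def algebra_simps add_divide_distrib diff_divide_distrib)
    then have "exp (2 * l / n * (a \<sigma> / 2 + b \<sigma>)) = exp (l * m) * exp ((?A + ?B) / 2)"
      by (simp only: exp_add)
    also have "\<dots> \<le> exp (l * m) * ((exp ?A + exp ?B) / 2)"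
      by (intro mult_left_mono exp_half_sum_le) simp
    finally show "exp (2 * l / n * (a \<sigma> / 2 + b \<sigma>)) \<le> exp (l * m) / 2 * (exp (- (2 * l * radH n)) * exp (2 * l / n * a \<sigma>)
      + exp (- (4 * l * radR n)) * exp (4 * l / n * b \<sigma>))"
      by (simp add: exp_diff exp_minus field_simps)
  qed
  also have "\<dots> = exp (l * m) / 2 * (exp (- (2 * l * radH n)) * sign_mean n (\<lambda>\<sigma>. exp (2 * l / n * a \<sigma>))
      + exp (- (4 * l * radR n)) * sign_mean n (\<lambda>\<sigma>. exp (4 * l / n * b \<sigma>)))"
    by (simp only: sign_mean_cmult sign_mean_add)
  also have "sign_mean n (\<lambda>\<sigma>. exp (2 * l / n * a \<sigma>)) = sign_mgf ?H n (2 * l) x"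
    unfolding a_def sign_mgf_def by (rule sign_mean_flip) (auto simp: s_def)
  also have "sign_mean n (\<lambda>\<sigma>. exp (4 * l / n * b \<sigma>)) = sign_mgf ?R n (4 * l) x"
    unfolding b_def sign_mgf_def by (rule sign_mean_flip) auto
  finally show "sign_mean n (\<lambda>\<sigma>. exp (2 * l / n * (SUP k\<in>H \<times> R. \<Sum>i<n. \<sigma> i * undeferred_loss k (S i)))) \<le> Q l S"
    by (simp add: Q_def x_def[abs_def])
qed

end

lemma (in prob_space) deviation_measurable_pair:
  fixes g :: "(nat \<Rightarrow> 'a) \<times> 'b \<Rightarrow> 'a \<Rightarrow> real"
  assumes meas: "(\<lambda>(S, z). g S z) \<in> borel_measurable (((\<Pi>\<^sub>M i\<in>{..<n}. M) \<Otimes>\<^sub>M N) \<Otimes>\<^sub>M M)"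
  shows "(\<lambda>S. deviation M n (g S) (fst S)) \<in> borel_measurable ((\<Pi>\<^sub>M i\<in>{..<n}. M) \<Otimes>\<^sub>M N)"
proof -
  let ?T = "(\<Pi>\<^sub>M i\<in>{..<n}. M) \<Otimes>\<^sub>M N"
  have "(\<lambda>S. g S (fst S i)) \<in> borel_measurable ?T" if "i < n" for i
  proof -
    have "(\<lambda>S. fst S i) \<in> measurable ?T M"
      by (rule measurable_compose[OF measurable_fst], rule measurable_component_singleton) (use that in simp)
    then show ?thesis
      using measurable_compose[OF measurable_Pair[OF measurable_ident_sets[OF refl]] meas] by simp
  qed
  moreover have "(\<lambda>S. \<integral>z. g S z \<partial>M) \<in> borel_measurable ?T"
    using borel_measurable_lebesgue_integral[OF meas] by simp
  ultimately show ?thesis by auto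
qed

text \<open>The source of the constant 64: the tail exponent is
  \<open>64\<^sup>2 / (4 * 256) = 4\<close> times \<open>ln (1 / \<delta>)\<close>, more than the 2
  that gives failure probability \<open>\<delta>\<^sup>2\<close>. Stating the result with
  \<open>\<delta>\<^sup>2\<close> leaves room for two such events to hold together when
  \<open>\<delta> \<le> 1 / 2\<close>.\<close>

lemma (in prob_space) sub_gaussian_above_prob_ge:
  fixes X Z :: "'a \<Rightarrow> real"
  assumes Z: "sub_gaussian_above M Z m (256 / N)" and X[measurable]: "X \<in> borel_measurable M"
    and le: "\<And>S. S \<in> space M \<Longrightarrow> X S \<le> c + Z S"
    and B: "c + m + 64 * sqrt (ln (1 / \<delta>) / N) \<le> B"
    and N: "N > 0" and \<delta>: "0 < \<delta>" "\<delta> < 1"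
  shows "prob {S \<in> space M. X S \<le> B} \<ge> 1 - \<delta>\<^sup>2"
proof -
  define L where "L = ln (1 / \<delta>)"
  have L: "L > 0" using \<delta> by (simp add: L_def)
  have [measurable]: "Z \<in> borel_measurable M" by (rule sub_gaussian_above_measurable[OF Z])
  have "exp (- ((64 * sqrt (L / N))\<^sup>2 / (4 * (256 / N)))) = exp (- (4 * L))"
  proof -
    have "(sqrt (L / N))\<^sup>2 = L / N" using N L by simp
    then have "(64 * sqrt (L / N))\<^sup>2 = 4096 * (L / N)" unfolding power_mult_distrib by simp
    then have "(64 * sqrt (L / N))\<^sup>2 / (4 * (256 / N)) = 4 * L" using N by simp
    then show ?thesis by simp
  qed
  also have "\<dots> \<le> exp (- (2 * L))" using L by simp
  also have "\<dots> = \<delta>\<^sup>2"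
  proof -
    have "exp (- L) = \<delta>" using \<delta> by (simp add: L_def ln_div)
    moreover have "exp (- (2 * L)) = exp (- L) * exp (- L)" by (simp flip: exp_add)
    ultimately show ?thesis by (simp add: power2_eq_square)
  qed
  finally have "1 - \<delta>\<^sup>2 \<le> prob {S \<in> space M. Z S \<le> m + 64 * sqrt (L / N)}"
    using sub_gaussian_above_tail[OF Z, of "64 * sqrt (L / N)"] N L by simp
  also have "\<dots> \<le> prob {S \<in> space M. X S \<le> B}"
  proof (rule finite_measure_mono)
    show "{S \<in> space M. Z S \<le> m + 64 * sqrt (L / N)} \<subseteq> {S \<in> space M. X S \<le> B}"
    proof safe
      fix S assume "S \<in> space M" "Z S \<le> m + 64 * sqrt (L / N)"
      then show "X S \<le> B" using le[of S] B unfolding L_def by linarith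
    qed
  qed simp
  finally show ?thesis .
qed

section \<open>Joint learning\<close>

context deferral
begin

lemma law_Su_eq: "law_Su n MX \<mu> = (\<Pi>\<^sub>M i\<in>{..<n}. law2)"
  by (simp add: law_Su_def law2_def)

lemma prob_law_Sl: "prob_space (law_Sl n \<mu>)"
  unfolding law_Sl_def by (rule prob_space_PiM) (rule prob_mu)

lemma prob_law_Su: "prob_space (law_Su n MX \<mu>)"
  unfolding law_Su_eq by (rule prob_space_PiM) (rule law2.prob_space_axioms)

lemma abs_defer_loss_le: "\<bar>defer_loss h r z\<bar> \<le> 1"
  using defer_loss_bounds[of h r z] by simp

lemma integrable_defer_loss:
  assumes "h \<in> H" "r \<in> R" shows "integrable \<mu> (defer_loss h r)"
  using defer_loss_bounds[of h r] assms
  by (intro mu.integrable_bounded[where B=1] defer_loss_measurable H_measurable R_measurable) (auto simp: abs_le_iff)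

definition expert_loss :: "('a \<Rightarrow> bool) \<Rightarrow> 'a \<times> bool \<times> bool \<Rightarrow> real" where
  "expert_loss r z = of_bool (snd (snd z) \<noteq> fst (snd z)) * of_bool (r (fst z))"

lemma defer_loss_split: "defer_loss h r z = (undeferred_loss (h, r) z + 1 / 2) + expert_loss r z"
  by (simp add: defer_loss_eq undeferred_loss_def expert_loss_def)

lemma expert_error_eq: "expert_error \<mu> = (\<integral>z. of_bool (snd (snd z) \<noteq> fst (snd z)) \<partial>\<mu>)"
proof -
  let ?E = "{z \<in> space \<mu>. snd (snd z) \<noteq> fst (snd z)}"
  have "(\<integral>z. of_bool (snd (snd z) \<noteq> fst (snd z)) \<partial>\<mu>) = (\<integral>z. indicator ?E z \<partial>\<mu>)"
    by (intro Bochner_Integration.integral_cong) (auto simp: indicator_def)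
  also have "\<dots> = measure \<mu> ?E" by simp
  also have "?E = {z \<in> space \<mu>. case z of (x, y, m) \<Rightarrow> m \<noteq> y}" by auto
  finally show ?thesis by (simp add: expert_error_def)
qed

lemma expert_error_bounds: "0 \<le> expert_error \<mu>" "expert_error \<mu> \<le> 1"
  by (auto simp: expert_error_def)

lemma sub_gaussian_above_expert:
  assumes n: "n \<ge> 1" and r: "measurable_rule (\<Pi>\<^sub>M i\<in>{..<n}. \<mu>) MX r"
    and rR: "\<And>S. S \<in> space (\<Pi>\<^sub>M i\<in>{..<n}. \<mu>) \<Longrightarrow> r S \<in> R"
  shows "sub_gaussian_above (\<Pi>\<^sub>M i\<in>{..<n}. \<mu>) (\<lambda>S. deviation \<mu> n (expert_loss (r S)) S)
    (2 * radR (nat \<lceil>real n * expert_error \<mu> / 2\<rceil>)) (4 / n)"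
proof -
  let ?P = "\<Pi>\<^sub>M i\<in>{..<n}. \<mu>" and ?k = "nat \<lceil>real n * expert_error \<mu> / 2\<rceil>"
  interpret P: prob_space ?P by (rule prob_space_PiM) (rule prob_mu)
  note [measurable] = rule_measurable[OF r fst_measurable]
  have meas: "(\<lambda>(S, z). expert_loss (r S) z) \<in> borel_measurable (?P \<Otimes>\<^sub>M \<mu>)"
    unfolding expert_loss_def case_prod_unfold by measurable
  show ?thesis
  proof (cases "expert_error \<mu> = 0")
    case True
    have "sub_gaussian_above ?P (\<lambda>S. deviation \<mu> n (expert_loss (r S)) S) 0 (4 / n)"
    proof (rule P.sub_gaussian_above_nonpos)
      show "(\<lambda>S. deviation \<mu> n (expert_loss (r S)) S) \<in> borel_measurable ?P"
        by (rule mu.rule_deviation_measurable[OF n meas])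
      fix S assume S: "S \<in> space ?P"
      have m: "expert_loss (r S) \<in> borel_measurable \<mu>"
        using measurable_compose[OF measurable_Pair1'[OF S] meas] by simp
      show "\<bar>deviation \<mu> n (expert_loss (r S)) S\<bar> \<le> 2 * 1"
        by (rule mu.rule_deviation_bounded[OF n S m]) (simp add: expert_loss_def)
      have "(\<integral>z. expert_loss (r S) z \<partial>\<mu>) \<le> (\<integral>z. of_bool (snd (snd z) \<noteq> fst (snd z)) \<partial>\<mu>)"
      proof (rule integral_mono)
        show "integrable \<mu> (expert_loss (r S))"
          by (rule mu.integrable_bounded[OF m, where B=1]) (simp add: expert_loss_def)
        show "integrable \<mu> (\<lambda>z. of_bool (snd (snd z) \<noteq> fst (snd z)) :: real)"
        proof (rule mu.integrable_bounded[where B=1])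
          show "(\<lambda>z. of_bool (snd (snd z) \<noteq> fst (snd z)) :: real) \<in> borel_measurable \<mu>" by measurable
        qed simp
      qed (simp add: expert_loss_def)
      moreover have "0 \<le> (\<Sum>i<n. expert_loss (r S) (S i)) / real n"
        by (intro divide_nonneg_nonneg sum_nonneg) (auto simp: expert_loss_def)
      ultimately show "deviation \<mu> n (expert_loss (r S)) S \<le> 0"
        using True expert_error_eq by linarith
    qed simp
    \<comment> \<open>For an expert that never errs the sample size rounds to 0, where the
      complexity has its default value; the level to be met is therefore exactly 0.\<close>
    moreover have "radR 0 = 0" by (simp add: rademacher_def)
    ultimately show ?thesis using True by simp
  next
    case False
    have k: "1 \<le> ?k" "?k \<le> n"
    proof -
      have "0 < real n * expert_error \<mu> / 2" using False expert_error_bounds n by simp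
      then show "1 \<le> ?k" by linarith
      have "real n * expert_error \<mu> \<le> real n * 1"
        using expert_error_bounds by (intro mult_left_mono) auto
      then have "real n * expert_error \<mu> / 2 \<le> real n" by simp
      then show "?k \<le> n" by linarith
    qed
    let ?w = "\<lambda>z :: 'a \<times> bool \<times> bool. of_bool (snd (snd z) \<noteq> fst (snd z)) :: real"
    have "sub_gaussian_above ?P (\<lambda>S. deviation \<mu> n (\<lambda>z. ?w z * of_bool (r S (fst z))) S)
        (2 * 1 * radR n) (4 * 1\<^sup>2 / n)"
    proof (rule RC.sub_gaussian_above_weighted_rule[OF prob_mu fst_measurable law_X_eq(1)
          rejector_functions_def n, where A=r])
      show "(\<lambda>(S, z). ?w z * of_bool (r S (fst z))) \<in> borel_measurable (?P \<Otimes>\<^sub>M \<mu>)"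
        using meas by (simp add: expert_loss_def)
    qed (use rR in auto)
    then have "sub_gaussian_above ?P (\<lambda>S. deviation \<mu> n (expert_loss (r S)) S) (2 * radR n) (4 / n)"
      by (simp add: expert_loss_def)
    then show ?thesis
      by (rule P.sub_gaussian_above_mono) (use RC.rademacher_antimono[OF k] in auto)
  qed
qed

text \<open>The event concerns the first sample only. The arbitrary factor \<open>N\<close> places
  it in the space of both samples, where it can be intersected with the event of staged
  learning.\<close>

lemma joint_event:
  assumes joint: "joint_rule MX \<mu> H R n ht rt" and n: "n \<ge> 1" and hs: "hs \<in> H" and rs: "rs \<in> R"
    and N: "prob_space N" and \<delta>: "0 < \<delta>" "\<delta> < 1"
    and B: "L_def \<mu> hs rs + (radH n + 2 * radR n + 2 * radR (nat \<lceil>real n * expert_error \<mu> / 2\<rceil>))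
      + 64 * sqrt (ln (1 / \<delta>) / n) \<le> B"
  shows "measure (law_Sl n \<mu> \<Otimes>\<^sub>M N) {S \<in> space (law_Sl n \<mu> \<Otimes>\<^sub>M N). L_def \<mu> (ht (fst S)) (rt (fst S)) \<le> B} \<ge> 1 - \<delta>\<^sup>2"
proof -
  let ?P = "\<Pi>\<^sub>M i\<in>{..<n}. \<mu>"
  interpret P: prob_space ?P by (rule prob_space_PiM) (rule prob_mu)
  interpret N: prob_space N by fact
  interpret PN: pair_prob_space ?P N ..
  have h: "measurable_rule ?P MX ht" and r: "measurable_rule ?P MX rt"
    and sol: "\<And>S. S \<in> space ?P \<Longrightarrow> joint_solution H R n S (ht S, rt S)"
    using joint by (auto simp: joint_rule_def law_Sl_def)
  have HR: "(ht S, rt S) \<in> H \<times> R" if "S \<in> space ?P" for S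
    using sol[OF that] by (simp add: joint_solution_def is_arg_min_def)
  \<comment> \<open>The deviation of the learned pair, split by who predicts, plus the reversed
    deviation of the competitor. Empirical minimality makes this sum dominate the excess
    risk.\<close>
  define Z where "Z S = (deviation \<mu> n (undeferred_loss (ht S, rt S)) S + deviation \<mu> n (expert_loss (rt S)) S)
    + ((\<Sum>i<n. defer_loss hs rs (S i)) / n - (\<integral>z. defer_loss hs rs z \<partial>\<mu>))" for S
  \<comment> \<open>Each addition multiplies the constant by 4, and there are two nested ones on top
    of \<open>16 / n\<close>; this gives the 256 of the tail bound.\<close>
  have "sub_gaussian_above ?P Z
      ((radH n + 2 * radR n + 2 * radR (nat \<lceil>real n * expert_error \<mu> / 2\<rceil>)) + 0) (4 * (4 * (16 / n)))"
    unfolding Z_def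
  proof (intro P.sub_gaussian_above_add)
    show "sub_gaussian_above ?P (\<lambda>S. deviation \<mu> n (undeferred_loss (ht S, rt S)) S) (radH n + 2 * radR n) (16 / n)"
      using n h r HR by (rule sub_gaussian_above_undeferred)
    show "sub_gaussian_above ?P (\<lambda>S. deviation \<mu> n (expert_loss (rt S)) S)
        (2 * radR (nat \<lceil>real n * expert_error \<mu> / 2\<rceil>)) (16 / n)"
      by (rule P.sub_gaussian_above_mono[OF sub_gaussian_above_expert[OF n r]])
        (use HR in \<open>auto simp: divide_right_mono\<close>)
    have "sub_gaussian_above ?P (\<lambda>S. (\<Sum>i<n. defer_loss hs rs (S i)) / n - (\<integral>z. defer_loss hs rs z \<partial>\<mu>)) 0 (1 / n)"
      by (intro mu.sub_gaussian_above_sample_mean defer_loss_measurable H_measurable[OF hs]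
          R_measurable[OF rs] abs_defer_loss_le n)
    then show "sub_gaussian_above ?P (\<lambda>S. (\<Sum>i<n. defer_loss hs rs (S i)) / n - (\<integral>z. defer_loss hs rs z \<partial>\<mu>)) 0 (4 * (16 / n))"
      by (rule P.sub_gaussian_above_mono) (auto simp: divide_right_mono)
  qed
  then have Z: "sub_gaussian_above ?P Z (radH n + 2 * radR n + 2 * radR (nat \<lceil>real n * expert_error \<mu> / 2\<rceil>)) (256 / real n)"
    by simp
  have le: "L_def \<mu> (ht S) (rt S) \<le> L_def \<mu> hs rs + Z S" if S: "S \<in> space ?P" for S
  proof -
    have k: "ht S \<in> H" "rt S \<in> R" using HR[OF S] by auto
    have "(\<Sum>i<n. defer_loss (ht S) (rt S) (S i)) \<le> (\<Sum>i<n. defer_loss hs rs (S i))"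
      using sol[OF S] hs rs by (force simp: joint_solution_def is_arg_min_def)
    then have emp: "(\<Sum>i<n. defer_loss (ht S) (rt S) (S i)) / n \<le> (\<Sum>i<n. defer_loss hs rs (S i)) / n"
      by (rule divide_right_mono) simp
    have meas: "undeferred_loss (ht S, rt S) \<in> borel_measurable \<mu>" "expert_loss (rt S) \<in> borel_measurable \<mu>"
    proof -
      note [measurable] = H_measurable[OF k(1)] R_measurable[OF k(2)]
      show "undeferred_loss (ht S, rt S) \<in> borel_measurable \<mu>" "expert_loss (rt S) \<in> borel_measurable \<mu>"
        unfolding undeferred_loss_def[abs_def] expert_loss_def[abs_def] fst_conv snd_conv by measurable
    qed
    have int: "integrable \<mu> (undeferred_loss (ht S, rt S))" "integrable \<mu> (expert_loss (rt S))"
      using meas by (auto intro!: mu.integrable_bounded[where B=1] simp: undeferred_loss_def expert_loss_def)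
    have "deviation \<mu> n (defer_loss (ht S) (rt S)) S
        = deviation \<mu> n (undeferred_loss (ht S, rt S)) S + deviation \<mu> n (expert_loss (rt S)) S"
      unfolding defer_loss_split[abs_def]
      using deviation_add[of \<mu> "\<lambda>z. undeferred_loss (ht S, rt S) z + 1 / 2" "expert_loss (rt S)" S n]
        mu.deviation_add_const[OF int(1) n, where c="1 / 2" and S=S] int by auto
    then show ?thesis using emp by (simp add: Z_def L_def_def)
  qed
  have "sub_gaussian_above (?P \<Otimes>\<^sub>M N) (\<lambda>S. Z (fst S)) (radH n + 2 * radR n + 2 * radR (nat \<lceil>real n * expert_error \<mu> / 2\<rceil>)) (256 / real n)"
  proof -
    obtain B where "\<And>S. S \<in> space ?P \<Longrightarrow> \<bar>Z S\<bar> \<le> B"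
      using Z by (auto simp: sub_gaussian_above_def)
    then show ?thesis
      using sub_gaussian_above_measurable[OF Z] Z
      by (intro sub_gaussian_above_pair_fst[OF P.prob_space_axioms N, where B=B]) (auto simp: space_pair_measure)
  qed
  then show ?thesis
    unfolding law_Sl_def
    by (rule PN.sub_gaussian_above_prob_ge[OF _ _ _ B])
      (use le n \<delta> measurable_compose[OF measurable_fst L_def_measurable[OF h r]] in \<open>auto simp: space_pair_measure\<close>)
qed

end

lemma measurable_rule_fst: "measurable_rule P MX g \<Longrightarrow> measurable_rule (P \<Otimes>\<^sub>M U) MX (\<lambda>S. g (fst S))"
proof -
  assume g: "measurable_rule P MX g"
  have "(\<lambda>p. (fst (fst p), snd p)) \<in> (P \<Otimes>\<^sub>M U) \<Otimes>\<^sub>M MX \<rightarrow>\<^sub>M P \<Otimes>\<^sub>M MX" by measurable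
  from measurable_compose[OF this g[unfolded measurable_rule_def]]
  show ?thesis by (simp add: measurable_rule_def case_prod_unfold)
qed

lemma measurable_rule_snd: "measurable_rule U MX g \<Longrightarrow> measurable_rule (P \<Otimes>\<^sub>M U) MX (\<lambda>S. g (snd S))"
proof -
  assume g: "measurable_rule U MX g"
  have "(\<lambda>p. (snd (fst p), snd p)) \<in> (P \<Otimes>\<^sub>M U) \<Otimes>\<^sub>M MX \<rightarrow>\<^sub>M U \<Otimes>\<^sub>M MX" by measurable
  from measurable_compose[OF this g[unfolded measurable_rule_def]]
  show ?thesis by (simp add: measurable_rule_def case_prod_unfold)
qed

section \<open>Staged learning\<close>

context deferral
begin

text \<open>
  The competitor that predicts with \<open>hs\<close> where \<open>r\<close> does not defer and with \<open>h\<close> elsewhere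
  does not beat the Bayes classifier.
\<close>

lemma classifier_excess:
  assumes opt: "optimal_classifier MX \<mu> hbar" and h: "h \<in> H" "hs \<in> H" and r: "r \<in> R"
  shows "L_def \<mu> h r - L_def \<mu> hs r \<le> (\<integral>z. loss01 h z \<partial>law2) - (\<integral>z. loss01 hbar z \<partial>law2)"
proof -
  define g where "g x = (if r x then h x else hs x)" for x
  note [measurable] = H_measurable[OF h(1)] H_measurable[OF h(2)] R_measurable[OF r]
  have g[measurable]: "g \<in> MX \<rightarrow>\<^sub>M count_space UNIV" unfolding g_def[abs_def] by measurable
  have "(\<integral>z. loss01 hbar z \<partial>law2) \<le> (\<integral>z. loss01 g z \<partial>law2)"
    using opt g by (auto simp: optimal_classifier_def is_arg_min_def law2_def not_less)
  moreover have "(\<integral>z. loss01 h z \<partial>law2) - (\<integral>z. loss01 g z \<partial>law2) = L_def \<mu> h r - L_def \<mu> hs r"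
  proof -
    have int: "integrable \<mu> (\<lambda>z. of_bool (f (fst z) \<noteq> fst (snd z)) :: real)" if "f \<in> MX \<rightarrow>\<^sub>M count_space UNIV" for f
    proof (rule mu.integrable_bounded[where B=1])
      note [measurable] = that
      show "(\<lambda>z. of_bool (f (fst z) \<noteq> fst (snd z)) :: real) \<in> borel_measurable \<mu>" by measurable
    qed simp
    have "(\<integral>z. loss01 h z \<partial>law2) - (\<integral>z. loss01 g z \<partial>law2)
        = (\<integral>z. of_bool (h (fst z) \<noteq> fst (snd z)) - of_bool (g (fst z) \<noteq> fst (snd z)) \<partial>\<mu>)"
      unfolding loss01_integral[OF H_measurable[OF h(1)]] loss01_integral[OF g]
      by (rule Bochner_Integration.integral_diff[symmetric]) (intro int H_measurable h g)+
    \<comment> \<open>Pointwise: where \<open>r\<close> defers, \<open>g\<close> is \<open>h\<close>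
      and the expert terms cancel, so both differences vanish; elsewhere \<open>g\<close> is
      \<open>hs\<close>.\<close>
    also have "\<dots> = (\<integral>z. defer_loss h r z - defer_loss hs r z \<partial>\<mu>)"
      by (intro Bochner_Integration.integral_cong) (auto simp: defer_loss_eq g_def)
    also have "\<dots> = L_def \<mu> h r - L_def \<mu> hs r"
      unfolding L_def_def by (intro Bochner_Integration.integral_diff integrable_defer_loss h r)
    finally show ?thesis .
  qed
  ultimately show ?thesis by linarith
qed

text \<open>The change of the loss when an example is deferred, positive where deferring hurts. For
  a fixed classifier the deferral loss is affine in the rejector with this coefficient, so
  differences between rejectors involve no product of two learned functions.\<close>

definition gain :: "('a \<Rightarrow> bool) \<Rightarrow> 'a \<times> bool \<times> bool \<Rightarrow> real" where
  "gain h z = of_bool (snd (snd z) \<noteq> fst (snd z)) - of_bool (h (fst z) \<noteq> fst (snd z))"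

lemma abs_gain_le: "\<bar>gain h z\<bar> \<le> 1"
  by (simp add: gain_def)

lemma defer_loss_diff:
  "defer_loss h r z - defer_loss h r' z = gain h z * of_bool (r (fst z)) - gain h z * of_bool (r' (fst z))"
  by (simp add: defer_loss_eq gain_def)

lemma gain_measurable:
  assumes [measurable]: "h \<in> MX \<rightarrow>\<^sub>M count_space UNIV" "r \<in> MX \<rightarrow>\<^sub>M count_space UNIV"
  shows "(\<lambda>z. gain h z * of_bool (r (fst z))) \<in> borel_measurable \<mu>"
  unfolding gain_def by measurable

text \<open>The comparison passes through the pair of the learned classifier and \<open>rs\<close>.
  Exchanging the rejector is judged on \<open>Sl\<close>, by \<open>X3\<close> and
  \<open>X4\<close>; exchanging the classifier, with \<open>rs\<close> kept fixed, is judged on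
  \<open>Su\<close>, by \<open>X1\<close> and \<open>X2\<close>.\<close>

lemma staged_event:
  assumes staged: "staged_rule MX \<mu> H R nl nu hh rh" and nl: "nl \<ge> 1" and nu: "nu \<ge> 1"
    and opt: "optimal_classifier MX \<mu> hbar" and hbar: "hbar \<in> H" and hs: "hs \<in> H" and rs: "rs \<in> R"
    and \<delta>: "0 < \<delta>" "\<delta> < 1"
    and B: "L_def \<mu> hs rs + (radH nu + 2 * radR nl) + 64 * sqrt (ln (1 / \<delta>) / real (min nl nu)) \<le> B"
  shows "measure (law_Sl nl \<mu> \<Otimes>\<^sub>M law_Su nu MX \<mu>)
    {S \<in> space (law_Sl nl \<mu> \<Otimes>\<^sub>M law_Su nu MX \<mu>). L_def \<mu> (hh (snd S)) (rh S) \<le> B} \<ge> 1 - \<delta>\<^sup>2"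
proof -
  let ?P = "\<Pi>\<^sub>M i\<in>{..<nl}. \<mu>" and ?U = "\<Pi>\<^sub>M i\<in>{..<nu}. law2"
  let ?\<Omega> = "?P \<Otimes>\<^sub>M ?U"
  define N where "N = real (min nl nu)"
  \<comment> \<open>Adding deviations asks for a common constant. The value \<open>4 / N\<close> is
    dictated by the learned rejector and dominates the other three.\<close>
  have N: "N > 0" "1 / real nu \<le> 4 / N" "1 / real nl \<le> 4 / N" "4 / real nl \<le> 4 / N"
    using nl nu by (auto simp: N_def intro!: frac_le)
  interpret P: prob_space ?P by (rule prob_space_PiM) (rule prob_mu)
  interpret U: prob_space ?U by (rule prob_space_PiM) (rule law2.prob_space_axioms)
  interpret PU: pair_prob_space ?P ?U ..
  have h: "measurable_rule ?U MX hh" and r: "measurable_rule ?\<Omega> MX rh"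
    and erm: "\<And>Su. Su \<in> space ?U \<Longrightarrow> staged_classifier H nu Su (hh Su)"
    and sol: "\<And>S. S \<in> space ?\<Omega> \<Longrightarrow> staged_rejector R nl (fst S) (hh (snd S)) (rh S)"
    using staged by (auto simp: staged_rule_def law_Sl_def law_Su_eq space_pair_measure)
  have hH: "hh Su \<in> H" if "Su \<in> space ?U" for Su
    using erm[OF that] by (simp add: staged_classifier_def is_arg_min_def)
  have rR: "rh S \<in> R" if "S \<in> space ?\<Omega>" for S
    using sol[OF that] by (simp add: staged_rejector_def is_arg_min_def)
  have hsnd: "measurable_rule ?\<Omega> MX (\<lambda>S. hh (snd S))"
    by (rule measurable_rule_snd[OF h])

  define X1 where "X1 Su = deviation law2 nu (loss01 (hh Su)) Su" for Su
  define X2 where "X2 Su = (\<Sum>i<nu. loss01 hbar (Su i)) / nu - (\<integral>z. loss01 hbar z \<partial>law2)" for Su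
  define X3 where "X3 S = deviation \<mu> nl (\<lambda>z. gain (hh (snd S)) z * of_bool (rh S (fst z))) (fst S)" for S
  define X4 where "X4 S = - deviation \<mu> nl (\<lambda>z. gain (hh (snd S)) z * of_bool (rs (fst z))) (fst S)" for S

  have sg1: "sub_gaussian_above ?U X1 (radH nu) (4 / N)"
  proof -
    \<comment> \<open>With these weights the 0-1 loss is \<open>1/2\<close> plus a multiple of the
      classifier coded as -1 and 1. Their modulus \<open>1/2\<close> cancels the 2 of
      symmetrization.\<close>
    let ?w = "\<lambda>z :: 'a \<times> bool. if snd z then - (1 / 2) else 1 / 2 :: real"
    let ?f = "\<lambda>(h :: 'a \<Rightarrow> bool) x. if h x then 1 else - 1 :: real"
    have "sub_gaussian_above ?U (\<lambda>Su. deviation law2 nu (\<lambda>z. ?w z * ?f (hh Su) (fst z)) Su)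
        (2 * (1 / 2) * radH nu) (4 * (1 / 2)\<^sup>2 / nu)"
    proof (rule HC.sub_gaussian_above_weighted_rule[OF law2.prob_space_axioms law2_fst_measurable law_X_eq(2)
          classifier_functions_def nu, where A=hh])
      note [measurable] = rule_measurable[OF h law2_fst_measurable]
      show "(\<lambda>(Su, z). ?w z * ?f (hh Su) (fst z)) \<in> borel_measurable (?U \<Otimes>\<^sub>M law2)"
        unfolding case_prod_unfold by measurable
    qed (use hH in auto)
    moreover have "deviation law2 nu (\<lambda>z. ?w z * ?f (hh Su) (fst z)) Su = X1 Su" if "Su \<in> space ?U" for Su
    proof -
      have "integrable law2 (\<lambda>z. ?w z * ?f (hh Su) (fst z))"
      proof (rule law2.integrable_bounded[where B=1])
        note [measurable] = H_measurable[OF hH[OF that]]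
        show "(\<lambda>z. ?w z * ?f (hh Su) (fst z)) \<in> borel_measurable law2" by measurable
      qed auto
      then have "deviation law2 nu (\<lambda>z. ?w z * ?f (hh Su) (fst z) + 1 / 2) Su
          = deviation law2 nu (\<lambda>z. ?w z * ?f (hh Su) (fst z)) Su"
        using nu by (rule law2.deviation_add_const)
      moreover have "?w z * ?f (hh Su) (fst z) + 1 / 2 = loss01 (hh Su) z" for z
        by (auto simp: loss01_eq)
      ultimately show ?thesis by (simp only: X1_def)
    qed
    ultimately have "sub_gaussian_above ?U X1 (radH nu) (1 / nu)"
      unfolding sub_gaussian_above_def
      by (simp add: power2_eq_square cong: measurable_cong Bochner_Integration.integral_cong)
    then show ?thesis
      by (rule U.sub_gaussian_above_mono) (use N in auto)
  qed
  have sg2: "sub_gaussian_above ?U X2 0 (4 / N)"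
  proof -
    have "sub_gaussian_above ?U X2 0 (1 / nu)"
      unfolding X2_def
      by (intro law2.sub_gaussian_above_sample_mean loss01_measurable H_measurable[OF hbar] nu) (simp add: loss01_eq)
    then show ?thesis
      by (rule U.sub_gaussian_above_mono) (use N in auto)
  qed

  have meas3: "(\<lambda>(S, z). gain (hh (snd S)) z * of_bool (rh S (fst z))) \<in> borel_measurable (?\<Omega> \<Otimes>\<^sub>M \<mu>)"
    and meas4: "(\<lambda>(S, z). gain (hh (snd S)) z * of_bool (rs (fst z))) \<in> borel_measurable (?\<Omega> \<Otimes>\<^sub>M \<mu>)"
  proof -
    note [measurable] = rule_measurable[OF hsnd fst_measurable] rule_measurable[OF r fst_measurable]
      R_measurable[OF rs]
    show "(\<lambda>(S, z). gain (hh (snd S)) z * of_bool (rh S (fst z))) \<in> borel_measurable (?\<Omega> \<Otimes>\<^sub>M \<mu>)"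
      "(\<lambda>(S, z). gain (hh (snd S)) z * of_bool (rs (fst z))) \<in> borel_measurable (?\<Omega> \<Otimes>\<^sub>M \<mu>)"
      unfolding gain_def case_prod_unfold by measurable
  qed
  have X3_meas: "X3 \<in> borel_measurable ?\<Omega>"
    unfolding X3_def[abs_def] using meas3 by (rule mu.deviation_measurable_pair)
  have X4_meas: "X4 \<in> borel_measurable ?\<Omega>"
    unfolding X4_def[abs_def] by (rule borel_measurable_uminus[OF mu.deviation_measurable_pair[OF meas4]])
  have g_bound: "\<bar>gain h z * of_bool b\<bar> \<le> 1" for h z b
    using abs_gain_le[of h z] by (cases b) auto
  have X34_bound: "\<bar>X3 S\<bar> \<le> 2" "\<bar>X4 S\<bar> \<le> 2" if S: "S \<in> space ?\<Omega>" for S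
  proof -
    have S': "fst S \<in> space ?P" "snd S \<in> space ?U" using S by (auto simp: space_pair_measure)
    note hm = H_measurable[OF hH[OF S'(2)]]
    have "\<bar>X3 S\<bar> \<le> 2 * 1"
      unfolding X3_def
      by (rule mu.rule_deviation_bounded[OF nl S'(1) gain_measurable[OF hm R_measurable[OF rR[OF S]]] g_bound])
    then show "\<bar>X3 S\<bar> \<le> 2" by simp
    have "\<bar>deviation \<mu> nl (\<lambda>z. gain (hh (snd S)) z * of_bool (rs (fst z))) (fst S)\<bar> \<le> 2 * 1"
      by (rule mu.rule_deviation_bounded[OF nl S'(1) gain_measurable[OF hm R_measurable[OF rs]] g_bound])
    then show "\<bar>X4 S\<bar> \<le> 2" by (simp only: X4_def abs_minus_cancel mult_1_right)
  qed
  have sg3: "sub_gaussian_above ?\<Omega> X3 (2 * radR nl) (4 / N)"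
  proof (rule sub_gaussian_above_pair_fst[OF P.prob_space_axioms U.prob_space_axioms X3_meas X34_bound(1)])
    \<comment> \<open>Once \<open>Su\<close> is fixed, the gain is a deterministic weight and
      \<open>rh\<close> is a rule in \<open>Sl\<close> alone. The resulting level does not depend on
      \<open>Su\<close>.\<close>
    fix Su assume Su: "Su \<in> space ?U"
    have pr: "(Sl, Su) \<in> space ?\<Omega>" if "Sl \<in> space ?P" for Sl using that Su by (simp add: space_pair_measure)
    have "(\<lambda>p. ((fst p, Su), snd p)) \<in> ?P \<Otimes>\<^sub>M \<mu> \<rightarrow>\<^sub>M ?\<Omega> \<Otimes>\<^sub>M \<mu>" using Su by measurable
    from measurable_compose[OF this meas3]
    have m: "(\<lambda>(Sl, z). gain (hh Su) z * of_bool (rh (Sl, Su) (fst z))) \<in> borel_measurable (?P \<Otimes>\<^sub>M \<mu>)"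
      by (simp add: case_prod_unfold)
    have "sub_gaussian_above ?P (\<lambda>Sl. deviation \<mu> nl (\<lambda>z. gain (hh Su) z * of_bool (rh (Sl, Su) (fst z))) Sl)
        (2 * 1 * radR nl) (4 * 1\<^sup>2 / nl)"
    proof (rule RC.sub_gaussian_above_weighted_rule[OF prob_mu fst_measurable law_X_eq(1)
          rejector_functions_def nl zero_less_one])
      show "(\<lambda>(Sl, z). gain (hh Su) z * of_bool (rh (Sl, Su) (fst z))) \<in> borel_measurable (?P \<Otimes>\<^sub>M \<mu>)"
        by (rule m)
    qed (use rR pr abs_gain_le in auto)
    then have "sub_gaussian_above ?P (\<lambda>Sl. X3 (Sl, Su)) (2 * radR nl) (4 / nl)"
      unfolding X3_def fst_conv snd_conv by (simp only: mult_1_right power_one)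
    then show "sub_gaussian_above ?P (\<lambda>Sl. X3 (Sl, Su)) (2 * radR nl) (4 / N)"
      by (rule P.sub_gaussian_above_mono) (use N in auto)
  qed
  have sg4: "sub_gaussian_above ?\<Omega> X4 0 (4 / N)"
  proof (rule sub_gaussian_above_pair_fst[OF P.prob_space_axioms U.prob_space_axioms X4_meas X34_bound(2)])
    fix Su assume Su: "Su \<in> space ?U"
    \<comment> \<open>The classifier was trained without \<open>Sl\<close>, so given
      \<open>Su\<close> this is the sample mean of a fixed function and carries no
      complexity.\<close>
    have "sub_gaussian_above ?P (\<lambda>Sl. (\<Sum>i<nl. gain (hh Su) (Sl i) * of_bool (rs (fst (Sl i)))) / nl
        - (\<integral>z. gain (hh Su) z * of_bool (rs (fst z)) \<partial>\<mu>)) 0 (1 / nl)"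
      by (rule mu.sub_gaussian_above_sample_mean[OF gain_measurable[OF H_measurable[OF hH[OF Su]] R_measurable[OF rs]] g_bound nl])
    then have "sub_gaussian_above ?P (\<lambda>Sl. X4 (Sl, Su)) 0 (1 / nl)"
      unfolding X4_def fst_conv snd_conv minus_diff_eq .
    then show "sub_gaussian_above ?P (\<lambda>Sl. X4 (Sl, Su)) 0 (4 / N)"
      by (rule P.sub_gaussian_above_mono) (use N in auto)
  qed
  note sg12 = sub_gaussian_above_pair_snd[OF P.prob_space_axioms U.prob_space_axioms]
  have "sub_gaussian_above ?\<Omega> (\<lambda>S. (X1 (snd S) + X2 (snd S)) + (X3 S + X4 S))
      ((radH nu + 0) + (2 * radR nl + 0)) (4 * (4 * (4 / N)))"
    by (intro PU.sub_gaussian_above_add sg12[OF sg1] sg12[OF sg2] sg3 sg4)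
  \<comment> \<open>The sum has constant \<open>64 / N\<close>; enlarging it to
    \<open>256 / N\<close> lets both learning methods share one tail bound.\<close>
  then have "sub_gaussian_above ?\<Omega> (\<lambda>S. (X1 (snd S) + X2 (snd S)) + (X3 S + X4 S))
      (radH nu + 2 * radR nl) (256 / N)"
    by (rule PU.sub_gaussian_above_mono) (use N in \<open>auto simp: field_simps\<close>)
  moreover have "L_def \<mu> (hh (snd S)) (rh S) \<le> L_def \<mu> hs rs + ((X1 (snd S) + X2 (snd S)) + (X3 S + X4 S))"
    if S: "S \<in> space ?\<Omega>" for S
  proof -
    define g where "g = hh (snd S)"
    have S': "fst S \<in> space ?P" "snd S \<in> space ?U" using S by (auto simp: space_pair_measure)
    have g: "g \<in> H" using hH[OF S'(2)] by (simp add: g_def)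
    note rr = rR[OF S]
    have "(\<Sum>i<nu. loss01 g (snd S i)) \<le> (\<Sum>i<nu. loss01 hbar (snd S i))"
      using erm[OF S'(2)] hbar by (force simp: staged_classifier_def is_arg_min_def g_def)
    then have "(\<Sum>i<nu. loss01 g (snd S i)) / nu \<le> (\<Sum>i<nu. loss01 hbar (snd S i)) / nu"
      by (rule divide_right_mono) simp
    then have "(\<integral>z. loss01 g z \<partial>law2) - (\<integral>z. loss01 hbar z \<partial>law2) \<le> X1 (snd S) + X2 (snd S)"
      by (simp add: X1_def X2_def g_def)
    with classifier_excess[OF opt g hs rs]
    have 1: "L_def \<mu> g rs - L_def \<mu> hs rs \<le> X1 (snd S) + X2 (snd S)" by linarith
    have int: "integrable \<mu> (\<lambda>z. gain g z * of_bool (q (fst z)))" if "q \<in> R" for q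
      by (rule mu.integrable_bounded[OF gain_measurable[OF H_measurable[OF g] R_measurable[OF that]] g_bound])
    have "L_def \<mu> g (rh S) - L_def \<mu> g rs = (\<integral>z. defer_loss g (rh S) z - defer_loss g rs z \<partial>\<mu>)"
      unfolding L_def_def by (intro Bochner_Integration.integral_diff[symmetric] integrable_defer_loss g rr rs)
    also have "\<dots> = (\<integral>z. gain g z * of_bool (rh S (fst z)) \<partial>\<mu>) - (\<integral>z. gain g z * of_bool (rs (fst z)) \<partial>\<mu>)"
      unfolding defer_loss_diff by (intro Bochner_Integration.integral_diff int rr rs)
    finally have E: "L_def \<mu> g (rh S) - L_def \<mu> g rs
      = (\<integral>z. gain g z * of_bool (rh S (fst z)) \<partial>\<mu>) - (\<integral>z. gain g z * of_bool (rs (fst z)) \<partial>\<mu>)" .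
    have "(\<Sum>i<nl. defer_loss g (rh S) (fst S i)) \<le> (\<Sum>i<nl. defer_loss g rs (fst S i))"
      using sol[OF S] rs by (force simp: staged_rejector_def is_arg_min_def g_def)
    then have "(\<Sum>i<nl. defer_loss g (rh S) (fst S i) - defer_loss g rs (fst S i)) \<le> 0"
      by (simp add: sum_subtractf)
    then have "(\<Sum>i<nl. gain g (fst S i) * of_bool (rh S (fst (fst S i))))
        \<le> (\<Sum>i<nl. gain g (fst S i) * of_bool (rs (fst (fst S i))))"
      unfolding defer_loss_diff by (simp add: sum_subtractf)
    then have "(\<Sum>i<nl. gain g (fst S i) * of_bool (rh S (fst (fst S i)))) / nl
        \<le> (\<Sum>i<nl. gain g (fst S i) * of_bool (rs (fst (fst S i)))) / nl"
      by (rule divide_right_mono) simp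
    with E have "L_def \<mu> g (rh S) - L_def \<mu> g rs \<le> X3 S + X4 S"
      by (simp add: X3_def X4_def flip: g_def)
    with 1 show ?thesis by (simp add: g_def)
  qed
  ultimately show ?thesis
    unfolding law_Sl_def law_Su_eq
    using B N \<delta> L_def_measurable[OF hsnd r]
    by (intro PU.sub_gaussian_above_prob_ge[where N=N]) (auto simp: N_def)
qed

end

theorem proposition1:
  shows "\<exists>C>0. \<forall>(MX :: 'a measure) \<mu> H R hbar hs rs nl nu hh rh ht rt \<delta>.
    deferral_setting MX \<mu> H R \<and>
    optimal_classifier MX \<mu> hbar \<and> hbar \<in> H \<and>
    optimal_pair \<mu> H R (hs, rs) \<and>
    nl \<ge> 1 \<and> nu \<ge> 1 \<and> 0 < \<delta> \<and> \<delta> < 1 \<and>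
    staged_rule MX \<mu> H R nl nu hh rh \<and>
    joint_rule MX \<mu> H R nl ht rt
    \<longrightarrow>
    (let p = expert_error \<mu>;
         RadH = (\<lambda>n. rademacher (law_X MX \<mu>) n (classifier_functions H));
         RadR = (\<lambda>n. rademacher (law_X MX \<mu>) n (rejector_functions R));
         \<Omega> = law_Sl nl \<mu> \<Otimes>\<^sub>M law_Su nu MX \<mu>;
         Staged = {S \<in> space \<Omega>. case S of (Sl, Su) \<Rightarrow>
           L_def \<mu> (hh Su) (rh (Sl, Su)) \<le>
             L_def \<mu> hs rs + RadH nu + 2 * RadR nl
             + 2 * min p (RadR (nat \<lceil>real nl * p / 2\<rceil>))
             + C * sqrt (ln (1 / \<delta>) / real (min nl nu))
             + p * exp (- (real nl * (p\<^sup>2 / 2)))};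
         Joint = {S \<in> space \<Omega>. case S of (Sl, Su) \<Rightarrow>
           L_def \<mu> (ht Sl) (rt Sl) \<le>
             L_def \<mu> hs rs + RadH nl + 2 * RadR nl
             + 2 * RadR (nat \<lceil>real nl * p / 2\<rceil>)
             + C * sqrt (ln (1 / \<delta>) / real nl)
             + p * exp (- (real nl * (p / 2)))}
     in measure \<Omega> Staged \<ge> 1 - \<delta> \<and>
        measure \<Omega> Joint \<ge> 1 - \<delta> \<and>
        (\<delta> \<le> 1 / 2 \<longrightarrow> measure \<Omega> (Staged \<inter> Joint) \<ge> 1 - \<delta>))"
proof (intro exI[of _ 64] conjI allI impI, goal_cases)
  case 1
  show ?case by simp
next
  case (2 MX \<mu> H R hbar hs rs nl nu hh rh ht rt \<delta>)
  then have set: "deferral_setting MX \<mu> H R" and opt: "optimal_classifier MX \<mu> hbar" and hbar: "hbar \<in> H"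
    and pair: "optimal_pair \<mu> H R (hs, rs)" and nl: "nl \<ge> 1" and nu: "nu \<ge> 1"
    and \<delta>: "0 < \<delta>" "\<delta> < 1"
    and staged: "staged_rule MX \<mu> H R nl nu hh rh" and joint: "joint_rule MX \<mu> H R nl ht rt"
    by auto
  have hs: "hs \<in> H" and rs: "rs \<in> R" using pair by (auto simp: optimal_pair_def is_arg_min_def)
  interpret deferral MX \<mu> H R
    using set hs rs by unfold_locales auto
  define p where "p = expert_error \<mu>"
  define \<Omega> where "\<Omega> = law_Sl nl \<mu> \<Otimes>\<^sub>M law_Su nu MX \<mu>"
  define Bs where "Bs = L_def \<mu> hs rs + radH nu + 2 * radR nl + 2 * min p (radR (nat \<lceil>real nl * p / 2\<rceil>))
    + 64 * sqrt (ln (1 / \<delta>) / real (min nl nu)) + p * exp (- (real nl * (p\<^sup>2 / 2)))"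
  define Bj where "Bj = L_def \<mu> hs rs + radH nl + 2 * radR nl + 2 * radR (nat \<lceil>real nl * p / 2\<rceil>)
    + 64 * sqrt (ln (1 / \<delta>) / real nl) + p * exp (- (real nl * (p / 2)))"
  define Staged where "Staged = {S \<in> space \<Omega>. L_def \<mu> (hh (snd S)) (rh S) \<le> Bs}"
  define Joint where "Joint = {S \<in> space \<Omega>. L_def \<mu> (ht (fst S)) (rt (fst S)) \<le> Bj}"
  have p: "0 \<le> p" using expert_error_bounds by (simp add: p_def)
  interpret Sl: prob_space "law_Sl nl \<mu>" by (rule prob_law_Sl)
  interpret Su: prob_space "law_Su nu MX \<mu>" by (rule prob_law_Su)
  interpret pair_prob_space "law_Sl nl \<mu>" "law_Su nu MX \<mu>" ..
  interpret \<Omega>: prob_space \<Omega> unfolding \<Omega>_def by (rule P.prob_space_axioms)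
  \<comment> \<open>The bound \<open>Bs\<close> exceeds the level controlled by
    \<open>staged_event\<close> by exactly this nonnegative amount.\<close>
  have "0 \<le> 2 * min p (radR (nat \<lceil>real nl * p / 2\<rceil>)) + p * exp (- (real nl * (p\<^sup>2 / 2)))"
    using p RC.rademacher_nonneg by simp
  then have S: "1 - \<delta>\<^sup>2 \<le> measure \<Omega> Staged"
    unfolding Staged_def \<Omega>_def
    by (intro staged_event[OF staged nl nu opt hbar hs rs \<delta>]) (simp add: Bs_def)
  have J: "1 - \<delta>\<^sup>2 \<le> measure \<Omega> Joint"
    unfolding Joint_def \<Omega>_def using p
    by (intro joint_event[OF joint nl hs rs prob_law_Su \<delta>]) (simp add: Bj_def p_def)
  have "Staged \<in> sets \<Omega>" "Joint \<in> sets \<Omega>"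
  proof -
    have "measurable_rule \<Omega> MX (\<lambda>S. hh (snd S))" "measurable_rule \<Omega> MX rh"
      "measurable_rule \<Omega> MX (\<lambda>S. ht (fst S))" "measurable_rule \<Omega> MX (\<lambda>S. rt (fst S))"
      using staged joint unfolding \<Omega>_def staged_rule_def joint_rule_def
      by (auto intro: measurable_rule_fst measurable_rule_snd)
    then have [measurable]: "(\<lambda>S. L_def \<mu> (hh (snd S)) (rh S)) \<in> borel_measurable \<Omega>"
      "(\<lambda>S. L_def \<mu> (ht (fst S)) (rt (fst S))) \<in> borel_measurable \<Omega>"
      by (auto intro: L_def_measurable)
    show "Staged \<in> sets \<Omega>" "Joint \<in> sets \<Omega>"
      unfolding Staged_def Joint_def by measurable
  qed
  \<comment> \<open>Each event fails with probability at most \<open>\<delta>\<^sup>2\<close>; the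
    union bound is affordable because \<open>2 * \<delta>\<^sup>2 \<le> \<delta>\<close> as soon as
    \<open>\<delta> \<le> 1 / 2\<close>.\<close>
  then have "1 - 2 * \<delta>\<^sup>2 \<le> measure \<Omega> (Staged \<inter> Joint)"
    using S J \<Omega>.finite_measure_Diff'[of Staged Joint] \<Omega>.finite_measure_Union[of Joint "Staged - Joint"]
      \<Omega>.prob_le_1[of "Joint \<union> (Staged - Joint)"] by auto
  moreover have "\<delta>\<^sup>2 \<le> \<delta>" using \<delta> by (simp add: power2_eq_square)
  moreover have "2 * \<delta>\<^sup>2 \<le> \<delta>" if "\<delta> \<le> 1 / 2"
    using mult_right_mono[OF that, of "2 * \<delta>"] \<delta> by (simp add: power2_eq_square)
  ultimately have "1 - \<delta> \<le> measure \<Omega> Staged \<and> 1 - \<delta> \<le> measure \<Omega> Joint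
      \<and> (\<delta> \<le> 1 / 2 \<longrightarrow> 1 - \<delta> \<le> measure \<Omega> (Staged \<inter> Joint))"
    using S J by force
  then show ?case
    unfolding Let_def Staged_def Joint_def Bs_def Bj_def \<Omega>_def p_def by (simp add: case_prod_unfold)
qed

end
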